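(* The system $\mathsf B_0+\mathsf{QF\text{-}AC}^{2,1}$ proves $\mathsf{WKL}\leftrightarrow\mathsf{WKL}^{\mathrm{st}}$.
   Context: Finite types are generated from $0$ (natural numbers) by $\to$; type $n+1$ is $n\to0$; superscripts on variables denote types. $\mathsf{E\text{-}EFA}^\omega$ is the extensional finite-type arithmetic of first-order strength $\mathsf{EFA}=I\Delta_0+\mathrm{EXP}$, namely Kohlenbach's system $\mathsf{E\text{-}G}_3\mathsf A^\omega$ ("Applied Proof Theory", Ch. 3). The nonstandard language adds unary predicates $\mathrm{st}^\sigma$ and quantifiers $\forall^{\mathrm{st}}x^\sigma,\exists^{\mathrm{st}}x^\sigma$ for every finite type $\sigma$; formulas without these symbols are called internal. $\mathsf{E\text{-}EFA}^{\omega}_{\mathrm{st}}$ is $\mathsf{E\text{-}EFA}^\omega$ plus: (EQ) $\forall^{\mathrm{st}}x\,\Phi(x)\leftrightarrow\forall x(\mathrm{st}(x)\to\Phi(x))$ and $\exists^{\mathrm{st}}x\,\Phi(x)\leftrightarrow\exists x(\mathrm{st}(x)\wedge\Phi(x))$ for arbitrary $\Phi$; ($\mathcal T_{\mathrm{st}}$) $\mathrm{st}(x)\wedge x=y\to\mathrm{st}(y)$; $\mathrm{st}(t)$ for each closed term $t$; $\mathrm{st}(f)\wedge\mathrm{st}(x)\to\mathrm{st}(fx)$; $\mathrm{st}^0(x)\wedge y\le x\to\mathrm{st}^0(y)$. Finite sequences of objects of type $\sigma$ are coded as single objects of type $\sigma$, such that every object codes a finite sequence; $x\in y$ means $x$ equals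 a component of the sequence coded by $y$; $\cup$ is concatenation; for $Y$ of type $\sigma\to\tau$, $Y[x]:=\bigcup_{f\in Y}f(x)$. Further axioms ($\varphi$ internal; $A$ quantifier-free internal): ($\mathsf I$) $\forall^{\mathrm{st}}y'\,\exists x\,\forall y\in y'\,\varphi(x,y)\to\exists x\,\forall^{\mathrm{st}}y\,\varphi(x,y)$; ($\mathsf{HAC}_{\mathrm{int}}$) $\forall^{\mathrm{st}}x^\sigma\,\exists^{\mathrm{st}}y^\tau\,\varphi(x,y)\to\exists^{\mathrm{st}}Y^{\sigma\to\tau}\,\forall^{\mathrm{st}}x^\sigma\,\exists y^\tau\in Y[x]\ \varphi(x,y)$ (parameters allowed in both); ($\mathsf{PF\text{-}TP}_\forall$) $\forall^{\mathrm{st}}\underline x\,\varphi(\underline x)\to\forall\underline x\,\varphi(\underline x)$, where $\varphi(\underline x)$ has no free variables besides $\underline x$; ($\mathsf{QF\text{-}AC}^{\sigma,\tau}$) $(\forall x^\sigma)(\exists y^\tau)A(x,y)\to(\exists Y^{\sigma\to\tau})(\forall x^\sigma)A(x,Y(x))$ (tuples of variables of the indicated type levels are allowed). $\mathsf B_0:=\mathsf{E\text{-}EFA}^{\omega}_{\mathrm{st}}+\mathsf I+\mathsf{HAC}_{\mathrm{int}}+\mathsf{PF\text{-}TP}_\forall+\mathsf{QF\text{-}AC}^{1,0}$. $\mathsf{WKL}$ (weak König's lemma) states that every infinite binary tree has a path: $(\forall T\le_11)\big[(\forall n^0)(\exists\beta^0)(|\beta|=n\wedge\beta\in T)\to(\exists\alpha^1\le_11)(\forall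 n^0)(\overline\alpha n\in T)\big]$. Here "$T\le_11$" means that the type $1$ object $T$ is (the characteristic function of) a binary tree, $\alpha\le_11$ means $(\forall n^0)(\alpha(n)\le1)$, $|\beta|$ is the length of the finite (binary) sequence coded by $\beta^0$, and $\overline\alpha n=\langle\alpha(0),\dots,\alpha(n-1)\rangle$. $\mathsf{WKL}^{\mathrm{st}}$ is obtained from $\mathsf{WKL}$ by relativizing all quantifiers (except bounded number quantifiers) to "st". *)

theory Defs
  imports Main
begin

section \<open>Finite types, terms and formulas\<close>

datatype ty = Base ("\<zero>") | Fun ty ty (infixr "\<rightarrow>" 70)

abbreviation one_ty :: ty  ("\<one>") where "\<one> \<equiv> \<zero> \<rightarrow> \<zero>"

fun level :: "ty \<Rightarrow> nat" where
  "level \<zero> = 0"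
| "level (\<sigma> \<rightarrow> \<tau>) = max (level \<sigma> + 1) (level \<tau>)"

fun args :: "ty \<Rightarrow> ty list" where
  "args \<zero> = []"
| "args (\<sigma> \<rightarrow> \<tau>) = \<sigma> # args \<tau>"

text \<open>
  The constants of Kohlenbach's system for the third level of the Ackermann hierarchy:
  zero, successor, the combinators \<open>\<Pi>\<close> and \<open>\<Sigma>\<close>, binary maximum and minimum, the
  branches \<open>A\<^sub>0, \<dots>, A\<^sub>3\<close> of the Ackermann function (successor in the second argument, sum,
  product, power), the functionals \<open>\<Phi>\<^sub>1, \<Phi>\<^sub>2, \<Phi>\<^sub>3\<close> (maximum, sum and product of
  \<open>f 0, \<dots>, f x\<close>), bounded search, and the predicative bounded recursor of each type.
\<close>

datatype cnst =
    Zero | Succ | Pi ty ty | Sig ty ty ty | Max0 | Min0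
  | A0 | A1 | A2 | A3 | Phi1 | Phi2 | Phi3 | Mub | Rec ty

fun cty :: "cnst \<Rightarrow> ty" where
  "cty Zero = \<zero>"
| "cty Succ = \<zero> \<rightarrow> \<zero>"
| "cty (Pi \<rho> \<tau>) = \<rho> \<rightarrow> \<tau> \<rightarrow> \<rho>"
| "cty (Sig \<delta> \<rho> \<tau>) = (\<delta> \<rightarrow> \<rho> \<rightarrow> \<tau>) \<rightarrow> (\<delta> \<rightarrow> \<rho>) \<rightarrow> \<delta> \<rightarrow> \<tau>"
| "cty Max0 = \<zero> \<rightarrow> \<zero> \<rightarrow> \<zero>"
| "cty Min0 = \<zero> \<rightarrow> \<zero> \<rightarrow> \<zero>"
| "cty A0 = \<zero> \<rightarrow> \<zero> \<rightarrow> \<zero>"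
| "cty A1 = \<zero> \<rightarrow> \<zero> \<rightarrow> \<zero>"
| "cty A2 = \<zero> \<rightarrow> \<zero> \<rightarrow> \<zero>"
| "cty A3 = \<zero> \<rightarrow> \<zero> \<rightarrow> \<zero>"
| "cty Phi1 = \<one> \<rightarrow> \<zero> \<rightarrow> \<zero>"
| "cty Phi2 = \<one> \<rightarrow> \<zero> \<rightarrow> \<zero>"
| "cty Phi3 = \<one> \<rightarrow> \<zero> \<rightarrow> \<zero>"
| "cty Mub = (\<zero> \<rightarrow> \<zero> \<rightarrow> \<zero>) \<rightarrow> \<zero> \<rightarrow> \<zero>"
| "cty (Rec \<rho>) = \<zero> \<rightarrow> \<rho> \<rightarrow> (\<zero> \<rightarrow> \<zero> \<rightarrow> \<rho>) \<rightarrow> (\<zero> \<rightarrow> \<rho>) \<rightarrow> \<rho>"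

text \<open>
  Variables are de Bruijn indices. A context is the list of the types of the variables, the
  innermost (most recently bound) variable first.
\<close>

datatype trm = Var nat | Cst cnst | App trm trm  (infixl "\<cdot>" 90)

fun tyof :: "ty list \<Rightarrow> trm \<Rightarrow> ty option" where
  "tyof E (Var n) = (if n < length E then Some (E ! n) else None)"
| "tyof E (Cst c) = Some (cty c)"
| "tyof E (s \<cdot> t) =
    (case tyof E s of
       Some (\<sigma> \<rightarrow> \<tau>) \<Rightarrow> (if tyof E t = Some \<sigma> then Some \<tau> else None)
     | _ \<Rightarrow> None)"

abbreviation has_type :: "ty list \<Rightarrow> trm \<Rightarrow> ty \<Rightarrow> bool"  ("(_ \<turnstile> _ \<Colon> _)" [51, 51, 51] 50) where
  "E \<turnstile> t \<Colon> \<sigma> \<equiv> tyof E t = Some \<sigma>"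

fun substt :: "(nat \<Rightarrow> trm) \<Rightarrow> trm \<Rightarrow> trm" where
  "substt f (Var n) = f n"
| "substt f (Cst c) = Cst c"
| "substt f (s \<cdot> t) = substt f s \<cdot> substt f t"

definition liftn :: "nat \<Rightarrow> trm \<Rightarrow> trm" where
  "liftn k = substt (\<lambda>n. Var (n + k))"

abbreviation lift :: "trm \<Rightarrow> trm" where "lift \<equiv> liftn 1"

abbreviation zer :: trm where "zer \<equiv> Cst Zero"
abbreviation suc :: "trm \<Rightarrow> trm" where "suc t \<equiv> Cst Succ \<cdot> t"
abbreviation num1 :: trm where "num1 \<equiv> suc zer"

datatype form =
    Eq trm trm            (infix "\<^bold>=" 60)
  | Le trm trm            (infix "\<^bold>\<le>" 60)
  | St ty trm
  | Fls                   ("\<^bold>\<bottom>")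
  | And form form         (infixr "\<^bold>\<and>" 55)
  | Or form form          (infixr "\<^bold>\<or>" 54)
  | Imp form form         (infixr "\<^bold>\<longrightarrow>" 53)
  | All ty form
  | Ex ty form
  | AllSt ty form
  | ExSt ty form

abbreviation Lt :: "trm \<Rightarrow> trm \<Rightarrow> form"  (infix "\<^bold><" 60) where
  "s \<^bold>< t \<equiv> suc s \<^bold>\<le> t"
abbreviation Neg :: "form \<Rightarrow> form"  ("\<^bold>\<not> _" [57] 57) where
  "\<^bold>\<not> \<phi> \<equiv> \<phi> \<^bold>\<longrightarrow> \<^bold>\<bottom>"
abbreviation Iff :: "form \<Rightarrow> form \<Rightarrow> form"  (infix "\<^bold>\<longleftrightarrow>" 52) where
  "\<phi> \<^bold>\<longleftrightarrow> \<psi> \<equiv> (\<phi> \<^bold>\<longrightarrow> \<psi>) \<^bold>\<and> (\<psi> \<^bold>\<longrightarrow> \<phi>)"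

fun wff :: "ty list \<Rightarrow> form \<Rightarrow> bool" where
  "wff E (s \<^bold>= t) \<longleftrightarrow> E \<turnstile> s \<Colon> \<zero> \<and> E \<turnstile> t \<Colon> \<zero>"
| "wff E (s \<^bold>\<le> t) \<longleftrightarrow> E \<turnstile> s \<Colon> \<zero> \<and> E \<turnstile> t \<Colon> \<zero>"
| "wff E (St \<sigma> t) \<longleftrightarrow> E \<turnstile> t \<Colon> \<sigma>"
| "wff E \<^bold>\<bottom> \<longleftrightarrow> True"
| "wff E (\<phi> \<^bold>\<and> \<psi>) \<longleftrightarrow> wff E \<phi> \<and> wff E \<psi>"
| "wff E (\<phi> \<^bold>\<or> \<psi>) \<longleftrightarrow> wff E \<phi> \<and> wff E \<psi>"
| "wff E (\<phi> \<^bold>\<longrightarrow> \<psi>) \<longleftrightarrow> wff E \<phi> \<and> wff E \<psi>"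
| "wff E (All \<sigma> \<phi>) \<longleftrightarrow> wff (\<sigma> # E) \<phi>"
| "wff E (Ex \<sigma> \<phi>) \<longleftrightarrow> wff (\<sigma> # E) \<phi>"
| "wff E (AllSt \<sigma> \<phi>) \<longleftrightarrow> wff (\<sigma> # E) \<phi>"
| "wff E (ExSt \<sigma> \<phi>) \<longleftrightarrow> wff (\<sigma> # E) \<phi>"

fun internal :: "form \<Rightarrow> bool" where
  "internal (s \<^bold>= t) \<longleftrightarrow> True"
| "internal (s \<^bold>\<le> t) \<longleftrightarrow> True"
| "internal (St \<sigma> t) \<longleftrightarrow> False"
| "internal \<^bold>\<bottom> \<longleftrightarrow> True"
| "internal (\<phi> \<^bold>\<and> \<psi>) \<longleftrightarrow> internal \<phi> \<and> internal \<psi>"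
| "internal (\<phi> \<^bold>\<or> \<psi>) \<longleftrightarrow> internal \<phi> \<and> internal \<psi>"
| "internal (\<phi> \<^bold>\<longrightarrow> \<psi>) \<longleftrightarrow> internal \<phi> \<and> internal \<psi>"
| "internal (All \<sigma> \<phi>) \<longleftrightarrow> internal \<phi>"
| "internal (Ex \<sigma> \<phi>) \<longleftrightarrow> internal \<phi>"
| "internal (AllSt \<sigma> \<phi>) \<longleftrightarrow> False"
| "internal (ExSt \<sigma> \<phi>) \<longleftrightarrow> False"

text \<open>Quantifier-free internal formulas; the only prime formulas are those of type \<open>0\<close>.\<close>

fun qf :: "form \<Rightarrow> bool" where
  "qf (s \<^bold>= t) \<longleftrightarrow> True"
| "qf (s \<^bold>\<le> t) \<longleftrightarrow> True"
| "qf \<^bold>\<bottom> \<longleftrightarrow> True"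
| "qf (\<phi> \<^bold>\<and> \<psi>) \<longleftrightarrow> qf \<phi> \<and> qf \<psi>"
| "qf (\<phi> \<^bold>\<or> \<psi>) \<longleftrightarrow> qf \<phi> \<and> qf \<psi>"
| "qf (\<phi> \<^bold>\<longrightarrow> \<psi>) \<longleftrightarrow> qf \<phi> \<and> qf \<psi>"
| "qf _ \<longleftrightarrow> False"

definition under :: "(nat \<Rightarrow> trm) \<Rightarrow> nat \<Rightarrow> trm" where
  "under f = case_nat (Var 0) (\<lambda>n. lift (f n))"

fun subst :: "(nat \<Rightarrow> trm) \<Rightarrow> form \<Rightarrow> form" where
  "subst f (s \<^bold>= t) = (substt f s \<^bold>= substt f t)"
| "subst f (s \<^bold>\<le> t) = (substt f s \<^bold>\<le> substt f t)"
| "subst f (St \<sigma> t) = St \<sigma> (substt f t)"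
| "subst f \<^bold>\<bottom> = \<^bold>\<bottom>"
| "subst f (\<phi> \<^bold>\<and> \<psi>) = (subst f \<phi> \<^bold>\<and> subst f \<psi>)"
| "subst f (\<phi> \<^bold>\<or> \<psi>) = (subst f \<phi> \<^bold>\<or> subst f \<psi>)"
| "subst f (\<phi> \<^bold>\<longrightarrow> \<psi>) = (subst f \<phi> \<^bold>\<longrightarrow> subst f \<psi>)"
| "subst f (All \<sigma> \<phi>) = All \<sigma> (subst (under f) \<phi>)"
| "subst f (Ex \<sigma> \<phi>) = Ex \<sigma> (subst (under f) \<phi>)"
| "subst f (AllSt \<sigma> \<phi>) = AllSt \<sigma> (subst (under f) \<phi>)"
| "subst f (ExSt \<sigma> \<phi>) = ExSt \<sigma> (subst (under f) \<phi>)"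

abbreviation rename :: "(nat \<Rightarrow> nat) \<Rightarrow> form \<Rightarrow> form" where
  "rename r \<equiv> subst (\<lambda>n. Var (r n))"

abbreviation liftf :: "form \<Rightarrow> form" where "liftf \<equiv> rename Suc"

definition inst :: "form \<Rightarrow> trm \<Rightarrow> form" where
  "inst \<phi> t = subst (case_nat t Var) \<phi>"

text \<open>Blocks of quantifiers, given by the context they bind (innermost variable first).\<close>

fun binds :: "(ty \<Rightarrow> form \<Rightarrow> form) \<Rightarrow> ty list \<Rightarrow> form \<Rightarrow> form" where
  "binds Q [] \<phi> = \<phi>"
| "binds Q (\<sigma> # \<Delta>) \<phi> = binds Q \<Delta> (Q \<sigma> \<phi>)"

text \<open>\<open>t x\<^sub>1 \<dots> x\<^sub>k\<close> for the \<open>k\<close> innermost variables, the outermost of which is \<open>x\<^sub>1\<close>.\<close>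

definition app_vars :: "trm \<Rightarrow> nat \<Rightarrow> trm" where
  "app_vars t k = foldl App t (map Var (rev [0..<k]))"

text \<open>Equality of higher type is extensional equality.\<close>

fun eqt :: "ty \<Rightarrow> trm \<Rightarrow> trm \<Rightarrow> form" where
  "eqt \<zero> s t = (s \<^bold>= t)"
| "eqt (\<sigma> \<rightarrow> \<tau>) s t = All \<sigma> (eqt \<tau> (lift s \<cdot> Var 0) (lift t \<cdot> Var 0))"


section \<open>Many-sorted classical logic\<close>

text \<open>
  Natural deduction. A theory is a set of pairs \<open>(E, \<phi>)\<close>: the formula \<open>\<phi>\<close>, with parameters from
  the context \<open>E\<close>, is an axiom. The standard quantifiers have no logical rules of their own;
  they are governed by the axioms (EQ).
\<close>

type_synonym thy = "(ty list \<times> form) set"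

inductive deriv :: "thy \<Rightarrow> ty list \<Rightarrow> form list \<Rightarrow> form \<Rightarrow> bool" for T where
  Axiom: "(E, \<phi>) \<in> T \<Longrightarrow> deriv T E \<Gamma> \<phi>"
| Hyp: "\<phi> \<in> set \<Gamma> \<Longrightarrow> deriv T E \<Gamma> \<phi>"
| Contr: "wff E \<phi> \<Longrightarrow> deriv T E ((\<^bold>\<not> \<phi>) # \<Gamma>) \<^bold>\<bottom> \<Longrightarrow> deriv T E \<Gamma> \<phi>"
| AndI: "deriv T E \<Gamma> \<phi> \<Longrightarrow> deriv T E \<Gamma> \<psi> \<Longrightarrow> deriv T E \<Gamma> (\<phi> \<^bold>\<and> \<psi>)"
| AndE1: "deriv T E \<Gamma> (\<phi> \<^bold>\<and> \<psi>) \<Longrightarrow> deriv T E \<Gamma> \<phi>"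
| AndE2: "deriv T E \<Gamma> (\<phi> \<^bold>\<and> \<psi>) \<Longrightarrow> deriv T E \<Gamma> \<psi>"
| OrI1: "wff E \<psi> \<Longrightarrow> deriv T E \<Gamma> \<phi> \<Longrightarrow> deriv T E \<Gamma> (\<phi> \<^bold>\<or> \<psi>)"
| OrI2: "wff E \<phi> \<Longrightarrow> deriv T E \<Gamma> \<psi> \<Longrightarrow> deriv T E \<Gamma> (\<phi> \<^bold>\<or> \<psi>)"
| OrE: "deriv T E \<Gamma> (\<phi> \<^bold>\<or> \<psi>) \<Longrightarrow> deriv T E (\<phi> # \<Gamma>) \<chi> \<Longrightarrow> deriv T E (\<psi> # \<Gamma>) \<chi> \<Longrightarrow> deriv T E \<Gamma> \<chi>"
| ImpI: "wff E \<phi> \<Longrightarrow> deriv T E (\<phi> # \<Gamma>) \<psi> \<Longrightarrow> deriv T E \<Gamma> (\<phi> \<^bold>\<longrightarrow> \<psi>)"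
| ImpE: "deriv T E \<Gamma> (\<phi> \<^bold>\<longrightarrow> \<psi>) \<Longrightarrow> deriv T E \<Gamma> \<phi> \<Longrightarrow> deriv T E \<Gamma> \<psi>"
| AllI: "deriv T (\<sigma> # E) (map liftf \<Gamma>) \<phi> \<Longrightarrow> deriv T E \<Gamma> (All \<sigma> \<phi>)"
| AllE: "deriv T E \<Gamma> (All \<sigma> \<phi>) \<Longrightarrow> E \<turnstile> t \<Colon> \<sigma> \<Longrightarrow> deriv T E \<Gamma> (inst \<phi> t)"
| ExI: "wff (\<sigma> # E) \<phi> \<Longrightarrow> E \<turnstile> t \<Colon> \<sigma> \<Longrightarrow> deriv T E \<Gamma> (inst \<phi> t) \<Longrightarrow> deriv T E \<Gamma> (Ex \<sigma> \<phi>)"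
| ExE: "deriv T E \<Gamma> (Ex \<sigma> \<phi>) \<Longrightarrow> wff E \<chi> \<Longrightarrow> deriv T (\<sigma> # E) (\<phi> # map liftf \<Gamma>) (liftf \<chi>)
    \<Longrightarrow> deriv T E \<Gamma> \<chi>"

definition proves :: "thy \<Rightarrow> form \<Rightarrow> bool"  (infix "\<tturnstile>" 50) where
  "T \<tturnstile> \<phi> \<longleftrightarrow> deriv T [] [] \<phi>"


section \<open>Extensional elementary arithmetic in all finite types\<close>

text \<open>
  \<open>R 0 y z v w = y w\<close> and \<open>R (x + 1) y z v w = min (z (R x y z v w) x w) (v x w)\<close>, where the
  tuple \<open>w\<close> of arguments makes all these terms of type \<open>0\<close>.
\<close>

definition rec_step :: "ty \<Rightarrow> trm \<Rightarrow> trm \<Rightarrow> trm \<Rightarrow> trm \<Rightarrow> form" where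
  "rec_step \<rho> x y z v =
    (let k = length (args \<rho>);
         r = (\<lambda>x. app_vars (liftn k (Cst (Rec \<rho>) \<cdot> x \<cdot> y \<cdot> z \<cdot> v)) k)
     in binds All (rev (args \<rho>))
          (r (suc x) \<^bold>= Cst Min0 \<cdot> app_vars (liftn k z \<cdot> r x \<cdot> liftn k x) k
                               \<cdot> app_vars (liftn k (v \<cdot> x)) k))"

inductive_set efa :: thy where
  eq_refl: "E \<turnstile> s \<Colon> \<zero> \<Longrightarrow> (E, s \<^bold>= s) \<in> efa"
| eq_sym: "\<lbrakk>E \<turnstile> s \<Colon> \<zero>; E \<turnstile> t \<Colon> \<zero>\<rbrakk> \<Longrightarrow> (E, s \<^bold>= t \<^bold>\<longrightarrow> t \<^bold>= s) \<in> efa"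
| eq_trans: "\<lbrakk>E \<turnstile> s \<Colon> \<zero>; E \<turnstile> t \<Colon> \<zero>; E \<turnstile> u \<Colon> \<zero>\<rbrakk>
    \<Longrightarrow> (E, s \<^bold>= t \<^bold>\<longrightarrow> t \<^bold>= u \<^bold>\<longrightarrow> s \<^bold>= u) \<in> efa"
| eq_le: "\<lbrakk>E \<turnstile> s \<Colon> \<zero>; E \<turnstile> t \<Colon> \<zero>; E \<turnstile> s' \<Colon> \<zero>; E \<turnstile> t' \<Colon> \<zero>\<rbrakk>
    \<Longrightarrow> (E, s \<^bold>= s' \<^bold>\<longrightarrow> t \<^bold>= t' \<^bold>\<longrightarrow> s \<^bold>\<le> t \<^bold>\<longrightarrow> s' \<^bold>\<le> t') \<in> efa"
| ext: "\<lbrakk>E \<turnstile> s \<Colon> \<rho>; E \<turnstile> t \<Colon> \<rho>; E \<turnstile> f \<Colon> \<rho> \<rightarrow> \<tau>\<rbrakk>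
    \<Longrightarrow> (E, eqt \<rho> s t \<^bold>\<longrightarrow> eqt \<tau> (f \<cdot> s) (f \<cdot> t)) \<in> efa"
| suc_inj: "\<lbrakk>E \<turnstile> s \<Colon> \<zero>; E \<turnstile> t \<Colon> \<zero>\<rbrakk> \<Longrightarrow> (E, suc s \<^bold>= suc t \<^bold>\<longrightarrow> s \<^bold>= t) \<in> efa"
| suc_not_zero: "E \<turnstile> s \<Colon> \<zero> \<Longrightarrow> (E, \<^bold>\<not> (suc s \<^bold>= zer)) \<in> efa"
| le_refl: "E \<turnstile> s \<Colon> \<zero> \<Longrightarrow> (E, s \<^bold>\<le> s) \<in> efa"
| le_trans: "\<lbrakk>E \<turnstile> s \<Colon> \<zero>; E \<turnstile> t \<Colon> \<zero>; E \<turnstile> u \<Colon> \<zero>\<rbrakk>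
    \<Longrightarrow> (E, s \<^bold>\<le> t \<^bold>\<longrightarrow> t \<^bold>\<le> u \<^bold>\<longrightarrow> s \<^bold>\<le> u) \<in> efa"
| le_antisym: "\<lbrakk>E \<turnstile> s \<Colon> \<zero>; E \<turnstile> t \<Colon> \<zero>\<rbrakk> \<Longrightarrow> (E, s \<^bold>\<le> t \<^bold>\<longrightarrow> t \<^bold>\<le> s \<^bold>\<longrightarrow> s \<^bold>= t) \<in> efa"
| le_linear: "\<lbrakk>E \<turnstile> s \<Colon> \<zero>; E \<turnstile> t \<Colon> \<zero>\<rbrakk> \<Longrightarrow> (E, s \<^bold>\<le> t \<^bold>\<or> t \<^bold>\<le> s) \<in> efa"
| zero_le: "E \<turnstile> s \<Colon> \<zero> \<Longrightarrow> (E, zer \<^bold>\<le> s) \<in> efa"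
| le_suc: "\<lbrakk>E \<turnstile> s \<Colon> \<zero>; E \<turnstile> t \<Colon> \<zero>\<rbrakk>
    \<Longrightarrow> (E, s \<^bold>\<le> suc t \<^bold>\<longleftrightarrow> (s \<^bold>\<le> t \<^bold>\<or> s \<^bold>= suc t)) \<in> efa"
| pi: "\<lbrakk>E \<turnstile> s \<Colon> \<rho>; E \<turnstile> t \<Colon> \<tau>\<rbrakk> \<Longrightarrow> (E, eqt \<rho> (Cst (Pi \<rho> \<tau>) \<cdot> s \<cdot> t) s) \<in> efa"
| sig: "\<lbrakk>E \<turnstile> s \<Colon> \<delta> \<rightarrow> \<rho> \<rightarrow> \<tau>; E \<turnstile> t \<Colon> \<delta> \<rightarrow> \<rho>; E \<turnstile> u \<Colon> \<delta>\<rbrakk>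
    \<Longrightarrow> (E, eqt \<tau> (Cst (Sig \<delta> \<rho> \<tau>) \<cdot> s \<cdot> t \<cdot> u) (s \<cdot> u \<cdot> (t \<cdot> u))) \<in> efa"
| max: "\<lbrakk>E \<turnstile> s \<Colon> \<zero>; E \<turnstile> t \<Colon> \<zero>; m = Cst Max0 \<cdot> s \<cdot> t\<rbrakk>
    \<Longrightarrow> (E, s \<^bold>\<le> m \<^bold>\<and> t \<^bold>\<le> m \<^bold>\<and> (m \<^bold>= s \<^bold>\<or> m \<^bold>= t)) \<in> efa"
| min: "\<lbrakk>E \<turnstile> s \<Colon> \<zero>; E \<turnstile> t \<Colon> \<zero>; m = Cst Min0 \<cdot> s \<cdot> t\<rbrakk>
    \<Longrightarrow> (E, m \<^bold>\<le> s \<^bold>\<and> m \<^bold>\<le> t \<^bold>\<and> (m \<^bold>= s \<^bold>\<or> m \<^bold>= t)) \<in> efa"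
| A0: "\<lbrakk>E \<turnstile> s \<Colon> \<zero>; E \<turnstile> t \<Colon> \<zero>\<rbrakk> \<Longrightarrow> (E, Cst A0 \<cdot> s \<cdot> t \<^bold>= suc t) \<in> efa"
| A1_zero: "E \<turnstile> s \<Colon> \<zero> \<Longrightarrow> (E, Cst A1 \<cdot> s \<cdot> zer \<^bold>= s) \<in> efa"
| A2_zero: "E \<turnstile> s \<Colon> \<zero> \<Longrightarrow> (E, Cst A2 \<cdot> s \<cdot> zer \<^bold>= zer) \<in> efa"
| A3_zero: "E \<turnstile> s \<Colon> \<zero> \<Longrightarrow> (E, Cst A3 \<cdot> s \<cdot> zer \<^bold>= num1) \<in> efa"
| A_suc: "\<lbrakk>E \<turnstile> s \<Colon> \<zero>; E \<turnstile> t \<Colon> \<zero>; (A, B) \<in> {(A0, A1), (A1, A2), (A2, A3)}\<rbrakk>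
    \<Longrightarrow> (E, Cst B \<cdot> s \<cdot> suc t \<^bold>= Cst A \<cdot> s \<cdot> (Cst B \<cdot> s \<cdot> t)) \<in> efa"
| Phi_zero: "\<lbrakk>E \<turnstile> f \<Colon> \<one>; P \<in> {Phi1, Phi2, Phi3}\<rbrakk> \<Longrightarrow> (E, Cst P \<cdot> f \<cdot> zer \<^bold>= f \<cdot> zer) \<in> efa"
| Phi_suc: "\<lbrakk>E \<turnstile> f \<Colon> \<one>; E \<turnstile> t \<Colon> \<zero>; (A, P) \<in> {(Max0, Phi1), (A1, Phi2), (A2, Phi3)}\<rbrakk>
    \<Longrightarrow> (E, Cst P \<cdot> f \<cdot> suc t \<^bold>= Cst A \<cdot> (f \<cdot> suc t) \<cdot> (Cst P \<cdot> f \<cdot> t)) \<in> efa"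
| mub_root: "\<lbrakk>E \<turnstile> f \<Colon> \<zero> \<rightarrow> \<zero> \<rightarrow> \<zero>; E \<turnstile> s \<Colon> \<zero>; E \<turnstile> t \<Colon> \<zero>; m = Cst Mub \<cdot> f \<cdot> s\<rbrakk>
    \<Longrightarrow> (E, t \<^bold>\<le> s \<^bold>\<and> f \<cdot> s \<cdot> t \<^bold>= zer \<^bold>\<longrightarrow> f \<cdot> s \<cdot> m \<^bold>= zer) \<in> efa"
| mub_least: "\<lbrakk>E \<turnstile> f \<Colon> \<zero> \<rightarrow> \<zero> \<rightarrow> \<zero>; E \<turnstile> s \<Colon> \<zero>; E \<turnstile> t \<Colon> \<zero>; m = Cst Mub \<cdot> f \<cdot> s\<rbrakk>
    \<Longrightarrow> (E, t \<^bold>< m \<^bold>\<longrightarrow> \<^bold>\<not> (f \<cdot> s \<cdot> t \<^bold>= zer)) \<in> efa"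
| mub_bound: "\<lbrakk>E \<turnstile> f \<Colon> \<zero> \<rightarrow> \<zero> \<rightarrow> \<zero>; E \<turnstile> s \<Colon> \<zero>; m = Cst Mub \<cdot> f \<cdot> s\<rbrakk>
    \<Longrightarrow> (E, m \<^bold>= zer \<^bold>\<or> (f \<cdot> s \<cdot> m \<^bold>= zer \<^bold>\<and> m \<^bold>\<le> s)) \<in> efa"
| rec_zero: "\<lbrakk>E \<turnstile> y \<Colon> \<rho>; E \<turnstile> z \<Colon> \<zero> \<rightarrow> \<zero> \<rightarrow> \<rho>; E \<turnstile> v \<Colon> \<zero> \<rightarrow> \<rho>\<rbrakk>
    \<Longrightarrow> (E, eqt \<rho> (Cst (Rec \<rho>) \<cdot> zer \<cdot> y \<cdot> z \<cdot> v) y) \<in> efa"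
| rec_suc: "\<lbrakk>E \<turnstile> x \<Colon> \<zero>; E \<turnstile> y \<Colon> \<rho>; E \<turnstile> z \<Colon> \<zero> \<rightarrow> \<zero> \<rightarrow> \<rho>; E \<turnstile> v \<Colon> \<zero> \<rightarrow> \<rho>\<rbrakk>
    \<Longrightarrow> (E, rec_step \<rho> x y z v) \<in> efa"
| qf_ind: "\<lbrakk>wff (\<zero> # E) \<phi>; qf \<phi>\<rbrakk>
    \<Longrightarrow> (E, inst \<phi> zer \<^bold>\<and> All \<zero> (\<phi> \<^bold>\<longrightarrow> subst (case_nat (suc (Var 0)) (\<lambda>n. Var (Suc n))) \<phi>)
           \<^bold>\<longrightarrow> All \<zero> \<phi>) \<in> efa"


section \<open>Coding of finite sequences\<close>

text \<open>
  \<open>lam E \<sigma> t\<close> is the combinator term for \<open>\<lambda>x. t\<close>, where \<open>t\<close> lives in the context \<open>\<sigma> # E\<close>;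
  \<open>lams E [\<sigma>\<^sub>1, \<dots>, \<sigma>\<^sub>k] t\<close> is \<open>\<lambda>x\<^sub>1 \<dots> x\<^sub>k. t\<close>, with \<open>x\<^sub>k\<close> the variable \<open>0\<close> of \<open>t\<close>.
\<close>

fun occurs0 :: "trm \<Rightarrow> bool" where
  "occurs0 (Var n) \<longleftrightarrow> n = 0"
| "occurs0 (Cst c) \<longleftrightarrow> False"
| "occurs0 (s \<cdot> t) \<longleftrightarrow> occurs0 s \<or> occurs0 t"

fun lam :: "ty list \<Rightarrow> ty \<Rightarrow> trm \<Rightarrow> trm" where
  "lam E \<sigma> t =
    (if \<not> occurs0 t then Cst (Pi (the (tyof (\<sigma> # E) t)) \<sigma>) \<cdot> substt (\<lambda>n. Var (n - 1)) t
     else case t of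
       s \<cdot> u \<Rightarrow>
         (case tyof (\<sigma> # E) s of
            Some (\<rho> \<rightarrow> \<tau>) \<Rightarrow> Cst (Sig \<sigma> \<rho> \<tau>) \<cdot> lam E \<sigma> s \<cdot> lam E \<sigma> u
          | _ \<Rightarrow> undefined)
     | _ \<Rightarrow> Cst (Sig \<sigma> (\<sigma> \<rightarrow> \<sigma>) \<sigma>) \<cdot> Cst (Pi \<sigma> (\<sigma> \<rightarrow> \<sigma>)) \<cdot> Cst (Pi \<sigma> \<sigma>))"

declare lam.simps [simp del]

fun lams :: "ty list \<Rightarrow> ty list \<Rightarrow> trm \<Rightarrow> trm" where
  "lams E [] t = t"
| "lams E (\<sigma> # \<sigma>s) t = lam E \<sigma> (lams (\<sigma> # E) \<sigma>s t)"

text \<open>Predecessor \<open>\<lambda>x\<close> and cut-off subtraction \<open>\<lambda>x y\<close>.\<close>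

definition pred :: trm where
  "pred = lams [] [\<zero>]
    (Cst (Rec \<zero>) \<cdot> Var 0 \<cdot> zer \<cdot> lams [\<zero>] [\<zero>, \<zero>] (Var 0) \<cdot> lams [\<zero>] [\<zero>] (Var 0))"

definition monus :: trm where
  "monus = lams [] [\<zero>, \<zero>]
    (Cst (Rec \<zero>) \<cdot> Var 0 \<cdot> Var 1 \<cdot> lams [\<zero>, \<zero>] [\<zero>, \<zero>] (pred \<cdot> Var 1) \<cdot> lams [\<zero>, \<zero>] [\<zero>] (Var 2))"

text \<open>
  Cantor pairing \<open>j x y = (0 + 1 + \<dots> + (x + y)) + x\<close>; \<open>diag z\<close> is the least \<open>s\<close> with
  \<open>z < 0 + 1 + \<dots> + (s + 1)\<close>, i.e. the number \<open>x + y\<close> for \<open>z = j x y\<close>.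
\<close>

definition tri :: trm where "tri = Cst Phi2 \<cdot> lams [] [\<zero>] (Var 0)"

definition pair :: trm where
  "pair = lams [] [\<zero>, \<zero>] (Cst A1 \<cdot> (tri \<cdot> (Cst A1 \<cdot> Var 1 \<cdot> Var 0)) \<cdot> Var 1)"

definition diag :: trm where
  "diag = Cst Mub \<cdot> lams [] [\<zero>, \<zero>] (monus \<cdot> suc (Var 1) \<cdot> (tri \<cdot> suc (Var 0)))"

definition proj1 :: trm where
  "proj1 = lams [] [\<zero>] (monus \<cdot> Var 0 \<cdot> (tri \<cdot> (diag \<cdot> Var 0)))"

definition proj2 :: trm where
  "proj2 = lams [] [\<zero>] (monus \<cdot> (diag \<cdot> Var 0) \<cdot> (proj1 \<cdot> Var 0))"

text \<open>
  Type \<open>0\<close>: \<open>0\<close> codes the empty sequence and \<open>j x s + 1\<close> codes \<open>x\<close> followed by the sequence coded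
  by \<open>s\<close>, so that every number codes exactly one finite sequence of numbers. The terms are
  \<open>drop0\<close> \<open>= \<lambda>s i.\<close> (\<open>s\<close> without its first \<open>i\<close> components), \<open>len0\<close> \<open>= \<lambda>s. |s|\<close>,
  \<open>cmp0\<close> \<open>= \<lambda>s i. (s)\<^sub>i\<close> (which is \<open>0\<close> for \<open>i \<ge> |s|\<close>) and
  \<open>seg\<close> \<open>= \<lambda>\<alpha> n. \<langle>\<alpha> 0, \<dots>, \<alpha> (n - 1)\<rangle>\<close>.
\<close>

definition head :: trm where "head = lams [] [\<zero>] (proj1 \<cdot> (pred \<cdot> Var 0))"

definition tail :: trm where "tail = lams [] [\<zero>] (proj2 \<cdot> (pred \<cdot> Var 0))"

definition drop0 :: trm where
  "drop0 = lams [] [\<zero>, \<zero>]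
    (Cst (Rec \<zero>) \<cdot> Var 0 \<cdot> Var 1 \<cdot> lams [\<zero>, \<zero>] [\<zero>, \<zero>] (tail \<cdot> Var 1) \<cdot> lams [\<zero>, \<zero>] [\<zero>] (Var 2))"

definition len0 :: trm where "len0 = Cst Mub \<cdot> drop0"

definition cmp0 :: trm where "cmp0 = lams [] [\<zero>, \<zero>] (head \<cdot> (drop0 \<cdot> Var 1 \<cdot> Var 0))"

text \<open>
  The recursion for \<open>seg\<close> prepends \<open>\<alpha> (n - 1), \<alpha> (n - 2), \<dots>, \<alpha> 0\<close> in turn. All intermediate
  codes are below \<open>(M + 2) ^ (4 ^ n)\<close> with \<open>M = max {\<alpha> 0, \<dots>, \<alpha> n}\<close>, because
  \<open>j x s + 1 \<le> (x + s + 1)\<^sup>2\<close>; so the bound that the recursor requires is never active.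
\<close>

definition seg :: trm where
  "seg =
    (let four = suc (suc (suc (suc zer)))
     in lams [] [\<one>, \<zero>]
       (Cst (Rec \<zero>) \<cdot> Var 0 \<cdot> zer
         \<cdot> lams [\<zero>, \<one>] [\<zero>, \<zero>] (suc (pair \<cdot> (Var 3 \<cdot> (monus \<cdot> Var 2 \<cdot> suc (Var 0))) \<cdot> Var 1))
         \<cdot> lams [\<zero>, \<one>] [\<zero>]
             (Cst A3 \<cdot> suc (suc (Cst Phi1 \<cdot> Var 2 \<cdot> Var 1)) \<cdot> (Cst A3 \<cdot> four \<cdot> Var 1))))"

text \<open>
  Higher types: an object \<open>y\<close> of type \<open>\<sigma> \<rightarrow> \<tau>\<close> codes the sequence of length \<open>|y 0|\<close> with the
  components \<open>\<lambda>x. (y x)\<^sub>i\<close>. Again every object codes a sequence, and \<open>mkseq \<tau> F n\<close> codes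
  \<open>\<langle>F 0, \<dots>, F (n - 1)\<rangle>\<close>.
\<close>

fun nul :: "ty \<Rightarrow> trm" where
  "nul \<zero> = zer"
| "nul (\<sigma> \<rightarrow> \<tau>) = Cst (Pi \<tau> \<sigma>) \<cdot> nul \<tau>"

fun len :: "ty \<Rightarrow> trm" where
  "len \<zero> = len0"
| "len (\<sigma> \<rightarrow> \<tau>) = lams [] [\<sigma> \<rightarrow> \<tau>] (len \<tau> \<cdot> (Var 0 \<cdot> nul \<sigma>))"

fun cmp :: "ty \<Rightarrow> trm" where
  "cmp \<zero> = cmp0"
| "cmp (\<sigma> \<rightarrow> \<tau>) = lams [] [\<sigma> \<rightarrow> \<tau>, \<zero>, \<sigma>] (cmp \<tau> \<cdot> (Var 2 \<cdot> Var 0) \<cdot> Var 1)"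

fun mkseq :: "ty \<Rightarrow> trm" where
  "mkseq \<zero> = seg"
| "mkseq (\<sigma> \<rightarrow> \<tau>) = lams [] [\<zero> \<rightarrow> \<sigma> \<rightarrow> \<tau>, \<zero>, \<sigma>]
    (mkseq \<tau> \<cdot> lams [\<sigma>, \<zero>, \<zero> \<rightarrow> \<sigma> \<rightarrow> \<tau>] [\<zero>] (Var 3 \<cdot> Var 0 \<cdot> Var 1) \<cdot> Var 1)"

definition elem :: "ty \<Rightarrow> trm \<Rightarrow> trm \<Rightarrow> form" where
  "elem \<tau> x y = Ex \<zero> (Var 0 \<^bold>< len \<tau> \<cdot> lift y \<^bold>\<and> eqt \<tau> (lift x) (cmp \<tau> \<cdot> lift y \<cdot> Var 0))"

text \<open>
  \<open>collect \<sigma> \<tau> \<cdot> Y \<cdot> x\<close> is \<open>Y[x]\<close>, the concatenation of the sequences \<open>s\<^sub>i = (Y)\<^sub>i x\<close> for \<open>i < |Y|\<close>: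
  \<open>block_len Y x i\<close> is \<open>|s\<^sub>i|\<close>, \<open>block_end Y x i\<close> is \<open>|s\<^sub>0| + \<dots> + |s\<^sub>i|\<close>, \<open>block Y x k\<close> is the
  number \<open>i\<close> of the sequence to which position \<open>k\<close> of the concatenation belongs, and
  \<open>entry Y x k\<close> is the component at this position.
\<close>

definition block_len :: "ty \<Rightarrow> ty \<Rightarrow> trm" where
  "block_len \<sigma> \<tau> = lams [] [\<sigma> \<rightarrow> \<tau>, \<sigma>, \<zero>] (len \<tau> \<cdot> (cmp (\<sigma> \<rightarrow> \<tau>) \<cdot> Var 2 \<cdot> Var 0 \<cdot> Var 1))"

definition block_end :: "ty \<Rightarrow> ty \<Rightarrow> trm" where
  "block_end \<sigma> \<tau> = lams [] [\<sigma> \<rightarrow> \<tau>, \<sigma>] (Cst Phi2 \<cdot> (block_len \<sigma> \<tau> \<cdot> Var 1 \<cdot> Var 0))"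

definition block :: "ty \<Rightarrow> ty \<Rightarrow> trm" where
  "block \<sigma> \<tau> = lams [] [\<sigma> \<rightarrow> \<tau>, \<sigma>, \<zero>]
    (Cst Mub
      \<cdot> lams [\<zero>, \<sigma>, \<sigma> \<rightarrow> \<tau>] [\<zero>, \<zero>] (monus \<cdot> suc (Var 2) \<cdot> (block_end \<sigma> \<tau> \<cdot> Var 4 \<cdot> Var 3 \<cdot> Var 0))
      \<cdot> (len (\<sigma> \<rightarrow> \<tau>) \<cdot> Var 2))"

definition entry :: "ty \<Rightarrow> ty \<Rightarrow> trm" where
  "entry \<sigma> \<tau> =
    (let i = block \<sigma> \<tau> \<cdot> Var 2 \<cdot> Var 1 \<cdot> Var 0;
         start = monus \<cdot> (block_end \<sigma> \<tau> \<cdot> Var 2 \<cdot> Var 1 \<cdot> i) \<cdot> (block_len \<sigma> \<tau> \<cdot> Var 2 \<cdot> Var 1 \<cdot> i)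
     in lams [] [\<sigma> \<rightarrow> \<tau>, \<sigma>, \<zero>]
          (cmp \<tau> \<cdot> (cmp (\<sigma> \<rightarrow> \<tau>) \<cdot> Var 2 \<cdot> i \<cdot> Var 1) \<cdot> (monus \<cdot> Var 0 \<cdot> start)))"

definition collect :: "ty \<Rightarrow> ty \<Rightarrow> trm" where
  "collect \<sigma> \<tau> =
    (let n = len (\<sigma> \<rightarrow> \<tau>) \<cdot> Var 1
     in lams [] [\<sigma> \<rightarrow> \<tau>, \<sigma>]
          (mkseq \<tau> \<cdot> (entry \<sigma> \<tau> \<cdot> Var 1 \<cdot> Var 0)
             \<cdot> (monus \<cdot> (block_end \<sigma> \<tau> \<cdot> Var 1 \<cdot> Var 0 \<cdot> n) \<cdot> (block_len \<sigma> \<tau> \<cdot> Var 1 \<cdot> Var 0 \<cdot> n))))"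


section \<open>The nonstandard axioms\<close>

inductive_set efa_st :: thy where
  efa: "(E, \<phi>) \<in> efa \<Longrightarrow> (E, \<phi>) \<in> efa_st"
| EQ_all: "wff (\<sigma> # E) \<phi> \<Longrightarrow> (E, AllSt \<sigma> \<phi> \<^bold>\<longleftrightarrow> All \<sigma> (St \<sigma> (Var 0) \<^bold>\<longrightarrow> \<phi>)) \<in> efa_st"
| EQ_ex: "wff (\<sigma> # E) \<phi> \<Longrightarrow> (E, ExSt \<sigma> \<phi> \<^bold>\<longleftrightarrow> Ex \<sigma> (St \<sigma> (Var 0) \<^bold>\<and> \<phi>)) \<in> efa_st"
| st_eq: "\<lbrakk>E \<turnstile> s \<Colon> \<sigma>; E \<turnstile> t \<Colon> \<sigma>\<rbrakk> \<Longrightarrow> (E, St \<sigma> s \<^bold>\<and> eqt \<sigma> s t \<^bold>\<longrightarrow> St \<sigma> t) \<in> efa_st"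
| st_closed: "[] \<turnstile> t \<Colon> \<sigma> \<Longrightarrow> (E, St \<sigma> t) \<in> efa_st"
| st_app: "\<lbrakk>E \<turnstile> s \<Colon> \<sigma> \<rightarrow> \<tau>; E \<turnstile> t \<Colon> \<sigma>\<rbrakk>
    \<Longrightarrow> (E, St (\<sigma> \<rightarrow> \<tau>) s \<^bold>\<and> St \<sigma> t \<^bold>\<longrightarrow> St \<tau> (s \<cdot> t)) \<in> efa_st"
| st_le: "\<lbrakk>E \<turnstile> s \<Colon> \<zero>; E \<turnstile> t \<Colon> \<zero>\<rbrakk> \<Longrightarrow> (E, St \<zero> s \<^bold>\<and> t \<^bold>\<le> s \<^bold>\<longrightarrow> St \<zero> t) \<in> efa_st"

text \<open>
  In idealization and choice, \<open>\<phi>\<close> lives in the context \<open>\<tau> # \<sigma> # E\<close>, i.e. \<open>y\<close> is the variable \<open>0\<close>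
  and \<open>x\<close> the variable \<open>1\<close>; the renamings skip the additional variable \<open>y'\<close> or \<open>Y\<close>.
\<close>

definition idealization :: thy where
  "idealization =
    {(E, AllSt \<tau> (Ex \<sigma> (All \<tau> (elem \<tau> (Var 0) (Var 2)
            \<^bold>\<longrightarrow> rename (\<lambda>n. if n < 2 then n else Suc n) \<phi>)))
         \<^bold>\<longrightarrow> Ex \<sigma> (AllSt \<tau> \<phi>)) | E \<sigma> \<tau> \<phi>. wff (\<tau> # \<sigma> # E) \<phi> \<and> internal \<phi>}"

definition hac_int :: thy where
  "hac_int =
    {(E, AllSt \<sigma> (ExSt \<tau> \<phi>)
         \<^bold>\<longrightarrow> ExSt (\<sigma> \<rightarrow> \<tau>) (AllSt \<sigma> (Ex \<tau> (elem \<tau> (Var 0) (collect \<sigma> \<tau> \<cdot> Var 2 \<cdot> Var 1)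
            \<^bold>\<and> rename (\<lambda>n. if n < 2 then n else Suc n) \<phi>)))) |
      E \<sigma> \<tau> \<phi>. wff (\<tau> # \<sigma> # E) \<phi> \<and> internal \<phi>}"

definition pf_tp :: thy where
  "pf_tp = {(E, binds AllSt \<Delta> \<phi> \<^bold>\<longrightarrow> binds All \<Delta> \<phi>) | E \<Delta> \<phi>. wff \<Delta> \<phi> \<and> internal \<phi>}"

text \<open>
  For tuples \<open>x\<close> and \<open>y\<close> of variables with the contexts \<open>\<Delta>\<close> and \<open>\<Theta>\<close>. In the conclusion, the
  \<open>x\<close> are the variables below \<open>length \<Delta>\<close>, followed by the \<open>Y\<close>.
\<close>

definition qf_ac :: "nat \<Rightarrow> nat \<Rightarrow> thy" where
  "qf_ac m n =
    {(E, binds All \<Delta> (binds Ex \<Theta> A)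
         \<^bold>\<longrightarrow> binds Ex (map (\<lambda>\<tau>. foldr Fun (rev \<Delta>) \<tau>) \<Theta>)
               (binds All \<Delta>
                 (subst (\<lambda>i. if i < length \<Theta> then app_vars (Var (length \<Delta> + i)) (length \<Delta>)
                             else if i < length \<Theta> + length \<Delta> then Var (i - length \<Theta>)
                             else Var i) A))) |
      E \<Delta> \<Theta> A. wff (\<Theta> @ \<Delta> @ E) A \<and> qf A
        \<and> (\<forall>\<sigma>\<in>set \<Delta>. level \<sigma> = m) \<and> (\<forall>\<tau>\<in>set \<Theta>. level \<tau> = n)}"

definition B0 :: thy where
  "B0 = efa_st \<union> idealization \<union> hac_int \<union> pf_tp \<union> qf_ac 1 0"


section \<open>Weak Koenig's lemma\<close>

definition in_tree :: "trm \<Rightarrow> trm \<Rightarrow> form" where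
  "in_tree \<beta> T = (T \<cdot> \<beta> \<^bold>= num1)"

definition binary_fun :: "trm \<Rightarrow> form" where
  "binary_fun \<alpha> = All \<zero> (lift \<alpha> \<cdot> Var 0 \<^bold>\<le> num1)"

text \<open>
  \<open>T\<close> is the characteristic function of a set of codes of binary sequences that is closed under
  initial segments; \<open>seg \<cdot> (cmp0 \<cdot> \<beta>) \<cdot> m\<close> is the initial segment of \<open>\<beta>\<close> of length \<open>m\<close>.
\<close>

definition binary_tree :: "trm \<Rightarrow> form" where
  "binary_tree T =
    (binary_fun T
     \<^bold>\<and> All \<zero> (in_tree (Var 0) (lift T) \<^bold>\<longrightarrow>
           All \<zero> (Var 0 \<^bold>< len0 \<cdot> Var 1 \<^bold>\<longrightarrow> cmp0 \<cdot> Var 1 \<cdot> Var 0 \<^bold>\<le> num1))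
     \<^bold>\<and> All \<zero> (in_tree (Var 0) (lift T) \<^bold>\<longrightarrow>
           All \<zero> (Var 0 \<^bold>\<le> len0 \<cdot> Var 1 \<^bold>\<longrightarrow> in_tree (seg \<cdot> (cmp0 \<cdot> Var 1) \<cdot> Var 0) (liftn 2 T))))"

definition WKL :: form where
  "WKL =
    All \<one> (binary_tree (Var 0) \<^bold>\<longrightarrow>
      All \<zero> (Ex \<zero> (len0 \<cdot> Var 0 \<^bold>= Var 1 \<^bold>\<and> in_tree (Var 0) (Var 2))) \<^bold>\<longrightarrow>
      Ex \<one> (binary_fun (Var 0) \<^bold>\<and> All \<zero> (in_tree (seg \<cdot> Var 1 \<cdot> Var 0) (Var 2))))"

text \<open>
  Relativization to the standard objects of all quantifiers except the bounded number
  quantifiers \<open>\<forall>x \<le> t\<close>, \<open>\<forall>x < t\<close>, \<open>\<exists>x \<le> t\<close>, \<open>\<exists>x < t\<close>, where \<open>x\<close> does not occur in \<open>t\<close>.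
\<close>

definition bounded_all :: "ty \<Rightarrow> form \<Rightarrow> bool" where
  "bounded_all \<sigma> \<phi> \<longleftrightarrow> \<sigma> = \<zero> \<and>
    (\<exists>t \<psi>. \<not> occurs0 t \<and> (\<phi> = (Var 0 \<^bold>\<le> t \<^bold>\<longrightarrow> \<psi>) \<or> \<phi> = (Var 0 \<^bold>< t \<^bold>\<longrightarrow> \<psi>)))"

definition bounded_ex :: "ty \<Rightarrow> form \<Rightarrow> bool" where
  "bounded_ex \<sigma> \<phi> \<longleftrightarrow> \<sigma> = \<zero> \<and>
    (\<exists>t \<psi>. \<not> occurs0 t \<and> (\<phi> = (Var 0 \<^bold>\<le> t \<^bold>\<and> \<psi>) \<or> \<phi> = (Var 0 \<^bold>< t \<^bold>\<and> \<psi>)))"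

fun rel_st :: "form \<Rightarrow> form" where
  "rel_st (\<phi> \<^bold>\<and> \<psi>) = (rel_st \<phi> \<^bold>\<and> rel_st \<psi>)"
| "rel_st (\<phi> \<^bold>\<or> \<psi>) = (rel_st \<phi> \<^bold>\<or> rel_st \<psi>)"
| "rel_st (\<phi> \<^bold>\<longrightarrow> \<psi>) = (rel_st \<phi> \<^bold>\<longrightarrow> rel_st \<psi>)"
| "rel_st (All \<sigma> \<phi>) = (if bounded_all \<sigma> \<phi> then All \<sigma> (rel_st \<phi>) else AllSt \<sigma> (rel_st \<phi>))"
| "rel_st (Ex \<sigma> \<phi>) = (if bounded_ex \<sigma> \<phi> then Ex \<sigma> (rel_st \<phi>) else ExSt \<sigma> (rel_st \<phi>))"
| "rel_st \<phi> = \<phi>"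

end

(* A completeness theorem for the calculus reduces derivability to truth in all extensional models,
   so that the rest is ordinary reasoning about functionals.

   WKL implies that for all T, b and all g of level 2 there are alpha and counterexamples q such
   that a quantifier-free formula holds: if q does not refute that T is a tree with b n a node of
   length n for all n, then alpha is binary and in T up to g(alpha). By QF-AC(2,1) there are
   functionals producing alpha and q, and parameter-free transfer makes these functionals standard.
   If a standard T had no standard path, HAC_int would give a standard g bounding the failure of
   every standard alpha (and a standard b), and the standard alpha for this T, b and g is a
   contradiction. Conversely, a failure of WKL is witnessed by T together with Skolem functionals
   from QF-AC(1,0), these can be taken standard by transfer, and then refute WKL^st. *)

theory Submission
  imports Defs "HOL-Library.Countable"
begin

text \<open>Transfer admits no parameters, and this shapes the argument: nothing can be transferred
  while a given tree is kept fixed. A standard object is therefore obtained either as the value of a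
  functional that was chosen without parameters, transferred, and only then applied to the tree, or
  by transferring the tree together with its Skolem functionals. From the side of WKL, a standard
  tree satisfies the tree axioms only at standard nodes, whereas WKL asks for them everywhere. The
  functionals for the counterexamples bridge the gap: at standard arguments their values are
  standard, and the hypotheses are consulted only there. The conclusion is cut down to the one place
  g(alpha) because choice requires a quantifier-free matrix. HAC_int yields only a finite sequence
  of candidates. Bounded search selects one of them, and for this the matrix must be decided by a
  standard functional. Constant functions adjust types, since QF-AC prescribes the level of every
  variable of a tuple. Completeness refers to general models, whose function domains need not be
  full; a quotient of the terms over the Henkin variables is the countermodel.\<close>

declare One_nat_def [simp del]  \<comment> \<open>\<open>lift\<close> abbreviates \<open>liftn 1\<close>\<close>

section \<open>Substitution\<close>

lemma substt_substt: "substt f (substt g t) = substt (\<lambda>i. substt f (g i)) t"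
  by (induction t) auto

lemma substt_Var [simp]: "substt Var t = t"
  by (induction t) auto

lemma lift_def: "lift = substt (\<lambda>n. Var (Suc n))"
  by (simp add: liftn_def fun_eq_iff One_nat_def)

lemma under_Var [simp]: "under Var = Var"
  by (auto simp: under_def lift_def fun_eq_iff split: nat.split)

lemma under_0 [simp]: "under f 0 = Var 0"
  and under_Suc [simp]: "under f (Suc n) = lift (f n)"
  by (simp_all add: under_def)

lemma lift_Var [simp]: "lift (Var n) = Var (Suc n)"
  and lift_Cst [simp]: "lift (Cst c) = Cst c"
  and lift_App [simp]: "lift (s \<cdot> t) = lift s \<cdot> lift t"
  by (simp_all add: lift_def)

lemma substt_lift: "substt f (lift t) = substt (\<lambda>i. f (Suc i)) t"
  by (simp add: lift_def substt_substt)

lemma lift_substt: "lift (substt f t) = substt (\<lambda>i. lift (f i)) t"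
  by (simp add: lift_def substt_substt)

lemma substt_under_lift: "substt (under f) (lift t) = lift (substt f t)"
  by (simp add: substt_lift lift_substt)

lemma under_comp: "(\<lambda>i. substt (under f) (under g i)) = under (\<lambda>i. substt f (g i))"
proof
  fix i show "substt (under f) (under g i) = under (\<lambda>i. substt f (g i)) i"
    by (cases i) (simp_all add: substt_under_lift)
qed

lemma subst_subst: "subst f (subst g \<phi>) = subst (\<lambda>i. substt f (g i)) \<phi>"
  by (induction \<phi> arbitrary: f g) (simp_all add: substt_substt under_comp)

lemma subst_Var [simp]: "subst Var \<phi> = \<phi>"
  by (induction \<phi>) simp_all

text \<open>Going under the quantifier and instantiating its variable merge into
  \<open>case_nat t f\<close>. An environment \<open>e\<close> is extended in the same way to
  \<open>case_nat x e\<close>, which makes the quantifier cases of syntax and semantics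
  match.\<close>

lemma inst_under: "inst (subst (under f) \<phi>) t = subst (case_nat t f) \<phi>"
proof -
  have "(\<lambda>i. substt (case_nat t Var) (under f i)) = case_nat t f"
  proof
    fix i show "substt (case_nat t Var) (under f i) = case_nat t f i"
      by (cases i) (simp_all add: substt_lift)
  qed
  then show ?thesis
    by (simp add: inst_def subst_subst)
qed

lemma subst_inst: "subst f (inst \<phi> t) = inst (subst (under f) \<phi>) (substt f t)"
proof -
  have "(\<lambda>i. substt f (case_nat t Var i)) = case_nat (substt f t) f"
    by (auto simp: fun_eq_iff split: nat.split)
  then show ?thesis
    by (simp add: inst_under) (simp add: inst_def subst_subst)
qed

lemma subst_under_liftf: "subst (under f) (liftf \<phi>) = liftf (subst f \<phi>)"
  by (simp add: subst_subst lift_def)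

section \<open>Substitutions that respect types\<close>

definition typed_sub :: "ty list \<Rightarrow> ty list \<Rightarrow> (nat \<Rightarrow> trm) \<Rightarrow> bool" where
  "typed_sub E E' f \<longleftrightarrow> (\<forall>i<length E. E' \<turnstile> f i \<Colon> E ! i)"

lemma tyof_substt:
  assumes "E \<turnstile> t \<Colon> \<sigma>" "typed_sub E E' f"
  shows "E' \<turnstile> substt f t \<Colon> \<sigma>"
  using assms
proof (induction t arbitrary: \<sigma>)
  case (Var n)
  then show ?case by (auto simp: typed_sub_def split: if_splits)
next
  case (App s t)
  from App.prems(1) obtain \<rho> where "E \<turnstile> s \<Colon> \<rho> \<rightarrow> \<sigma>" "E \<turnstile> t \<Colon> \<rho>"
    by (auto split: option.splits ty.splits if_splits)
  then show ?case using App by auto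
qed simp

lemma typed_sub_tail: "typed_sub E (\<sigma> # E) (\<lambda>n. Var (Suc n))"
  by (simp add: typed_sub_def)

lemma tyof_lift: "E \<turnstile> t \<Colon> \<sigma> \<Longrightarrow> \<rho> # E \<turnstile> lift t \<Colon> \<sigma>"
  unfolding lift_def using tyof_substt[OF _ typed_sub_tail] by simp

lemma typed_sub_under: "typed_sub E E' f \<Longrightarrow> typed_sub (\<sigma> # E) (\<sigma> # E') (under f)"
  unfolding typed_sub_def
proof (intro allI impI)
  fix i assume *: "\<forall>i<length E. E' \<turnstile> f i \<Colon> E ! i" "i < length (\<sigma> # E)"
  then show "\<sigma> # E' \<turnstile> under f i \<Colon> (\<sigma> # E) ! i"
    by (cases i) (simp_all add: tyof_lift del: One_nat_def)
qed

lemma wff_subst: "wff E \<phi> \<Longrightarrow> typed_sub E E' f \<Longrightarrow> wff E' (subst f \<phi>)"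
  by (induction \<phi> arbitrary: E E' f) (auto intro: tyof_substt typed_sub_under)

lemma typed_sub_append: "typed_sub E (E @ E') Var"
  by (simp add: typed_sub_def nth_append)

lemma tyof_append: "E \<turnstile> t \<Colon> \<sigma> \<Longrightarrow> E @ E' \<turnstile> t \<Colon> \<sigma>"
  using tyof_substt[OF _ typed_sub_append] by simp

lemma wff_append: "wff E \<phi> \<Longrightarrow> wff (E @ E') \<phi>"
  using wff_subst[OF _ typed_sub_append] by simp

lemma substt_cong:
  "E \<turnstile> t \<Colon> \<sigma> \<Longrightarrow> (\<And>i. i < length E \<Longrightarrow> f i = g i) \<Longrightarrow> substt f t = substt g t"
  by (induction t arbitrary: \<sigma>) (auto split: option.splits ty.splits if_splits)

lemma subst_cong:
  "wff E \<phi> \<Longrightarrow> (\<And>i. i < length E \<Longrightarrow> f i = g i) \<Longrightarrow> subst f \<phi> = subst g \<phi>"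
proof (induction \<phi> arbitrary: E f g)
  case (All \<sigma> \<phi>)
  have "subst (under f) \<phi> = subst (under g) \<phi>"
    using All.prems by (intro All.IH[of "\<sigma> # E"]) (auto simp: under_def split: nat.split)
  then show ?case by simp
next
  case (Ex \<sigma> \<phi>)
  have "subst (under f) \<phi> = subst (under g) \<phi>"
    using Ex.prems by (intro Ex.IH[of "\<sigma> # E"]) (auto simp: under_def split: nat.split)
  then show ?case by simp
next
  case (AllSt \<sigma> \<phi>)
  have "subst (under f) \<phi> = subst (under g) \<phi>"
    using AllSt.prems by (intro AllSt.IH[of "\<sigma> # E"]) (auto simp: under_def split: nat.split)
  then show ?case by simp
next
  case (ExSt \<sigma> \<phi>)
  have "subst (under f) \<phi> = subst (under g) \<phi>"
    using ExSt.prems by (intro ExSt.IH[of "\<sigma> # E"]) (auto simp: under_def split: nat.split)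
  then show ?case by simp
next
  case (Eq s t)
  then show ?case using substt_cong[of E s _ f g] substt_cong[of E t _ f g] by simp
next
  case (Le s t)
  then show ?case using substt_cong[of E s _ f g] substt_cong[of E t _ f g] by simp
next
  case (St \<sigma> t)
  then show ?case using substt_cong[of E t _ f g] by simp
next
  case (And \<phi> \<psi>)
  then show ?case using And.IH(1)[of E f g] And.IH(2)[of E f g] by simp
next
  case (Or \<phi> \<psi>)
  then show ?case using Or.IH(1)[of E f g] Or.IH(2)[of E f g] by simp
next
  case (Imp \<phi> \<psi>)
  then show ?case using Imp.IH(1)[of E f g] Imp.IH(2)[of E f g] by simp
qed simp

lemma subst_closed: "wff [] \<phi> \<Longrightarrow> subst f \<phi> = \<phi>"
  using subst_cong[of "[]" \<phi> f Var] by simp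

lemma substt_closed: "[] \<turnstile> t \<Colon> \<sigma> \<Longrightarrow> substt f t = t"
  using substt_cong[of "[]" t \<sigma> f Var] by simp

text \<open>These closed terms serve to eliminate surplus variables: substituting them shortens the
  context of a derivation.\<close>

lemma tyof_nul: "E \<turnstile> nul \<sigma> \<Colon> \<sigma>"
  by (induction \<sigma>) simp_all

lemma subst_eqt: "subst f (eqt \<sigma> s t) = eqt \<sigma> (substt f s) (substt f t)"
  by (induction \<sigma> arbitrary: f s t) (simp_all add: substt_under_lift)

lemma wff_eqt: "E \<turnstile> s \<Colon> \<sigma> \<Longrightarrow> E \<turnstile> t \<Colon> \<sigma> \<Longrightarrow> wff E (eqt \<sigma> s t)"
  by (induction \<sigma> arbitrary: E s t) (auto simp: tyof_lift)

section \<open>Admissible rules\<close>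

text \<open>Rules look at hypotheses only through membership, so order and repetition are free.
  Enlarging the theory turns purely logical derivations into derivations from
  \<open>T\<close>.\<close>

lemma deriv_weaken:
  "deriv T E \<Gamma> \<phi> \<Longrightarrow> set \<Gamma> \<subseteq> set \<Gamma>' \<Longrightarrow> T \<subseteq> T' \<Longrightarrow> deriv T' E \<Gamma>' \<phi>"
proof (induction arbitrary: \<Gamma>' rule: deriv.induct)
  case (Contr E \<phi> \<Gamma>)
  have "deriv T' E ((\<^bold>\<not> \<phi>) # \<Gamma>') \<^bold>\<bottom>"
    by (rule Contr.IH) (use Contr.prems in auto)
  then show ?case by (rule deriv.Contr[OF Contr.hyps(1)])
next
  case (OrE E \<Gamma> \<phi> \<psi> \<chi>)
  have "set (\<phi> # \<Gamma>) \<subseteq> set (\<phi> # \<Gamma>')" "set (\<psi> # \<Gamma>) \<subseteq> set (\<psi> # \<Gamma>')"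
    using OrE.prems by auto
  then show ?case using OrE by (meson deriv.OrE)
next
  case (ImpI E \<phi> \<Gamma> \<psi>)
  have "deriv T' E (\<phi> # \<Gamma>') \<psi>"
    by (rule ImpI.IH) (use ImpI.prems in auto)
  then show ?case by (rule deriv.ImpI[OF ImpI.hyps(1)])
next
  case (AllI \<sigma> E \<Gamma> \<phi>)
  then show ?case by (intro deriv.AllI AllI.IH) auto
next
  case (ExE E \<Gamma> \<sigma> \<phi> \<chi>)
  have "set (\<phi> # map liftf \<Gamma>) \<subseteq> set (\<phi> # map liftf \<Gamma>')"
    using ExE.prems by auto
  then show ?case
    using deriv.ExE[OF ExE.IH(1)[OF ExE.prems] ExE.hyps(2) ExE.IH(2)] ExE.prems(2) by simp
next
  case (AndE1 E \<Gamma> \<phi> \<psi>)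
  then show ?case by (meson deriv.AndE1)
next
  case (AndE2 E \<Gamma> \<phi> \<psi>)
  then show ?case by (meson deriv.AndE2)
next
  case (ImpE E \<Gamma> \<phi> \<psi>)
  then show ?case by (meson deriv.ImpE)
next
  case (AllE E \<Gamma> \<sigma> \<phi> t)
  then show ?case by (meson deriv.AllE)
next
  case (ExI \<sigma> E \<phi> t \<Gamma>)
  then show ?case by (meson deriv.ExI)
qed (auto intro: deriv.Axiom deriv.Hyp deriv.AndI deriv.OrI1 deriv.OrI2)

text \<open>Restricted to the empty theory because a set of axioms need not be closed under
  substitution. For this reason the completeness proof works in pure logic and carries axioms as
  closed hypotheses.\<close>

lemma deriv_subst:
  "deriv {} E \<Gamma> \<phi> \<Longrightarrow> typed_sub E E' f \<Longrightarrow> deriv {} E' (map (subst f) \<Gamma>) (subst f \<phi>)"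
proof (induction arbitrary: E' f rule: deriv.induct)
  case (Contr E \<phi> \<Gamma>)
  have "deriv {} E' (map (subst f) ((\<^bold>\<not> \<phi>) # \<Gamma>)) (subst f \<^bold>\<bottom>)" by (rule Contr.IH) (rule Contr.prems)
  then show ?case using Contr.hyps Contr.prems by (simp add: deriv.Contr wff_subst)
next
  case (OrE E \<Gamma> \<phi> \<psi> \<chi>)
  have "deriv {} E' (map (subst f) \<Gamma>) (subst f \<phi> \<^bold>\<or> subst f \<psi>)" using OrE.IH(1) OrE.prems by simp
  then show ?case
    using OrE.IH(2)[OF OrE.prems] OrE.IH(3)[OF OrE.prems] by (simp add: deriv.OrE)
next
  case (AllI \<sigma> E \<Gamma> \<phi>)
  have "deriv {} (\<sigma> # E') (map (subst (under f)) (map liftf \<Gamma>)) (subst (under f) \<phi>)"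
    using AllI.IH AllI.prems typed_sub_under by blast
  then show ?case by (auto intro!: deriv.AllI simp: subst_under_liftf comp_def)
next
  case (AllE E \<Gamma> \<sigma> \<phi> t)
  then show ?case by (auto simp: subst_inst intro!: deriv.AllE tyof_substt)
next
  case (ExI \<sigma> E \<phi> t \<Gamma>)
  then show ?case
    by (auto simp: subst_inst intro!: deriv.ExI[where t = "substt f t"] tyof_substt wff_subst typed_sub_under)
next
  case (ExE E \<Gamma> \<sigma> \<phi> \<chi>)
  have "deriv {} (\<sigma> # E') (map (subst (under f)) (\<phi> # map liftf \<Gamma>)) (subst (under f) (liftf \<chi>))"
    using ExE.IH ExE.prems typed_sub_under by blast
  then have "deriv {} (\<sigma> # E') (subst (under f) \<phi> # map liftf (map (subst f) \<Gamma>)) (liftf (subst f \<chi>))"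
    by (simp add: subst_under_liftf comp_def)
  moreover have "deriv {} E' (map (subst f) \<Gamma>) (Ex \<sigma> (subst (under f) \<phi>))"
    using ExE.IH(1) ExE.prems by simp
  ultimately show ?case
    using wff_subst[OF ExE.hyps(2) ExE.prems] by (rule deriv.ExE[rotated 2])
next
  case (AndE1 E \<Gamma> \<phi> \<psi>)
  then show ?case by (metis deriv.AndE1 subst.simps(5))
next
  case (AndE2 E \<Gamma> \<phi> \<psi>)
  then show ?case by (metis deriv.AndE2 subst.simps(5))
next
  case (ImpE E \<Gamma> \<phi> \<psi>)
  then show ?case by (metis deriv.ImpE subst.simps(7))
qed (auto intro: deriv.Hyp deriv.AndI deriv.OrI1 deriv.OrI2 deriv.ImpI wff_subst)

lemma deriv_context: "deriv {} E \<Gamma> \<phi> \<Longrightarrow> deriv {} (E @ E') \<Gamma> \<phi>"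
  using deriv_subst[OF _ typed_sub_append, of E \<Gamma> \<phi> E'] by (simp add: map_idI)

text \<open>The way back from axioms carried as hypotheses to axioms of the theory, one cut per
  hypothesis.\<close>

lemma deriv_discharge:
  assumes "deriv T E \<Gamma> \<phi>" "\<And>\<psi>. \<psi> \<in> set \<Gamma> \<Longrightarrow> wff E \<psi> \<and> deriv T E [] \<psi>"
  shows "deriv T E [] \<phi>"
  using assms
proof (induction \<Gamma> arbitrary: \<phi>)
  case (Cons \<psi> \<Gamma>)
  then have "deriv T E [] (\<psi> \<^bold>\<longrightarrow> \<phi>)" by (simp add: deriv.ImpI)
  then show ?case using Cons.prems(2) by (meson deriv.ImpE list.set_intros(1))
qed simp

lemma deriv_binds_All: "deriv T E [] \<phi> \<Longrightarrow> deriv T [] [] (binds All E \<phi>)"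
  by (induction E arbitrary: \<phi>) (simp_all add: deriv.AllI)

lemma wff_binds:
  "wff E (binds All \<Delta> \<phi>) \<longleftrightarrow> wff (\<Delta> @ E) \<phi>"
  "wff E (binds Ex \<Delta> \<phi>) \<longleftrightarrow> wff (\<Delta> @ E) \<phi>"
  "wff E (binds AllSt \<Delta> \<phi>) \<longleftrightarrow> wff (\<Delta> @ E) \<phi>"
  by (induction \<Delta> arbitrary: \<phi>) auto

text \<open>The head of the context is bound innermost. Hence the induction hypothesis, applied to
  \<open>All \<sigma> \<phi>\<close>, instantiates all outer variables first, and one
  \<open>AllE\<close> remains.\<close>

lemma deriv_binds_inst:
  assumes "typed_sub E E' s" "binds All E \<phi> \<in> set \<Gamma>" "wff E \<phi>"
  shows "deriv {} E' \<Gamma> (subst s \<phi>)"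
  using assms
proof (induction E arbitrary: \<phi> s)
  case Nil
  then show ?case by (simp add: deriv.Hyp subst_closed)
next
  case (Cons \<sigma> E)
  have ty: "typed_sub E E' (\<lambda>i. s (Suc i))" "E' \<turnstile> s 0 \<Colon> \<sigma>"
    using Cons.prems(1) by (auto simp: typed_sub_def)
  have "deriv {} E' \<Gamma> (subst (\<lambda>i. s (Suc i)) (All \<sigma> \<phi>))"
    using Cons.prems ty by (intro Cons.IH) auto
  from deriv.AllE[OF this[simplified] ty(2)] have "deriv {} E' \<Gamma> (subst (case_nat (s 0) (\<lambda>i. s (Suc i))) \<phi>)"
    by (simp add: inst_under)
  moreover have "case_nat (s 0) (\<lambda>i. s (Suc i)) = s"
    by (auto simp: fun_eq_iff split: nat.split)
  ultimately show ?case by simp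
qed

section \<open>Completeness\<close>

instance ty :: countable by countable_datatype
instance cnst :: countable by countable_datatype
instance trm :: countable by countable_datatype
instance form :: countable by countable_datatype

text \<open>
  The Henkin witnesses are the variables of an infinite context in which every type occurs
  infinitely often; variable \<open>k\<close> has type \<open>vty k\<close>.
\<close>

definition vty :: "nat \<Rightarrow> ty" where
  "vty k = fst (from_nat k :: ty \<times> nat)"

definition ctx :: "nat \<Rightarrow> ty list" where
  "ctx n = map vty [0..<n]"

lemma length_ctx [simp]: "length (ctx n) = n"
  by (simp add: ctx_def)

lemma nth_ctx [simp]: "i < n \<Longrightarrow> ctx n ! i = vty i"
  by (simp add: ctx_def)

lemma ctx_0 [simp]: "ctx 0 = []"
  by (simp add: ctx_def)

text \<open>Contexts grow at the outer end, so de Bruijn indices keep their meaning. This is why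
  variables can play the part of Henkin constants without any renaming.\<close>

lemma ctx_append: "n \<le> m \<Longrightarrow> \<exists>E. ctx m = ctx n @ E"
  unfolding ctx_def using upt_add_eq_append[of 0 n "m - n"] by auto

lemma wff_mono: "wff (ctx n) \<phi> \<Longrightarrow> n \<le> m \<Longrightarrow> wff (ctx m) \<phi>"
  using ctx_append wff_append by metis

lemma tyof_mono: "ctx n \<turnstile> t \<Colon> \<sigma> \<Longrightarrow> n \<le> m \<Longrightarrow> ctx m \<turnstile> t \<Colon> \<sigma>"
  using ctx_append tyof_append by metis

lemma deriv_mono: "deriv {} (ctx n) \<Gamma> \<phi> \<Longrightarrow> n \<le> m \<Longrightarrow> deriv {} (ctx m) \<Gamma> \<phi>"
  using ctx_append deriv_context by metis

text \<open>The pairs of \<open>\<sigma>\<close> with different numbers have infinitely many codes,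
  so the codes are unbounded.\<close>

lemma ex_fresh: "\<exists>k\<ge>n. vty k = \<sigma>"
proof -
  have "inj (\<lambda>j::nat. to_nat (\<sigma>, j))"
    by (auto intro: injI)
  then have "infinite (range (\<lambda>j::nat. to_nat (\<sigma>, j)))"
    by (simp add: finite_image_iff)
  then obtain j :: nat where "n \<le> to_nat (\<sigma>, j)"
    by (metis (mono_tags, lifting) finite_nat_set_iff_bounded_le nat_le_linear rangeE)
  then show ?thesis
    by (intro exI[of _ "to_nat (\<sigma>, j)"]) (simp add: vty_def)
qed

section \<open>The Lindenbaum-Henkin construction\<close>

definition consistent :: "form set \<Rightarrow> bool" where
  "consistent S \<longleftrightarrow> \<not> (\<exists>n \<Gamma>. set \<Gamma> \<subseteq> S \<and> deriv {} (ctx n) \<Gamma> \<^bold>\<bottom>)"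

text \<open>Well-formedness in \<open>ctx k\<close> says that only variables below \<open>k\<close>
  occur free, so the variable \<open>k\<close> itself is new for every member of
  \<open>S\<close>.\<close>

definition fresh :: "form set \<Rightarrow> ty \<Rightarrow> nat" where
  "fresh S \<sigma> = (SOME k. vty k = \<sigma> \<and> (\<forall>\<phi>\<in>S. wff (ctx k) \<phi>))"

definition witnesses :: "form set \<Rightarrow> form \<Rightarrow> form set" where
  "witnesses S \<phi> = (case \<phi> of Ex \<sigma> \<psi> \<Rightarrow> {inst \<psi> (Var (fresh (insert \<phi> S) \<sigma>))} | _ \<Rightarrow> {})"

definition extend :: "form set \<Rightarrow> form \<Rightarrow> form set" where
  "extend S \<phi> =
    (if consistent (insert \<phi> S) \<and> (\<exists>n. wff (ctx n) \<phi>) then insert \<phi> S \<union> witnesses S \<phi> else S)"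

fun chain :: "form set \<Rightarrow> nat \<Rightarrow> form set" where
  "chain S 0 = S"
| "chain S (Suc i) = extend (chain S i) (from_nat i)"

definition limit :: "form set \<Rightarrow> form set" where
  "limit S = (\<Union>i. chain S i)"

lemma fresh:
  assumes "\<And>\<phi>. \<phi> \<in> S \<Longrightarrow> wff (ctx n) \<phi>"
  shows "vty (fresh S \<sigma>) = \<sigma>" "\<phi> \<in> S \<Longrightarrow> wff (ctx (fresh S \<sigma>)) \<phi>"
proof -
  obtain k where "n \<le> k" "vty k = \<sigma>" using ex_fresh by blast
  then have "\<exists>k. vty k = \<sigma> \<and> (\<forall>\<phi>\<in>S. wff (ctx k) \<phi>)"
    using assms wff_mono by blast
  from someI_ex[OF this] show "vty (fresh S \<sigma>) = \<sigma>" "\<phi> \<in> S \<Longrightarrow> wff (ctx (fresh S \<sigma>)) \<phi>"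
    by (auto simp: fresh_def)
qed

lemma bounded_insert:
  assumes "\<forall>\<phi>\<in>S. wff (ctx n) \<phi>" "wff (ctx m) \<psi>"
  shows "\<forall>\<phi>\<in>insert \<psi> S. wff (ctx (max n m)) \<phi>"
  using assms by (auto intro: wff_mono)

lemma wff_inst: "wff (\<sigma> # E) \<phi> \<Longrightarrow> E \<turnstile> t \<Colon> \<sigma> \<Longrightarrow> wff E (inst \<phi> t)"
  unfolding inst_def by (erule wff_subst) (auto simp: typed_sub_def nth_Cons split: nat.split)

text \<open>Mapping the witness to the variable bound by the quantifier turns a refutation of the
  instance into one from \<open>ExE\<close>.\<close>

lemma consistent_witness:
  assumes cons: "consistent S" and ex: "Ex \<sigma> \<psi> \<in> S"
    and wff: "\<And>\<phi>. \<phi> \<in> S \<Longrightarrow> wff (ctx k) \<phi>" and k: "vty k = \<sigma>"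
  shows "consistent (insert (inst \<psi> (Var k)) S)"
  unfolding consistent_def
proof
  assume "\<exists>n \<Gamma>. set \<Gamma> \<subseteq> insert (inst \<psi> (Var k)) S \<and> deriv {} (ctx n) \<Gamma> \<^bold>\<bottom>"
  then obtain n \<Gamma> where \<Gamma>: "set \<Gamma> \<subseteq> insert (inst \<psi> (Var k)) S" "deriv {} (ctx n) \<Gamma> \<^bold>\<bottom>"
    by blast
  define \<Gamma>' where "\<Gamma>' = filter (\<lambda>\<phi>. \<phi> \<in> S) \<Gamma>"
  \<comment> \<open>Smaller variables move up to make room for the bound variable. The derivation
    may also mention variables above \<open>k\<close>, although no member of \<open>S\<close> does;
    closed terms remove them.\<close>
  define f where "f i = (if i < k then Var (Suc i) else if i = k then Var 0 else nul (vty i))" for i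
  have \<Gamma>': "set \<Gamma>' \<subseteq> S" by (auto simp: \<Gamma>'_def)
  have "set \<Gamma> \<subseteq> set (inst \<psi> (Var k) # \<Gamma>')"
    using \<Gamma>(1) by (auto simp: \<Gamma>'_def)
  then have "deriv {} (ctx n) (inst \<psi> (Var k) # \<Gamma>') \<^bold>\<bottom>"
    using deriv_weaken[OF \<Gamma>(2)] by blast
  moreover have "typed_sub (ctx n) (\<sigma> # ctx k) f"
    by (auto simp: typed_sub_def f_def k tyof_nul)
  ultimately have "deriv {} (\<sigma> # ctx k) (map (subst f) (inst \<psi> (Var k) # \<Gamma>')) (subst f \<^bold>\<bottom>)"
    by (rule deriv_subst)
  moreover have "subst f (inst \<psi> (Var k)) = \<psi>"
  proof -
    have "wff (\<sigma> # ctx k) \<psi>" using wff[OF ex] by simp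
    then have "subst (\<lambda>i. substt f (case_nat (Var k) Var i)) \<psi> = subst Var \<psi>"
      by (rule subst_cong) (auto simp: f_def split: nat.split)
    then show ?thesis by (simp add: inst_def subst_subst)
  qed
  moreover have "map (subst f) \<Gamma>' = map liftf \<Gamma>'"
  proof (rule map_cong[OF refl])
    fix \<phi> assume "\<phi> \<in> set \<Gamma>'"
    then have "wff (ctx k) \<phi>" using \<Gamma>' wff by blast
    then show "subst f \<phi> = liftf \<phi>"
      by (rule subst_cong) (simp add: f_def)
  qed
  ultimately have "deriv {} (\<sigma> # ctx k) (\<psi> # map liftf (Ex \<sigma> \<psi> # \<Gamma>')) (liftf \<^bold>\<bottom>)"
    by (auto intro: deriv_weaken)
  then have "deriv {} (ctx k) (Ex \<sigma> \<psi> # \<Gamma>') \<^bold>\<bottom>"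
    by (rule deriv.ExE[rotated 2]) (simp_all add: deriv.Hyp)
  then show False
    using cons ex \<Gamma>' unfolding consistent_def by (metis list.set(2) insert_subset)
qed

lemma extend:
  assumes "consistent S" "\<forall>\<phi>\<in>S. wff (ctx n) \<phi>"
  shows "consistent (extend S \<phi>)" "\<exists>m. \<forall>\<psi>\<in>extend S \<phi>. wff (ctx m) \<psi>"
proof -
  have "consistent (extend S \<phi>) \<and> (\<exists>m. \<forall>\<psi>\<in>extend S \<phi>. wff (ctx m) \<psi>)"
  proof (cases "consistent (insert \<phi> S) \<and> (\<exists>m. wff (ctx m) \<phi>)")
    case True
    then obtain m where m: "\<forall>\<psi>\<in>insert \<phi> S. wff (ctx m) \<psi>"
      using bounded_insert[OF assms(2)] by blast
    show ?thesis
    proof (cases "\<exists>\<sigma> \<psi>. \<phi> = Ex \<sigma> \<psi>")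
      case ex: True
      then obtain \<sigma> \<psi> where \<phi>: "\<phi> = Ex \<sigma> \<psi>" by blast
      define k where "k = fresh (insert \<phi> S) \<sigma>"
      have k: "vty k = \<sigma>" "\<And>\<chi>. \<chi> \<in> insert \<phi> S \<Longrightarrow> wff (ctx k) \<chi>"
        unfolding k_def by (rule fresh; use m in blast)+
      have ext: "extend S \<phi> = insert (inst \<psi> (Var k)) (insert \<phi> S)"
        using True by (auto simp: extend_def witnesses_def \<phi> k_def)
      have "wff (ctx (Suc k)) \<chi>" if "\<chi> \<in> insert \<phi> S" for \<chi>
        using k(2)[OF that] wff_mono by auto
      moreover have "wff (ctx (Suc k)) (inst \<psi> (Var k))"
      proof (rule wff_inst)
        show "wff (\<sigma> # ctx (Suc k)) \<psi>" using calculation[of \<phi>] by (simp add: \<phi>)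
      qed (simp add: k)
      moreover have "consistent (insert (inst \<psi> (Var k)) (insert \<phi> S))"
        using True k by (intro consistent_witness[where \<sigma> = \<sigma>]) (auto simp: \<phi>)
      ultimately show ?thesis unfolding ext by blast
    next
      case False
      then have "witnesses S \<phi> = {}" by (auto simp: witnesses_def split: form.split)
      then show ?thesis using True m by (auto simp: extend_def)
    qed
  next
    case False
    then show ?thesis using assms by (auto simp: extend_def)
  qed
  then show "consistent (extend S \<phi>)" "\<exists>m. \<forall>\<psi>\<in>extend S \<phi>. wff (ctx m) \<psi>" by auto
qed

lemma chain:
  assumes "consistent S" "\<forall>\<phi>\<in>S. wff [] \<phi>"
  shows "consistent (chain S i) \<and> (\<exists>n. \<forall>\<phi>\<in>chain S i. wff (ctx n) \<phi>)"
proof (induction i)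
  case 0
  then show ?case using assms by (auto intro!: exI[of _ 0])
qed (use extend in auto)

lemma chain_mono: "i \<le> j \<Longrightarrow> chain S i \<subseteq> chain S j"
  by (rule lift_Suc_mono_le[of "chain S"]) (auto simp: extend_def)

text \<open>The stages increase, so finitely many members appear at a common stage. Since
  derivations use finitely many hypotheses, consistency passes to the union.\<close>

lemma finite_limit:
  assumes "finite F" "F \<subseteq> limit S"
  shows "\<exists>i. F \<subseteq> chain S i"
  using assms
proof (induction F)
  case (insert \<phi> F)
  then obtain i j where "F \<subseteq> chain S i" "\<phi> \<in> chain S j" by (auto simp: limit_def)
  then have "insert \<phi> F \<subseteq> chain S (max i j)"
    using chain_mono[of i "max i j" S] chain_mono[of j "max i j" S] by auto
  then show ?case by blast
qed simp

locale henkin =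
  fixes H :: "form set"
  assumes cons: "consistent H"
    and wff_H: "\<phi> \<in> H \<Longrightarrow> \<exists>n. wff (ctx n) \<phi>"
    and maximal: "wff (ctx n) \<phi> \<Longrightarrow> consistent (insert \<phi> H) \<Longrightarrow> \<phi> \<in> H"
    and witness: "Ex \<sigma> \<phi> \<in> H \<Longrightarrow> \<exists>k. vty k = \<sigma> \<and> inst \<phi> (Var k) \<in> H"

lemma consistent_subset: "consistent S \<Longrightarrow> S' \<subseteq> S \<Longrightarrow> consistent S'"
  unfolding consistent_def by blast

lemma henkin_limit:
  assumes "consistent S" "\<forall>\<phi>\<in>S. wff [] \<phi>"
  shows "henkin (limit S)"
proof
  show cons: "consistent (limit S)"
    unfolding consistent_def using finite_limit[of _ S] chain[OF assms]
    by (metis List.finite_set consistent_def)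
  show "\<exists>n. wff (ctx n) \<phi>" if "\<phi> \<in> limit S" for \<phi>
    using that chain[OF assms] by (auto simp: limit_def)
  have ext: "\<phi> \<in> limit S \<and> witnesses (chain S (to_nat \<phi>)) \<phi> \<subseteq> limit S"
    if \<phi>: "wff (ctx n) \<phi>" "consistent (insert \<phi> (limit S))" for n \<phi>
  proof -
    \<comment> \<open>Consistency with the union is inherited by the stage at which
      \<open>\<phi>\<close> is enumerated, so \<open>\<phi>\<close> is accepted there.\<close>
    have "consistent (insert \<phi> (chain S (to_nat \<phi>)))"
      by (rule consistent_subset[OF \<phi>(2)]) (auto simp: limit_def)
    then have "insert \<phi> (witnesses (chain S (to_nat \<phi>)) \<phi>) \<subseteq> chain S (Suc (to_nat \<phi>))"
      using \<phi>(1) by (auto simp: extend_def)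
    then show ?thesis unfolding limit_def by blast
  qed
  then show "\<phi> \<in> limit S" if "wff (ctx n) \<phi>" "consistent (insert \<phi> (limit S))" for n \<phi>
    using that by blast
  show "\<exists>k. vty k = \<sigma> \<and> inst \<psi> (Var k) \<in> limit S" if *: "Ex \<sigma> \<psi> \<in> limit S" for \<sigma> \<psi>
  proof -
    let ?S = "chain S (to_nat (Ex \<sigma> \<psi>))"
    obtain n where n: "wff (ctx n) (Ex \<sigma> \<psi>)"
      using * chain[OF assms] unfolding limit_def by (metis UN_E)
    obtain m where m: "\<forall>\<phi>\<in>?S. wff (ctx m) \<phi>" using chain[OF assms] by blast
    \<comment> \<open>A formula of the limit is consistent with the limit, so \<open>ext\<close>
      applies to it again. This also provides witnesses for existential formulas that belong to the
      initial set.\<close>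
    have "inst \<psi> (Var (fresh (insert (Ex \<sigma> \<psi>) ?S) \<sigma>)) \<in> limit S"
      using ext[OF n] cons * by (auto simp: witnesses_def insert_absorb)
    moreover have "vty (fresh (insert (Ex \<sigma> \<psi>) ?S) \<sigma>) = \<sigma>"
      by (rule fresh(1)) (use bounded_insert[OF m n] in blast)
    ultimately show ?thesis by blast
  qed
qed

section \<open>Membership in a Henkin set follows the truth tables\<close>

context henkin
begin

text \<open>By maximality, an absent \<open>\<phi>\<close> would be refutable; a cut with its
  derivation from \<open>\<Gamma>\<close> would then refute members of \<open>H\<close>. The two
  derivations may live in different contexts, and the larger one accommodates both.\<close>

lemma ded:
  assumes "set \<Gamma> \<subseteq> H" "deriv {} (ctx n) \<Gamma> \<phi>" "wff (ctx n) \<phi>"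
  shows "\<phi> \<in> H"
proof (rule maximal[OF assms(3)], rule ccontr)
  assume "\<not> consistent (insert \<phi> H)"
  then obtain m \<Delta> where \<Delta>: "set \<Delta> \<subseteq> insert \<phi> H" "deriv {} (ctx m) \<Delta> \<^bold>\<bottom>"
    unfolding consistent_def by blast
  let ?k = "max n m" and ?\<Theta> = "\<Gamma> @ filter (\<lambda>\<psi>. \<psi> \<in> H) \<Delta>"
  have "deriv {} (ctx ?k) (\<phi> # ?\<Theta>) \<^bold>\<bottom>"
    using \<Delta>(1) by (intro deriv_weaken[OF deriv_mono[OF \<Delta>(2)]]) auto
  moreover have "wff (ctx ?k) \<phi>" using assms(3) wff_mono by simp
  moreover have "deriv {} (ctx ?k) ?\<Theta> \<phi>"
    by (intro deriv_weaken[OF deriv_mono[OF assms(2)]]) auto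
  ultimately have "deriv {} (ctx ?k) ?\<Theta> \<^bold>\<bottom>"
    by (meson deriv.ImpE deriv.ImpI)
  moreover have "set ?\<Theta> \<subseteq> H" using assms(1) by auto
  ultimately show False using cons unfolding consistent_def by blast
qed

lemma Fls_notin: "\<^bold>\<bottom> \<notin> H"
  using cons deriv.Hyp[of "\<^bold>\<bottom>" "[\<^bold>\<bottom>]" "{}" "ctx 0"] unfolding consistent_def
  by (metis empty_set insert_subset empty_subsetI list.simps(15) list.set_intros(1))

lemma mp: "(\<phi> \<^bold>\<longrightarrow> \<psi>) \<in> H \<Longrightarrow> \<phi> \<in> H \<Longrightarrow> \<psi> \<in> H"
proof -
  assume *: "(\<phi> \<^bold>\<longrightarrow> \<psi>) \<in> H" "\<phi> \<in> H"
  then obtain n where "wff (ctx n) (\<phi> \<^bold>\<longrightarrow> \<psi>)" using wff_H by blast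
  then show "\<psi> \<in> H" using *
    by (intro ded[OF _ deriv.ImpE[OF deriv.Hyp deriv.Hyp], of "[\<phi> \<^bold>\<longrightarrow> \<psi>, \<phi>]" \<phi> \<psi> n]) simp_all
qed

lemma neg: assumes "wff (ctx n) \<phi>" shows "(\<^bold>\<not> \<phi>) \<in> H \<longleftrightarrow> \<phi> \<notin> H"
proof
  assume "(\<^bold>\<not> \<phi>) \<in> H" then show "\<phi> \<notin> H" using mp Fls_notin by blast
next
  assume "\<phi> \<notin> H"
  then obtain m \<Gamma> where \<Gamma>: "set \<Gamma> \<subseteq> insert \<phi> H" "deriv {} (ctx m) \<Gamma> \<^bold>\<bottom>"
    using maximal[OF assms] unfolding consistent_def by blast
  let ?\<Theta> = "filter (\<lambda>\<psi>. \<psi> \<in> H) \<Gamma>" and ?k = "max n m"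
  have "deriv {} (ctx ?k) (\<phi> # ?\<Theta>) \<^bold>\<bottom>"
    using \<Gamma>(1) by (intro deriv_weaken[OF deriv_mono[OF \<Gamma>(2)]]) auto
  moreover have "wff (ctx ?k) \<phi>" using assms wff_mono by simp
  ultimately show "(\<^bold>\<not> \<phi>) \<in> H"
    by (intro ded[of ?\<Theta> ?k]) (auto intro: deriv.ImpI)
qed

lemma imp: assumes "wff (ctx n) (\<phi> \<^bold>\<longrightarrow> \<psi>)" shows "(\<phi> \<^bold>\<longrightarrow> \<psi>) \<in> H \<longleftrightarrow> (\<phi> \<in> H \<longrightarrow> \<psi> \<in> H)"
proof (intro iffI)
  assume *: "\<phi> \<in> H \<longrightarrow> \<psi> \<in> H"
  show "(\<phi> \<^bold>\<longrightarrow> \<psi>) \<in> H"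
  proof (cases "\<psi> \<in> H")
    case True
    then show ?thesis using assms
      by (intro ded[of "[\<psi>]" n]) (simp_all add: deriv.ImpI deriv.Hyp)
  next
    case False
    then have "(\<^bold>\<not> \<phi>) \<in> H" using * assms neg by auto
    moreover have "deriv {} (ctx n) [\<^bold>\<not> \<phi>] (\<phi> \<^bold>\<longrightarrow> \<psi>)"
    proof (rule deriv.ImpI)
      have "deriv {} (ctx n) [\<^bold>\<not> \<psi>, \<phi>, \<^bold>\<not> \<phi>] \<^bold>\<bottom>"
        by (rule deriv.ImpE[of _ _ _ \<phi>]) (auto intro: deriv.Hyp)
      then show "deriv {} (ctx n) [\<phi>, \<^bold>\<not> \<phi>] \<psi>" using assms by (intro deriv.Contr[of _ \<psi>]) auto
    qed (use assms in auto)
    ultimately show ?thesis using assms by (intro ded[of "[\<^bold>\<not> \<phi>]" n]) auto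
  qed
qed (use mp in blast)

lemma conj: assumes "wff (ctx n) (\<phi> \<^bold>\<and> \<psi>)" shows "(\<phi> \<^bold>\<and> \<psi>) \<in> H \<longleftrightarrow> \<phi> \<in> H \<and> \<psi> \<in> H"
proof (intro iffI conjI)
  assume *: "(\<phi> \<^bold>\<and> \<psi>) \<in> H"
  have d: "deriv {} (ctx n) [\<phi> \<^bold>\<and> \<psi>] (\<phi> \<^bold>\<and> \<psi>)" by (simp add: deriv.Hyp)
  show "\<phi> \<in> H" using * assms by (intro ded[OF _ deriv.AndE1[OF d]]) auto
  show "\<psi> \<in> H" using * assms by (intro ded[OF _ deriv.AndE2[OF d]]) auto
next
  assume "\<phi> \<in> H \<and> \<psi> \<in> H"
  then show "(\<phi> \<^bold>\<and> \<psi>) \<in> H" using assms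
    by (intro ded[of "[\<phi>, \<psi>]" n]) (simp_all add: deriv.AndI deriv.Hyp)
qed

lemma disj: assumes "wff (ctx n) (\<phi> \<^bold>\<or> \<psi>)" shows "(\<phi> \<^bold>\<or> \<psi>) \<in> H \<longleftrightarrow> \<phi> \<in> H \<or> \<psi> \<in> H"
proof
  assume *: "(\<phi> \<^bold>\<or> \<psi>) \<in> H"
  show "\<phi> \<in> H \<or> \<psi> \<in> H"
  proof (rule ccontr)
    assume "\<not> (\<phi> \<in> H \<or> \<psi> \<in> H)"
    then have "set [\<phi> \<^bold>\<or> \<psi>, \<^bold>\<not> \<phi>, \<^bold>\<not> \<psi>] \<subseteq> H" using neg[of n \<phi>] neg[of n \<psi>] assms * by auto
    moreover have "deriv {} (ctx n) [\<phi> \<^bold>\<or> \<psi>, \<^bold>\<not> \<phi>, \<^bold>\<not> \<psi>] \<^bold>\<bottom>"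
    proof (rule deriv.OrE[of _ _ _ \<phi> \<psi>])
      show "deriv {} (ctx n) [\<phi>, \<phi> \<^bold>\<or> \<psi>, \<^bold>\<not> \<phi>, \<^bold>\<not> \<psi>] \<^bold>\<bottom>"
        by (rule deriv.ImpE[of _ _ _ \<phi>]) (auto intro: deriv.Hyp)
      show "deriv {} (ctx n) [\<psi>, \<phi> \<^bold>\<or> \<psi>, \<^bold>\<not> \<phi>, \<^bold>\<not> \<psi>] \<^bold>\<bottom>"
        by (rule deriv.ImpE[of _ _ _ \<psi>]) (auto intro: deriv.Hyp)
    qed (simp add: deriv.Hyp)
    ultimately show False using cons unfolding consistent_def by blast
  qed
next
  assume "\<phi> \<in> H \<or> \<psi> \<in> H"
  then show "(\<phi> \<^bold>\<or> \<psi>) \<in> H"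
  proof
    assume "\<phi> \<in> H" then show ?thesis using assms
      by (intro ded[of "[\<phi>]" n]) (simp_all add: deriv.OrI1 deriv.Hyp)
  next
    assume "\<psi> \<in> H" then show ?thesis using assms
      by (intro ded[of "[\<psi>]" n]) (simp_all add: deriv.OrI2 deriv.Hyp)
  qed
qed

definition typed :: "trm \<Rightarrow> ty \<Rightarrow> bool" where
  "typed t \<sigma> \<longleftrightarrow> (\<exists>n. ctx n \<turnstile> t \<Colon> \<sigma>)"

lemma typed_ctx: "typed t \<sigma> \<Longrightarrow> \<exists>m\<ge>n. ctx m \<turnstile> t \<Colon> \<sigma>"
  unfolding typed_def using tyof_mono by (metis max.cobounded1 max.cobounded2)

lemma typed_Var: "typed (Var k) (vty k)"
  unfolding typed_def by (rule exI[of _ "Suc k"]) simp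

lemma ex: assumes "wff (ctx n) (Ex \<sigma> \<phi>)"
  shows "Ex \<sigma> \<phi> \<in> H \<longleftrightarrow> (\<exists>t. typed t \<sigma> \<and> inst \<phi> t \<in> H)"
proof
  assume "Ex \<sigma> \<phi> \<in> H" then show "\<exists>t. typed t \<sigma> \<and> inst \<phi> t \<in> H"
    using witness typed_Var by blast
next
  assume "\<exists>t. typed t \<sigma> \<and> inst \<phi> t \<in> H"
  then obtain t m where t: "inst \<phi> t \<in> H" "m \<ge> n" "ctx m \<turnstile> t \<Colon> \<sigma>" using typed_ctx by blast
  moreover have "wff (ctx m) (Ex \<sigma> \<phi>)" using assms wff_mono t(2) by blast
  ultimately show "Ex \<sigma> \<phi> \<in> H"
    by (intro ded[OF _ deriv.ExI[OF _ _ deriv.Hyp], of "[inst \<phi> t]" \<sigma> m \<phi> t]) simp_all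
qed

text \<open>For the converse, a witness of the negated matrix would contradict the assumption on
  instances. So \<open>H\<close> denies that there is a counterexample, and classical logic derives
  the universal formula from this.\<close>

lemma all: assumes "wff (ctx n) (All \<sigma> \<phi>)"
  shows "All \<sigma> \<phi> \<in> H \<longleftrightarrow> (\<forall>t. typed t \<sigma> \<longrightarrow> inst \<phi> t \<in> H)"
proof (intro iffI allI impI)
  fix t assume *: "All \<sigma> \<phi> \<in> H" "typed t \<sigma>"
  then obtain m where t: "m \<ge> n" "ctx m \<turnstile> t \<Colon> \<sigma>" using typed_ctx by blast
  have "wff (ctx m) (All \<sigma> \<phi>)" using assms wff_mono t(1) by blast
  moreover have "deriv {} (ctx m) [All \<sigma> \<phi>] (inst \<phi> t)"
    by (rule deriv.AllE[OF _ t(2)]) (simp add: deriv.Hyp)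
  ultimately show "inst \<phi> t \<in> H"
    using * t(2) by (intro ded[of "[All \<sigma> \<phi>]" m]) (auto intro: wff_inst)
next
  assume *: "\<forall>t. typed t \<sigma> \<longrightarrow> inst \<phi> t \<in> H"
  show "All \<sigma> \<phi> \<in> H"
  proof (rule ccontr)
    assume no: "All \<sigma> \<phi> \<notin> H"
    have w: "wff (ctx n) (Ex \<sigma> (\<^bold>\<not> \<phi>))" "wff (\<sigma> # ctx n) \<phi>" using assms by auto
    have "Ex \<sigma> (\<^bold>\<not> \<phi>) \<notin> H"
    proof
      assume "Ex \<sigma> (\<^bold>\<not> \<phi>) \<in> H"
      then obtain t where "typed t \<sigma>" "inst (\<^bold>\<not> \<phi>) t \<in> H" using ex[OF w(1)] by blast
      then have "(\<^bold>\<not> inst \<phi> t) \<in> H" "inst \<phi> t \<in> H" using * by (auto simp: inst_def)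
      then show False using mp Fls_notin by blast
    qed
    then have "(\<^bold>\<not> Ex \<sigma> (\<^bold>\<not> \<phi>)) \<in> H" using neg[OF w(1)] by blast
    moreover have "deriv {} (ctx n) [\<^bold>\<not> Ex \<sigma> (\<^bold>\<not> \<phi>)] (All \<sigma> \<phi>)"
    proof (intro deriv.AllI deriv.Contr[OF w(2)])
      let ?\<Gamma> = "(\<^bold>\<not> \<phi>) # map liftf [\<^bold>\<not> Ex \<sigma> (\<^bold>\<not> \<phi>)]"
      \<comment> \<open>The eigenvariable itself is the witness: lifting the matrix under its binder
        and instantiating with \<open>Var 0\<close> cancel out.\<close>
      have i: "inst (subst (under (\<lambda>n. Var (Suc n))) (\<^bold>\<not> \<phi>)) (Var 0) = (\<^bold>\<not> \<phi>)"
      proof -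
        have "case_nat (Var 0) (\<lambda>n. Var (Suc n)) = Var" by (auto simp: fun_eq_iff split: nat.split)
        then show ?thesis by (simp add: inst_under del: subst.simps)
      qed
      have "typed_sub (\<sigma> # ctx n) (\<sigma> # \<sigma> # ctx n) (under (\<lambda>n. Var (Suc n)))"
        by (rule typed_sub_under) (rule typed_sub_tail)
      then have "deriv {} (\<sigma> # ctx n) ?\<Gamma> (Ex \<sigma> (subst (under (\<lambda>n. Var (Suc n))) (\<^bold>\<not> \<phi>)))"
        using w(2) wff_subst by (intro deriv.ExI[where t = "Var 0"]) (simp_all add: i deriv.Hyp del: subst.simps)
      moreover have "deriv {} (\<sigma> # ctx n) ?\<Gamma> (\<^bold>\<not> Ex \<sigma> (subst (under (\<lambda>n. Var (Suc n))) (\<^bold>\<not> \<phi>)))"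
        by (rule deriv.Hyp) simp
      ultimately show "deriv {} (\<sigma> # ctx n) ?\<Gamma> \<^bold>\<bottom>" by (meson deriv.ImpE)
    qed
    ultimately have "All \<sigma> \<phi> \<in> H" using assms by (intro ded) auto
    then show False using no by blast
  qed
qed

end

section \<open>Models\<close>

text \<open>All types share one carrier and are separated by \<open>dom\<close>. Function domains
  may be proper subsets of the full function space, as a model built from terms requires.\<close>

record 'm interp =
  dom :: "ty \<Rightarrow> 'm set"
  app :: "'m \<Rightarrow> 'm \<Rightarrow> 'm"
  const :: "cnst \<Rightarrow> 'm"
  leq :: "'m \<Rightarrow> 'm \<Rightarrow> bool"
  std :: "ty \<Rightarrow> 'm \<Rightarrow> bool"

fun eval :: "'m interp \<Rightarrow> (nat \<Rightarrow> 'm) \<Rightarrow> trm \<Rightarrow> 'm" where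
  "eval M e (Var n) = e n"
| "eval M e (Cst c) = const M c"
| "eval M e (s \<cdot> t) = app M (eval M e s) (eval M e t)"

fun sat :: "'m interp \<Rightarrow> (nat \<Rightarrow> 'm) \<Rightarrow> form \<Rightarrow> bool" where
  "sat M e (s \<^bold>= t) \<longleftrightarrow> eval M e s = eval M e t"
| "sat M e (s \<^bold>\<le> t) \<longleftrightarrow> leq M (eval M e s) (eval M e t)"
| "sat M e (St \<sigma> t) \<longleftrightarrow> std M \<sigma> (eval M e t)"
| "sat M e \<^bold>\<bottom> \<longleftrightarrow> False"
| "sat M e (\<phi> \<^bold>\<and> \<psi>) \<longleftrightarrow> sat M e \<phi> \<and> sat M e \<psi>"
| "sat M e (\<phi> \<^bold>\<or> \<psi>) \<longleftrightarrow> sat M e \<phi> \<or> sat M e \<psi>"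
| "sat M e (\<phi> \<^bold>\<longrightarrow> \<psi>) \<longleftrightarrow> (sat M e \<phi> \<longrightarrow> sat M e \<psi>)"
| "sat M e (All \<sigma> \<phi>) \<longleftrightarrow> (\<forall>x\<in>dom M \<sigma>. sat M (case_nat x e) \<phi>)"
| "sat M e (Ex \<sigma> \<phi>) \<longleftrightarrow> (\<exists>x\<in>dom M \<sigma>. sat M (case_nat x e) \<phi>)"
| "sat M e (AllSt \<sigma> \<phi>) \<longleftrightarrow> (\<forall>x\<in>dom M \<sigma>. std M \<sigma> x \<longrightarrow> sat M (case_nat x e) \<phi>)"
| "sat M e (ExSt \<sigma> \<phi>) \<longleftrightarrow> (\<exists>x\<in>dom M \<sigma>. std M \<sigma> x \<and> sat M (case_nat x e) \<phi>)"

lemma eval_substt: "eval M e (substt f t) = eval M (\<lambda>i. eval M e (f i)) t"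
  by (induction t) simp_all

lemma eval_lift [simp]: "eval M (case_nat x e) (lift t) = eval M e t"
  by (simp add: lift_def eval_substt)

lemma case_nat_under: "(\<lambda>i. eval M (case_nat x e) (under f i)) = case_nat x (\<lambda>i. eval M e (f i))"
proof
  fix i show "eval M (case_nat x e) (under f i) = case_nat x (\<lambda>i. eval M e (f i)) i"
    by (cases i) simp_all
qed

lemma sat_subst: "sat M e (subst f \<phi>) \<longleftrightarrow> sat M (\<lambda>i. eval M e (f i)) \<phi>"
  by (induction \<phi> arbitrary: e f) (simp_all add: eval_substt case_nat_under)

lemma eval_cong:
  "E \<turnstile> t \<Colon> \<sigma> \<Longrightarrow> (\<And>i. i < length E \<Longrightarrow> e i = e' i) \<Longrightarrow> eval M e t = eval M e' t"
proof (induction t arbitrary: \<sigma>)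
  case (App s t)
  from App.prems(1) obtain \<rho> where "E \<turnstile> s \<Colon> \<rho> \<rightarrow> \<sigma>" "E \<turnstile> t \<Colon> \<rho>"
    by (auto split: option.splits ty.splits if_splits)
  then show ?case using App.IH App.prems(2) by auto
qed (auto split: if_splits)

lemma sat_cong:
  "wff E \<phi> \<Longrightarrow> (\<And>i. i < length E \<Longrightarrow> e i = e' i) \<Longrightarrow> sat M e \<phi> \<longleftrightarrow> sat M e' \<phi>"
proof (induction \<phi> arbitrary: E e e')
  case (Eq s t)
  then show ?case using eval_cong[of E s _ e e'] eval_cong[of E t _ e e'] by simp
next
  case (Le s t)
  then show ?case using eval_cong[of E s _ e e'] eval_cong[of E t _ e e'] by simp
next
  case (St \<sigma> t)
  then show ?case using eval_cong[of E t _ e e'] by simp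
next
  case (And \<phi> \<psi>)
  then show ?case using And.IH(1)[of E e e'] And.IH(2)[of E e e'] by simp
next
  case (Or \<phi> \<psi>)
  then show ?case using Or.IH(1)[of E e e'] Or.IH(2)[of E e e'] by simp
next
  case (Imp \<phi> \<psi>)
  then show ?case using Imp.IH(1)[of E e e'] Imp.IH(2)[of E e e'] by simp
next
  case (All \<sigma> \<phi>)
  have "sat M (case_nat x e) \<phi> \<longleftrightarrow> sat M (case_nat x e') \<phi>" for x
    using All.prems by (intro All.IH[of "\<sigma> # E"]) (auto split: nat.split)
  then show ?case by simp
next
  case (Ex \<sigma> \<phi>)
  have "sat M (case_nat x e) \<phi> \<longleftrightarrow> sat M (case_nat x e') \<phi>" for x
    using Ex.prems by (intro Ex.IH[of "\<sigma> # E"]) (auto split: nat.split)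
  then show ?case by simp
next
  case (AllSt \<sigma> \<phi>)
  have "sat M (case_nat x e) \<phi> \<longleftrightarrow> sat M (case_nat x e') \<phi>" for x
    using AllSt.prems by (intro AllSt.IH[of "\<sigma> # E"]) (auto split: nat.split)
  then show ?case by simp
next
  case (ExSt \<sigma> \<phi>)
  have "sat M (case_nat x e) \<phi> \<longleftrightarrow> sat M (case_nat x e') \<phi>" for x
    using ExSt.prems by (intro ExSt.IH[of "\<sigma> # E"]) (auto split: nat.split)
  then show ?case by simp
qed simp

definition wfenv :: "'m interp \<Rightarrow> ty list \<Rightarrow> (nat \<Rightarrow> 'm) \<Rightarrow> bool" where
  "wfenv M E e \<longleftrightarrow> (\<forall>i<length E. e i \<in> dom M (E ! i))"

text \<open>Only the well-formed axioms are required to hold, so well-formedness has to be checked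
  just for the instances that are used.\<close>

locale model =
  fixes T :: thy and M :: "'m interp"
  assumes const_dom: "const M c \<in> dom M (cty c)"
    and app_dom: "f \<in> dom M (\<sigma> \<rightarrow> \<tau>) \<Longrightarrow> x \<in> dom M \<sigma> \<Longrightarrow> app M f x \<in> dom M \<tau>"
    and extensional: "f \<in> dom M (\<sigma> \<rightarrow> \<tau>) \<Longrightarrow> g \<in> dom M (\<sigma> \<rightarrow> \<tau>) \<Longrightarrow>
      (\<And>x. x \<in> dom M \<sigma> \<Longrightarrow> app M f x = app M g x) \<Longrightarrow> f = g"
    and axiom: "(E, \<phi>) \<in> T \<Longrightarrow> wff E \<phi> \<Longrightarrow> wfenv M E e \<Longrightarrow> sat M e \<phi>"

text \<open>Axioms with parameters are represented in \<open>H\<close> by their universal closures;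
  \<open>axiom_inst\<close> recovers their instances at Henkin terms.\<close>

locale henkin_theory = henkin +
  fixes T :: thy
  assumes efa_st: "efa_st \<subseteq> T"
    and closure: "(E, \<phi>) \<in> T \<Longrightarrow> wff E \<phi> \<Longrightarrow> binds All E \<phi> \<in> H"
begin

lemma typed_sub_ctx:
  assumes "\<forall>i<length E. typed (s i) (E ! i)"
  shows "\<exists>n. typed_sub E (ctx n) s"
proof -
  have "\<forall>i\<in>{..<length E}. \<exists>n. ctx n \<turnstile> s i \<Colon> E ! i" using assms by (auto simp: typed_def)
  then obtain n where n: "\<forall>i\<in>{..<length E}. ctx (n i) \<turnstile> s i \<Colon> E ! i" by metis
  have "n i \<le> Max (insert 0 (n ` {..<length E}))" if "i < length E" for i
    using that by (intro Max_ge) auto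
  then show ?thesis using n unfolding typed_sub_def by (meson lessThan_iff tyof_mono)
qed

lemma axiom_inst:
  assumes "(E, \<phi>) \<in> T" "wff E \<phi>" "\<forall>i<length E. typed (s i) (E ! i)"
  shows "subst s \<phi> \<in> H"
proof -
  obtain n where n: "typed_sub E (ctx n) s" using typed_sub_ctx assms by blast
  then have "deriv {} (ctx n) [binds All E \<phi>] (subst s \<phi>)"
    using assms(2) by (intro deriv_binds_inst) auto
  then show ?thesis
    using closure[OF assms(1,2)] wff_subst[OF assms(2) n] by (intro ded) auto
qed

lemma axiom_H: "(ctx n, \<phi>) \<in> efa \<Longrightarrow> wff (ctx n) \<phi> \<Longrightarrow> \<phi> \<in> H"
  using axiom_inst[of "ctx n" \<phi> Var] efa_st efa_st.efa typed_Var by auto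

lemma axiom_st: "(ctx n, \<phi>) \<in> efa_st \<Longrightarrow> wff (ctx n) \<phi> \<Longrightarrow> \<phi> \<in> H"
  using axiom_inst[of "ctx n" \<phi> Var] efa_st typed_Var by auto

lemma typed_ctx2: "typed s \<sigma> \<Longrightarrow> typed t \<tau> \<Longrightarrow> \<exists>n. ctx n \<turnstile> s \<Colon> \<sigma> \<and> ctx n \<turnstile> t \<Colon> \<tau>"
proof -
  assume *: "typed s \<sigma>" "typed t \<tau>"
  obtain n where n: "ctx n \<turnstile> s \<Colon> \<sigma>" using * by (auto simp: typed_def)
  obtain m where "n \<le> m" "ctx m \<turnstile> t \<Colon> \<tau>" using typed_ctx * by blast
  with n show ?thesis using tyof_mono by blast
qed

lemma typed_ctx3: "typed s \<sigma> \<Longrightarrow> typed t \<tau> \<Longrightarrow> typed u \<rho> \<Longrightarrow>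
    \<exists>n. ctx n \<turnstile> s \<Colon> \<sigma> \<and> ctx n \<turnstile> t \<Colon> \<tau> \<and> ctx n \<turnstile> u \<Colon> \<rho>"
proof -
  assume *: "typed s \<sigma>" "typed t \<tau>" "typed u \<rho>"
  obtain n where n: "ctx n \<turnstile> s \<Colon> \<sigma>" "ctx n \<turnstile> t \<Colon> \<tau>" using typed_ctx2 * by blast
  obtain m where "n \<le> m" "ctx m \<turnstile> u \<Colon> \<rho>" using typed_ctx * by blast
  with n show ?thesis using tyof_mono by blast
qed

lemma typed_App: "typed s (\<sigma> \<rightarrow> \<tau>) \<Longrightarrow> typed t \<sigma> \<Longrightarrow> typed (s \<cdot> t) \<tau>"
proof -
  assume "typed s (\<sigma> \<rightarrow> \<tau>)" "typed t \<sigma>"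
  then obtain n where "ctx n \<turnstile> s \<Colon> \<sigma> \<rightarrow> \<tau>" "ctx n \<turnstile> t \<Colon> \<sigma>" using typed_ctx2 by blast
  then show ?thesis by (auto simp: typed_def intro!: exI[of _ n])
qed

lemma typed_unique: "typed t \<sigma> \<Longrightarrow> typed t \<tau> \<Longrightarrow> \<sigma> = \<tau>"
  using typed_ctx2[of t \<sigma> t \<tau>] by auto

lemma typed_Cst: "typed (Cst c) (cty c)"
  by (simp add: typed_def)

section \<open>Provable extensional equality is a congruence\<close>

definition teq :: "ty \<Rightarrow> trm \<Rightarrow> trm \<Rightarrow> bool" where
  "teq \<sigma> s t \<longleftrightarrow> eqt \<sigma> s t \<in> H"

text \<open>A universal formula belongs to \<open>H\<close> exactly when its term instances do, so
  equality of functions reduces to equality of their values at terms.\<close>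

lemma teq_fun:
  assumes "typed s (\<sigma> \<rightarrow> \<tau>)" "typed t (\<sigma> \<rightarrow> \<tau>)"
  shows "teq (\<sigma> \<rightarrow> \<tau>) s t \<longleftrightarrow> (\<forall>x. typed x \<sigma> \<longrightarrow> teq \<tau> (s \<cdot> x) (t \<cdot> x))"
proof -
  obtain n where "ctx n \<turnstile> s \<Colon> \<sigma> \<rightarrow> \<tau>" "ctx n \<turnstile> t \<Colon> \<sigma> \<rightarrow> \<tau>" using typed_ctx2[OF assms] by blast
  then have "wff (ctx n) (eqt (\<sigma> \<rightarrow> \<tau>) s t)" by (rule wff_eqt)
  then show ?thesis
    by (simp add: teq_def all inst_def subst_eqt substt_lift)
qed

text \<open>The axioms speak of equality at type 0 only; as for symmetry and transitivity, higher
  types follow by induction through \<open>teq_fun\<close>.\<close>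

lemma teq_refl: "typed s \<sigma> \<Longrightarrow> teq \<sigma> s s"
proof (induction \<sigma> arbitrary: s)
  case Base
  then obtain n where "ctx n \<turnstile> s \<Colon> \<zero>" by (auto simp: typed_def)
  then show ?case unfolding teq_def using axiom_H[of n "s \<^bold>= s"] by (simp add: efa.eq_refl)
qed (auto simp: teq_fun intro: typed_App)

lemma teq_sym: "typed s \<sigma> \<Longrightarrow> typed t \<sigma> \<Longrightarrow> teq \<sigma> s t \<Longrightarrow> teq \<sigma> t s"
proof (induction \<sigma> arbitrary: s t)
  case Base
  then obtain n where "ctx n \<turnstile> s \<Colon> \<zero>" "ctx n \<turnstile> t \<Colon> \<zero>" using typed_ctx2 by blast
  then have "(s \<^bold>= t \<^bold>\<longrightarrow> t \<^bold>= s) \<in> H" by (intro axiom_H[of n]) (simp_all add: efa.eq_sym)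
  then show ?case using Base mp by (simp add: teq_def)
next
  case (Fun \<sigma> \<tau>)
  have "teq \<tau> (t \<cdot> x) (s \<cdot> x)" if "typed x \<sigma>" for x
    using Fun.IH(2)[OF typed_App[OF Fun.prems(1) that] typed_App[OF Fun.prems(2) that]]
      Fun.prems(3) teq_fun[OF Fun.prems(1,2)] that by blast
  then show ?case using teq_fun Fun.prems by blast
qed

lemma teq_trans:
  "typed s \<sigma> \<Longrightarrow> typed t \<sigma> \<Longrightarrow> typed u \<sigma> \<Longrightarrow> teq \<sigma> s t \<Longrightarrow> teq \<sigma> t u \<Longrightarrow> teq \<sigma> s u"
proof (induction \<sigma> arbitrary: s t u)
  case Base
  then obtain n where "ctx n \<turnstile> s \<Colon> \<zero>" "ctx n \<turnstile> t \<Colon> \<zero>" "ctx n \<turnstile> u \<Colon> \<zero>" using typed_ctx3 by metis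
  then have "(s \<^bold>= t \<^bold>\<longrightarrow> t \<^bold>= u \<^bold>\<longrightarrow> s \<^bold>= u) \<in> H" by (intro axiom_H[of n]) (simp_all add: efa.eq_trans)
  then show ?case using Base(4,5) mp unfolding teq_def eqt.simps by blast
next
  case (Fun \<sigma> \<tau>)
  show ?case
    unfolding teq_fun[OF Fun.prems(1,3)]
  proof (intro allI impI)
    fix x assume x: "typed x \<sigma>"
    have "teq \<tau> (s \<cdot> x) (t \<cdot> x)" "teq \<tau> (t \<cdot> x) (u \<cdot> x)"
      using Fun.prems(4,5) teq_fun[OF Fun.prems(1,2)] teq_fun[OF Fun.prems(2,3)] x by blast+
    then show "teq \<tau> (s \<cdot> x) (u \<cdot> x)"
      using Fun.prems(1-3) x by (meson Fun.IH(2) typed_App)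
  qed
qed

text \<open>Exchanging the function uses the definition of equality at function types, and
  exchanging the argument is the extensionality axiom.\<close>

lemma teq_App:
  assumes "typed s (\<sigma> \<rightarrow> \<tau>)" "typed s' (\<sigma> \<rightarrow> \<tau>)" "typed t \<sigma>" "typed t' \<sigma>"
    and "teq (\<sigma> \<rightarrow> \<tau>) s s'" "teq \<sigma> t t'"
  shows "teq \<tau> (s \<cdot> t) (s' \<cdot> t')"
proof (rule teq_trans)
  show "teq \<tau> (s \<cdot> t) (s' \<cdot> t)" using assms by (simp add: teq_fun)
  obtain n where n: "ctx n \<turnstile> t \<Colon> \<sigma>" "ctx n \<turnstile> t' \<Colon> \<sigma>" "ctx n \<turnstile> s' \<Colon> \<sigma> \<rightarrow> \<tau>"
    using typed_ctx3 assms by metis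
  then have "(eqt \<sigma> t t' \<^bold>\<longrightarrow> eqt \<tau> (s' \<cdot> t) (s' \<cdot> t')) \<in> H"
    by (intro axiom_H[of n] efa.ext) (auto intro: wff_eqt)
  then show "teq \<tau> (s' \<cdot> t) (s' \<cdot> t')"
    using assms(6) mp unfolding teq_def by blast
qed (use assms typed_App in blast)+

section \<open>The quotient of the Henkin terms and the truth lemma\<close>

definition cls :: "trm \<Rightarrow> trm set" where
  "cls t = {u. \<exists>\<sigma>. typed t \<sigma> \<and> typed u \<sigma> \<and> teq \<sigma> t u}"

definition rep :: "trm set \<Rightarrow> trm" where
  "rep X = (SOME t. t \<in> X)"

lemma cls_eq: "typed s \<sigma> \<Longrightarrow> typed t \<sigma> \<Longrightarrow> cls s = cls t \<longleftrightarrow> teq \<sigma> s t"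
proof
  assume *: "typed s \<sigma>" "typed t \<sigma>" "cls s = cls t"
  have "t \<in> cls t" using * teq_refl by (auto simp: cls_def)
  then show "teq \<sigma> s t" using * typed_unique by (auto simp: cls_def)
next
  assume *: "typed s \<sigma>" "typed t \<sigma>" "teq \<sigma> s t"
  show "cls s = cls t"
  proof (intro set_eqI iffI)
    fix u assume "u \<in> cls s"
    then have u: "typed u \<sigma>" "teq \<sigma> s u" using *(1) typed_unique by (auto simp: cls_def)
    then have "teq \<sigma> t u" using teq_trans[OF *(2,1) u(1)] teq_sym[OF *] by blast
    then show "u \<in> cls t" using * u by (auto simp: cls_def)
  next
    fix u assume "u \<in> cls t"
    then have u: "typed u \<sigma>" "teq \<sigma> t u" using *(2) typed_unique by (auto simp: cls_def)
    then have "teq \<sigma> s u" using teq_trans[OF *(1,2) u(1)] *(3) by blast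
    then show "u \<in> cls s" using * u by (auto simp: cls_def)
  qed
qed

lemma rep_cls: "typed t \<sigma> \<Longrightarrow> typed (rep (cls t)) \<sigma> \<and> teq \<sigma> t (rep (cls t))"
proof -
  assume t: "typed t \<sigma>"
  then have "\<exists>u. u \<in> cls t" using teq_refl by (auto simp: cls_def)
  then have "rep (cls t) \<in> cls t" unfolding rep_def by (rule someI_ex)
  then show ?thesis using t typed_unique by (auto simp: cls_def)
qed

text \<open>Everything is read off at chosen representatives. Independence of the choice rests on
  \<open>teq_App\<close> for application, on \<open>eq_le\<close> for the order and on
  \<open>st_eq\<close> for standardness.\<close>

definition term_model :: "trm set interp" where
  "term_model =
    \<lparr>dom = (\<lambda>\<sigma>. {cls t | t. typed t \<sigma>}),
     app = (\<lambda>X Y. cls (rep X \<cdot> rep Y)),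
     const = (\<lambda>c. cls (Cst c)),
     leq = (\<lambda>X Y. (rep X \<^bold>\<le> rep Y) \<in> H),
     std = (\<lambda>\<sigma> X. St \<sigma> (rep X) \<in> H)\<rparr>"

lemma app_cls: "typed s (\<sigma> \<rightarrow> \<tau>) \<Longrightarrow> typed t \<sigma> \<Longrightarrow> app term_model (cls s) (cls t) = cls (s \<cdot> t)"
  using rep_cls[of s "\<sigma> \<rightarrow> \<tau>"] rep_cls[of t \<sigma>]
    teq_App[of s \<sigma> \<tau> "rep (cls s)" t "rep (cls t)"]
    cls_eq[of "s \<cdot> t" \<tau> "rep (cls s) \<cdot> rep (cls t)"] typed_App
  by (auto simp: term_model_def)

lemma leq_cls:
  assumes "typed s \<zero>" "typed t \<zero>"
  shows "leq term_model (cls s) (cls t) \<longleftrightarrow> (s \<^bold>\<le> t) \<in> H"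
proof -
  have *: "(s \<^bold>\<le> t) \<in> H \<Longrightarrow> (s' \<^bold>\<le> t') \<in> H"
    if ty: "typed s \<zero>" "typed t \<zero>" "typed s' \<zero>" "typed t' \<zero>" "teq \<zero> s s'" "teq \<zero> t t'" for s t s' t'
  proof -
    obtain n where "ctx n \<turnstile> s \<Colon> \<zero>" "ctx n \<turnstile> t \<Colon> \<zero>" "ctx n \<turnstile> s' \<Colon> \<zero>" "ctx n \<turnstile> t' \<Colon> \<zero>"
    proof -
      obtain n where n: "ctx n \<turnstile> s \<Colon> \<zero>" "ctx n \<turnstile> t \<Colon> \<zero>" "ctx n \<turnstile> s' \<Colon> \<zero>"
        using typed_ctx3[OF ty(1-3)] by blast
      obtain m where "n \<le> m" "ctx m \<turnstile> t' \<Colon> \<zero>" using typed_ctx[OF ty(4)] by blast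
      with n show ?thesis using that tyof_mono by blast
    qed
    then have "(s \<^bold>= s' \<^bold>\<longrightarrow> t \<^bold>= t' \<^bold>\<longrightarrow> s \<^bold>\<le> t \<^bold>\<longrightarrow> s' \<^bold>\<le> t') \<in> H"
      by (intro axiom_H[of n] efa.eq_le) auto
    then show "(s \<^bold>\<le> t) \<in> H \<Longrightarrow> (s' \<^bold>\<le> t') \<in> H"
      using ty(5,6) mp unfolding teq_def eqt.simps by blast
  qed
  have r: "typed (rep (cls s)) \<zero>" "teq \<zero> s (rep (cls s))" "typed (rep (cls t)) \<zero>" "teq \<zero> t (rep (cls t))"
    using rep_cls assms by blast+
  then have "teq \<zero> (rep (cls s)) s" "teq \<zero> (rep (cls t)) t" using teq_sym assms by blast+
  then have "(rep (cls s) \<^bold>\<le> rep (cls t)) \<in> H \<longleftrightarrow> (s \<^bold>\<le> t) \<in> H"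
    using * r assms by (intro iffI) blast+
  then show ?thesis by (simp add: term_model_def)
qed

lemma std_cls:
  assumes "typed t \<sigma>"
  shows "std term_model \<sigma> (cls t) \<longleftrightarrow> St \<sigma> t \<in> H"
proof -
  have *: "St \<sigma> s \<in> H \<Longrightarrow> St \<sigma> t \<in> H" if ty: "typed s \<sigma>" "typed t \<sigma>" "teq \<sigma> s t" for s t
  proof -
    obtain n where n: "ctx n \<turnstile> s \<Colon> \<sigma>" "ctx n \<turnstile> t \<Colon> \<sigma>"
      using ty(1,2) typed_ctx2 by blast
    then have w: "wff (ctx n) (St \<sigma> s \<^bold>\<and> eqt \<sigma> s t)" by (simp add: wff_eqt)
    then have "(St \<sigma> s \<^bold>\<and> eqt \<sigma> s t \<^bold>\<longrightarrow> St \<sigma> t) \<in> H"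
      using n by (intro axiom_st[of n] efa_st.st_eq) auto
    then show "St \<sigma> s \<in> H \<Longrightarrow> St \<sigma> t \<in> H"
      using ty(3) mp conj[OF w] unfolding teq_def by blast
  qed
  then show ?thesis
    using rep_cls[OF assms] teq_sym assms by (auto simp: term_model_def)
qed

lemma eval_cls:
  assumes "E \<turnstile> t \<Colon> \<sigma>" "\<forall>i<length E. typed (s i) (E ! i)"
  shows "eval term_model (\<lambda>i. cls (s i)) t = cls (substt s t) \<and> typed (substt s t) \<sigma>"
  using assms
proof (induction t arbitrary: \<sigma>)
  case (Var n)
  then show ?case by (auto split: if_splits)
next
  case (Cst c)
  then show ?case using typed_Cst[of c] by (simp add: term_model_def)
next
  case (App t u)
  from App.prems(1) obtain \<rho> where "E \<turnstile> t \<Colon> \<rho> \<rightarrow> \<sigma>" "E \<turnstile> u \<Colon> \<rho>"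
    by (auto split: option.splits ty.splits if_splits)
  then show ?case using App.IH(1)[of "\<rho> \<rightarrow> \<sigma>"] App.IH(2)[of \<rho>] App.prems
    by (auto simp: app_cls intro: typed_App)
qed

lemma typed_env_case:
  "typed t \<sigma> \<Longrightarrow> \<forall>i<length E. typed (s i) (E ! i) \<Longrightarrow>
    \<forall>i<length (\<sigma> # E). typed (case_nat t s i) ((\<sigma> # E) ! i)"
  by (auto simp: nth_Cons split: nat.split)

lemma cls_case: "(\<lambda>i. cls (case_nat t s i)) = case_nat (cls t) (\<lambda>i. cls (s i))"
  by (auto simp: fun_eq_iff split: nat.split)

lemma dom_term_model [simp]: "dom term_model \<sigma> = {cls t | t. typed t \<sigma>}"
  by (simp add: term_model_def)

text \<open>The substitution \<open>s\<close> is general in order that the induction can extend it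
  by a term at each quantifier; the interest lies in \<open>s = Var\<close>.\<close>

lemma truth:
  assumes "wff E \<phi>" "\<forall>i<length E. typed (s i) (E ! i)"
  shows "sat term_model (\<lambda>i. cls (s i)) \<phi> \<longleftrightarrow> subst s \<phi> \<in> H"
  using assms
proof (induction \<phi> arbitrary: E s)
  case (Eq t u)
  then show ?case using eval_cls[of E t \<zero> s] eval_cls[of E u \<zero> s] cls_eq[of "substt s t" \<zero> "substt s u"]
    by (simp add: teq_def)
next
  case (Le t u)
  then show ?case using eval_cls[of E t \<zero> s] eval_cls[of E u \<zero> s] leq_cls by simp
next
  case (St \<sigma> t)
  then show ?case using eval_cls[of E t \<sigma> s] std_cls by simp
next
  case Fls
  then show ?case using Fls_notin by simp
next
  case (And \<phi> \<psi>)
  then obtain n where "typed_sub E (ctx n) s" using typed_sub_ctx by blast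
  then have "wff (ctx n) (subst s (\<phi> \<^bold>\<and> \<psi>))" using And.prems wff_subst by blast
  then show ?case using conj And.IH[of E s] And.prems by simp
next
  case (Or \<phi> \<psi>)
  then obtain n where "typed_sub E (ctx n) s" using typed_sub_ctx by blast
  then have "wff (ctx n) (subst s (\<phi> \<^bold>\<or> \<psi>))" using Or.prems wff_subst by blast
  then show ?case using disj Or.IH[of E s] Or.prems by simp
next
  case (Imp \<phi> \<psi>)
  then obtain n where "typed_sub E (ctx n) s" using typed_sub_ctx by blast
  then have "wff (ctx n) (subst s (\<phi> \<^bold>\<longrightarrow> \<psi>))" using Imp.prems wff_subst by blast
  then show ?case using imp Imp.IH[of E s] Imp.prems by simp
next
  case (All \<sigma> \<phi>)
  then obtain n where n: "typed_sub E (ctx n) s" using typed_sub_ctx by blast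
  then have w: "wff (ctx n) (All \<sigma> (subst (under s) \<phi>))" using wff_subst[OF All.prems(1) n] by simp
  have IH: "sat term_model (case_nat (cls t) (\<lambda>i. cls (s i))) \<phi> \<longleftrightarrow> subst (case_nat t s) \<phi> \<in> H"
    if "typed t \<sigma>" for t
    using All.IH[of "\<sigma> # E" "case_nat t s"] All.prems that typed_env_case by (simp add: cls_case)
  show ?case by (auto simp: all[OF w] IH inst_under)
next
  case (Ex \<sigma> \<phi>)
  then obtain n where n: "typed_sub E (ctx n) s" using typed_sub_ctx by blast
  then have w: "wff (ctx n) (Ex \<sigma> (subst (under s) \<phi>))" using wff_subst[OF Ex.prems(1) n] by simp
  have IH: "sat term_model (case_nat (cls t) (\<lambda>i. cls (s i))) \<phi> \<longleftrightarrow> subst (case_nat t s) \<phi> \<in> H"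
    if "typed t \<sigma>" for t
    using Ex.IH[of "\<sigma> # E" "case_nat t s"] Ex.prems that typed_env_case by (simp add: cls_case)
  show ?case by (auto simp: ex[OF w] IH inst_under)
next
  case (AllSt \<sigma> \<phi>)
  let ?\<psi> = "All \<sigma> (St \<sigma> (Var 0) \<^bold>\<longrightarrow> \<phi>)"
  obtain n where n: "typed_sub E (ctx n) s" using typed_sub_ctx AllSt.prems by blast
  have "wff E (AllSt \<sigma> \<phi> \<^bold>\<longleftrightarrow> ?\<psi>)" using AllSt.prems by simp
  then have w: "wff (ctx n) (subst s (AllSt \<sigma> \<phi> \<^bold>\<longleftrightarrow> ?\<psi>))" using n wff_subst by blast
  \<comment> \<open>The calculus has no rules for standard quantifiers. This instance of (EQ) in
    \<open>H\<close> replaces the formula by one with an ordinary quantifier.\<close>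
  have "subst s (AllSt \<sigma> \<phi> \<^bold>\<longleftrightarrow> ?\<psi>) \<in> H"
    using AllSt.prems efa_st efa_st.EQ_all by (intro axiom_inst[of E]) auto
  then have eq: "subst s (AllSt \<sigma> \<phi>) \<in> H \<longleftrightarrow> subst s ?\<psi> \<in> H"
    using w by (auto simp: conj imp)
  have w': "wff (ctx n) (All \<sigma> (St \<sigma> (Var 0) \<^bold>\<longrightarrow> subst (under s) \<phi>))" using w by simp
  have IH: "sat term_model (case_nat (cls t) (\<lambda>i. cls (s i))) \<phi> \<longleftrightarrow> subst (case_nat t s) \<phi> \<in> H"
    if "typed t \<sigma>" for t
    using AllSt.IH[of "\<sigma> # E" "case_nat t s"] AllSt.prems that typed_env_case by (simp add: cls_case)
  have "inst (St \<sigma> (Var 0) \<^bold>\<longrightarrow> subst (under s) \<phi>) t \<in> H \<longleftrightarrow>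
      (St \<sigma> t \<in> H \<longrightarrow> subst (case_nat t s) \<phi> \<in> H)" if t: "typed t \<sigma>" for t
  proof -
    obtain m where m: "m \<ge> n" "ctx m \<turnstile> t \<Colon> \<sigma>" using typed_ctx t by blast
    have "wff (\<sigma> # ctx m) (St \<sigma> (Var 0) \<^bold>\<longrightarrow> subst (under s) \<phi>)"
      using wff_mono[OF w' m(1)] by simp
    from wff_inst[OF this m(2)] show ?thesis
      by (simp add: imp inst_under[symmetric]) (simp add: inst_def imp)
  qed
  then show ?case
    unfolding eq using all[OF w'] by (auto simp: IH std_cls)
next
  case (ExSt \<sigma> \<phi>)
  let ?\<psi> = "Ex \<sigma> (St \<sigma> (Var 0) \<^bold>\<and> \<phi>)"
  obtain n where n: "typed_sub E (ctx n) s" using typed_sub_ctx ExSt.prems by blast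
  have "wff E (ExSt \<sigma> \<phi> \<^bold>\<longleftrightarrow> ?\<psi>)" using ExSt.prems by simp
  then have w: "wff (ctx n) (subst s (ExSt \<sigma> \<phi> \<^bold>\<longleftrightarrow> ?\<psi>))" using n wff_subst by blast
  have "subst s (ExSt \<sigma> \<phi> \<^bold>\<longleftrightarrow> ?\<psi>) \<in> H"
    using ExSt.prems efa_st efa_st.EQ_ex by (intro axiom_inst[of E]) auto
  then have eq: "subst s (ExSt \<sigma> \<phi>) \<in> H \<longleftrightarrow> subst s ?\<psi> \<in> H"
    using w by (auto simp: conj imp)
  have w': "wff (ctx n) (Ex \<sigma> (St \<sigma> (Var 0) \<^bold>\<and> subst (under s) \<phi>))" using w by simp
  have IH: "sat term_model (case_nat (cls t) (\<lambda>i. cls (s i))) \<phi> \<longleftrightarrow> subst (case_nat t s) \<phi> \<in> H"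
    if "typed t \<sigma>" for t
    using ExSt.IH[of "\<sigma> # E" "case_nat t s"] ExSt.prems that typed_env_case by (simp add: cls_case)
  have "inst (St \<sigma> (Var 0) \<^bold>\<and> subst (under s) \<phi>) t \<in> H \<longleftrightarrow>
      St \<sigma> t \<in> H \<and> subst (case_nat t s) \<phi> \<in> H" if t: "typed t \<sigma>" for t
  proof -
    obtain m where m: "m \<ge> n" "ctx m \<turnstile> t \<Colon> \<sigma>" using typed_ctx t by blast
    have "wff (\<sigma> # ctx m) (St \<sigma> (Var 0) \<^bold>\<and> subst (under s) \<phi>)"
      using wff_mono[OF w' m(1)] by simp
    from wff_inst[OF this m(2)] show ?thesis
      by (simp add: conj inst_under[symmetric]) (simp add: inst_def conj)
  qed
  then show ?case
    unfolding eq using ex[OF w'] by (auto simp: IH std_cls)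
qed

lemma model_term_model: "model T term_model"
proof
  show "const term_model c \<in> dom term_model (cty c)" for c
    using typed_Cst by (auto simp: term_model_def)
  show "app term_model f x \<in> dom term_model \<tau>"
    if "f \<in> dom term_model (\<sigma> \<rightarrow> \<tau>)" "x \<in> dom term_model \<sigma>" for f x \<sigma> \<tau>
    using that typed_App by (auto simp: app_cls)
  show "f = g" if fg: "f \<in> dom term_model (\<sigma> \<rightarrow> \<tau>)" "g \<in> dom term_model (\<sigma> \<rightarrow> \<tau>)"
    "\<And>x. x \<in> dom term_model \<sigma> \<Longrightarrow> app term_model f x = app term_model g x" for f g \<sigma> \<tau>
  proof -
    obtain s t where st: "f = cls s" "typed s (\<sigma> \<rightarrow> \<tau>)" "g = cls t" "typed t (\<sigma> \<rightarrow> \<tau>)"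
      using fg by auto
    have "teq \<tau> (s \<cdot> x) (t \<cdot> x)" if x: "typed x \<sigma>" for x
    proof -
      have "cls (s \<cdot> x) = cls (t \<cdot> x)" using fg(3)[of "cls x"] x st by (auto simp: app_cls)
      then show ?thesis using cls_eq typed_App st x by blast
    qed
    then show "f = g" using st cls_eq teq_fun by blast
  qed
  show "sat term_model e \<phi>" if "(E, \<phi>) \<in> T" "wff E \<phi>" "wfenv term_model E e" for E \<phi> e
  proof -
    have "\<forall>i. \<exists>t. i < length E \<longrightarrow> e i = cls t \<and> typed t (E ! i)"
      using that(3) by (auto simp: wfenv_def)
    then obtain s where s: "\<forall>i<length E. e i = cls (s i) \<and> typed (s i) (E ! i)" by metis
    then have "sat term_model (\<lambda>i. cls (s i)) \<phi>"
      using truth[OF that(2), of s] axiom_inst[OF that(1,2), of s] by blast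
    moreover have "sat term_model e \<phi> \<longleftrightarrow> sat term_model (\<lambda>i. cls (s i)) \<phi>"
      by (rule sat_cong[OF that(2)]) (use s in blast)
    ultimately show ?thesis by blast
  qed
qed

end

text \<open>One carrier type suffices because the countermodel consists of sets of terms. The
  inclusion of \<open>efa_st\<close> supplies the equality axioms behind the quotient and (EQ) for
  the standard quantifiers.\<close>

theorem completeness:
  assumes "efa_st \<subseteq> T" "wff [] \<phi>"
    and models: "\<And>(M :: trm set interp) e. model T M \<Longrightarrow> sat M e \<phi>"
  shows "T \<tturnstile> \<phi>"
proof (rule ccontr)
  assume not: "\<not> T \<tturnstile> \<phi>"
  \<comment> \<open>Universal closures turn axioms with parameters into sentences, so that
    substitutions leave these hypotheses unchanged.\<close>
  define Th where "Th = {binds All E \<psi> | E \<psi>. (E, \<psi>) \<in> T \<and> wff E \<psi>}"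
  have Th: "wff [] \<psi> \<and> deriv T [] [] \<psi>" if "\<psi> \<in> Th" for \<psi>
    using that by (auto simp: Th_def wff_binds intro: deriv_binds_All[OF deriv.Axiom])
  let ?S = "insert (\<^bold>\<not> \<phi>) Th"
  have wf: "\<forall>\<psi>\<in>?S. wff [] \<psi>" using Th assms(2) by auto
  have "consistent ?S"
    unfolding consistent_def
  proof
    assume "\<exists>n \<Gamma>. set \<Gamma> \<subseteq> ?S \<and> deriv {} (ctx n) \<Gamma> \<^bold>\<bottom>"
    then obtain n \<Gamma> where \<Gamma>: "set \<Gamma> \<subseteq> ?S" "deriv {} (ctx n) \<Gamma> \<^bold>\<bottom>" by blast
    \<comment> \<open>Closed terms replace the free variables of the refutation, which brings it
      into the empty context required by \<open>proves\<close>.\<close>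
    have "typed_sub (ctx n) [] (\<lambda>i. nul (vty i))" by (simp add: typed_sub_def tyof_nul)
    from deriv_subst[OF \<Gamma>(2) this] have "deriv {} [] (map (subst (\<lambda>i. nul (vty i))) \<Gamma>) \<^bold>\<bottom>" by simp
    moreover have "map (subst (\<lambda>i. nul (vty i))) \<Gamma> = \<Gamma>"
      using \<Gamma>(1) wf by (intro map_idI subst_closed) blast
    ultimately have d: "deriv {} [] \<Gamma> \<^bold>\<bottom>" by simp
    let ?\<Gamma> = "filter (\<lambda>\<psi>. \<psi> \<in> Th) \<Gamma>"
    have "deriv T [] ((\<^bold>\<not> \<phi>) # ?\<Gamma>) \<^bold>\<bottom>"
      by (rule deriv_weaken[OF d]) (use \<Gamma>(1) in auto)
    then have "deriv T [] ?\<Gamma> \<phi>" by (rule deriv.Contr[OF assms(2)])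
    then have "deriv T [] [] \<phi>" by (rule deriv_discharge) (use Th in auto)
    then show False using not by (simp add: proves_def)
  qed
  then interpret henkin "limit ?S" using wf by (rule henkin_limit)
  have sub: "?S \<subseteq> limit ?S" unfolding limit_def using chain.simps(1)[of ?S] by blast
  interpret henkin_theory "limit ?S" T
    by unfold_locales (use assms(1) sub in \<open>auto simp: Th_def\<close>)
  have "sat term_model (\<lambda>i. cls (Var i)) \<phi>" by (rule models[OF model_term_model])
  then have "\<phi> \<in> limit ?S" using truth[OF assms(2), of Var] by simp
  then show False using sub mp Fls_notin by blast
qed

section \<open>Typing of the coding terms\<close>

lemma tyof_pred_subst:
  "\<sigma> # E \<turnstile> t \<Colon> \<tau> \<Longrightarrow> \<not> occurs0 t \<Longrightarrow> E \<turnstile> substt (\<lambda>n. Var (n - 1)) t \<Colon> \<tau>"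
proof (induction t arbitrary: \<tau>)
  case (Var n)
  then show ?case by (cases n) (auto split: if_splits)
next
  case (App s t)
  from App.prems(1) obtain \<rho> where "\<sigma> # E \<turnstile> s \<Colon> \<rho> \<rightarrow> \<tau>" "\<sigma> # E \<turnstile> t \<Colon> \<rho>"
    by (auto split: option.splits ty.splits if_splits)
  then show ?case using App by auto
qed simp

lemma tyof_lam: "\<sigma> # E \<turnstile> t \<Colon> \<tau> \<Longrightarrow> E \<turnstile> lam E \<sigma> t \<Colon> \<sigma> \<rightarrow> \<tau>"
proof (induction t arbitrary: \<tau>)
  case (App s t)
  from App.prems(1) obtain \<rho> where "\<sigma> # E \<turnstile> s \<Colon> \<rho> \<rightarrow> \<tau>" "\<sigma> # E \<turnstile> t \<Colon> \<rho>"
    by (auto split: option.splits ty.splits if_splits)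
  then show ?case
    using App.IH App.prems tyof_pred_subst[OF App.prems] by (auto simp: lam.simps)
next
  case (Var n)
  then show ?case using tyof_pred_subst[OF Var] by (auto simp: lam.simps)
next
  case (Cst c)
  then show ?case by (auto simp: lam.simps)
qed

text \<open>Written with \<open>the\<close> so that it acts as a rewrite rule: the simplifier
  computes the type of the body instead of having to guess it.\<close>

lemma tyof_lams:
  "tyof (rev \<sigma>s @ E) t \<noteq> None \<Longrightarrow>
    tyof E (lams E \<sigma>s t) = Some (foldr Fun \<sigma>s (the (tyof (rev \<sigma>s @ E) t)))"
proof (induction \<sigma>s arbitrary: E)
  case (Cons \<sigma> \<sigma>s)
  then have "tyof (\<sigma> # E) (lams (\<sigma> # E) \<sigma>s t) =
      Some (foldr Fun \<sigma>s (the (tyof (rev (\<sigma> # \<sigma>s) @ E) t)))"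
    by simp
  from tyof_lam[OF this] show ?case by simp
qed auto

text \<open>The coding terms are abstractions formed in the empty context; typing them there settles
  every context.\<close>

lemma tyof_closed: "[] \<turnstile> t \<Colon> \<sigma> \<Longrightarrow> E \<turnstile> t \<Colon> \<sigma>"
  using tyof_append[of "[]" t \<sigma> E] by simp

lemmas typing = tyof_lams tyof_nul

lemma tyof_pred: "E \<turnstile> pred \<Colon> \<zero> \<rightarrow> \<zero>"
  by (rule tyof_closed) (simp add: pred_def typing del: lams.simps)

lemma tyof_monus: "E \<turnstile> monus \<Colon> \<zero> \<rightarrow> \<zero> \<rightarrow> \<zero>"
  by (rule tyof_closed) (simp add: monus_def typing tyof_pred del: lams.simps)

lemma tyof_tri: "E \<turnstile> tri \<Colon> \<zero> \<rightarrow> \<zero>"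
  by (rule tyof_closed) (simp add: tri_def typing del: lams.simps)

lemma tyof_pair: "E \<turnstile> pair \<Colon> \<zero> \<rightarrow> \<zero> \<rightarrow> \<zero>"
  by (rule tyof_closed) (simp add: pair_def typing tyof_tri del: lams.simps)

lemma tyof_diag: "E \<turnstile> diag \<Colon> \<zero> \<rightarrow> \<zero>"
  by (rule tyof_closed) (simp add: diag_def typing tyof_tri tyof_monus del: lams.simps)

lemma tyof_proj1: "E \<turnstile> proj1 \<Colon> \<zero> \<rightarrow> \<zero>"
  by (rule tyof_closed) (simp add: proj1_def typing tyof_tri tyof_monus tyof_diag del: lams.simps)

lemma tyof_proj2: "E \<turnstile> proj2 \<Colon> \<zero> \<rightarrow> \<zero>"
  by (rule tyof_closed) (simp add: proj2_def typing tyof_proj1 tyof_monus tyof_diag del: lams.simps)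

lemma tyof_head: "E \<turnstile> head \<Colon> \<zero> \<rightarrow> \<zero>"
  by (rule tyof_closed) (simp add: head_def typing tyof_proj1 tyof_pred del: lams.simps)

lemma tyof_tail: "E \<turnstile> tail \<Colon> \<zero> \<rightarrow> \<zero>"
  by (rule tyof_closed) (simp add: tail_def typing tyof_proj2 tyof_pred del: lams.simps)

lemma tyof_drop0: "E \<turnstile> drop0 \<Colon> \<zero> \<rightarrow> \<zero> \<rightarrow> \<zero>"
  by (rule tyof_closed) (simp add: drop0_def typing tyof_tail del: lams.simps)

lemma tyof_len0 [simp]: "E \<turnstile> len0 \<Colon> \<zero> \<rightarrow> \<zero>"
  by (rule tyof_closed) (simp add: len0_def tyof_drop0)

lemma tyof_cmp0 [simp]: "E \<turnstile> cmp0 \<Colon> \<zero> \<rightarrow> \<zero> \<rightarrow> \<zero>"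
  by (rule tyof_closed) (simp add: cmp0_def typing tyof_drop0 tyof_head del: lams.simps)

lemma tyof_seg [simp]: "E \<turnstile> seg \<Colon> \<one> \<rightarrow> \<zero> \<rightarrow> \<zero>"
  by (rule tyof_closed)
    (simp add: seg_def Let_def typing tyof_pair tyof_monus del: lams.simps)

lemma tyof_len [simp]: "E \<turnstile> len \<tau> \<Colon> \<tau> \<rightarrow> \<zero>"
proof (induction \<tau> arbitrary: E)
  case (Fun \<sigma> \<tau>)
  show ?case by (rule tyof_closed) (simp add: typing Fun del: lams.simps)
qed simp

lemma tyof_cmp [simp]: "E \<turnstile> cmp \<tau> \<Colon> \<tau> \<rightarrow> \<zero> \<rightarrow> \<tau>"
proof (induction \<tau> arbitrary: E)
  case (Fun \<sigma> \<tau>)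
  show ?case by (rule tyof_closed) (simp add: typing Fun del: lams.simps)
qed simp

lemma tyof_mkseq: "E \<turnstile> mkseq \<tau> \<Colon> (\<zero> \<rightarrow> \<tau>) \<rightarrow> \<zero> \<rightarrow> \<tau>"
proof (induction \<tau> arbitrary: E)
  case (Fun \<sigma> \<tau>)
  show ?case by (rule tyof_closed) (simp add: typing Fun del: lams.simps)
qed simp

lemma tyof_block_len: "E \<turnstile> block_len \<sigma> \<tau> \<Colon> (\<sigma> \<rightarrow> \<tau>) \<rightarrow> \<sigma> \<rightarrow> \<zero> \<rightarrow> \<zero>"
  by (rule tyof_closed) (simp add: block_len_def typing del: lams.simps cmp.simps len.simps)

lemma tyof_block_end: "E \<turnstile> block_end \<sigma> \<tau> \<Colon> (\<sigma> \<rightarrow> \<tau>) \<rightarrow> \<sigma> \<rightarrow> \<zero> \<rightarrow> \<zero>"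
  by (rule tyof_closed) (simp add: block_end_def typing tyof_block_len del: lams.simps)

lemma tyof_block: "E \<turnstile> block \<sigma> \<tau> \<Colon> (\<sigma> \<rightarrow> \<tau>) \<rightarrow> \<sigma> \<rightarrow> \<zero> \<rightarrow> \<zero>"
  by (rule tyof_closed)
    (simp add: block_def typing tyof_block_end tyof_monus del: lams.simps cmp.simps len.simps)

lemma tyof_entry: "E \<turnstile> entry \<sigma> \<tau> \<Colon> (\<sigma> \<rightarrow> \<tau>) \<rightarrow> \<sigma> \<rightarrow> \<zero> \<rightarrow> \<tau>"
  by (rule tyof_closed)
    (simp add: entry_def Let_def typing tyof_block_end tyof_block_len tyof_block tyof_monus
      del: lams.simps cmp.simps len.simps)

lemma tyof_collect [simp]: "E \<turnstile> collect \<sigma> \<tau> \<Colon> (\<sigma> \<rightarrow> \<tau>) \<rightarrow> \<sigma> \<rightarrow> \<tau>"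
  by (rule tyof_closed)
    (simp add: collect_def Let_def typing tyof_block_end tyof_block_len tyof_entry tyof_mkseq tyof_monus
      del: lams.simps cmp.simps len.simps)

lemma lift_closed: "[] \<turnstile> t \<Colon> \<sigma> \<Longrightarrow> lift t = t"
  by (simp add: lift_def substt_closed)

lemma lift_coding [simp]:
  "lift len0 = len0" "lift cmp0 = cmp0" "lift seg = seg" "lift (collect \<sigma> \<tau>) = collect \<sigma> \<tau>"
  by (rule lift_closed, simp)+

section \<open>Evaluation in models\<close>

lemma wfenv_Nil [simp]: "wfenv M [] e"
  by (simp add: wfenv_def)

lemma wfenv_Cons [simp]: "wfenv M (\<sigma> # E) (case_nat x e) \<longleftrightarrow> x \<in> dom M \<sigma> \<and> wfenv M E e"
  by (auto simp: wfenv_def nth_Cons less_Suc_eq_0_disj split: nat.splits)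

definition stdenv :: "'m interp \<Rightarrow> ty list \<Rightarrow> (nat \<Rightarrow> 'm) \<Rightarrow> bool" where
  "stdenv M E e \<longleftrightarrow> (\<forall>i<length E. std M (E ! i) (e i))"

lemma stdenv_Nil [simp]: "stdenv M [] e"
  by (simp add: stdenv_def)

lemma stdenv_Cons [simp]: "stdenv M (\<sigma> # E) (case_nat x e) \<longleftrightarrow> std M \<sigma> x \<and> stdenv M E e"
  by (auto simp: stdenv_def nth_Cons less_Suc_eq_0_disj split: nat.splits)

lemma lift_pred_subst: "\<not> occurs0 t \<Longrightarrow> lift (substt (\<lambda>n. Var (n - 1)) t) = t"
  by (induction t) (auto simp: lift_def)

locale nonstandard_model = model +
  assumes efa_st: "efa_st \<subseteq> T"
begin

lemma axiom_efa: "(E, \<phi>) \<in> efa \<Longrightarrow> wff E \<phi> \<Longrightarrow> wfenv M E e \<Longrightarrow> sat M e \<phi>"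
  using axiom efa_st efa_st.efa by blast

lemma axiom_st: "(E, \<phi>) \<in> efa_st \<Longrightarrow> wff E \<phi> \<Longrightarrow> wfenv M E e \<Longrightarrow> sat M e \<phi>"
  using axiom efa_st by blast

lemma eval_dom: "E \<turnstile> t \<Colon> \<sigma> \<Longrightarrow> wfenv M E e \<Longrightarrow> eval M e t \<in> dom M \<sigma>"
proof (induction t arbitrary: \<sigma>)
  case (App s t)
  from App.prems(1) obtain \<rho> where "E \<turnstile> s \<Colon> \<rho> \<rightarrow> \<sigma>" "E \<turnstile> t \<Colon> \<rho>"
    by (auto split: option.splits ty.splits if_splits)
  then show ?case using App.IH App.prems(2) by (auto intro: app_dom)
qed (auto simp: wfenv_def const_dom split: if_splits)

text \<open>Function domains are extensional, so the quantifiers in \<open>eqt\<close> collapse to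
  identity by induction on the type.\<close>

lemma sat_eqt:
  "E \<turnstile> s \<Colon> \<sigma> \<Longrightarrow> E \<turnstile> t \<Colon> \<sigma> \<Longrightarrow> wfenv M E e \<Longrightarrow>
    sat M e (eqt \<sigma> s t) \<longleftrightarrow> eval M e s = eval M e t"
proof (induction \<sigma> arbitrary: E e s t)
  case (Fun \<sigma> \<tau>)
  have "sat M (case_nat x e) (eqt \<tau> (lift s \<cdot> Var 0) (lift t \<cdot> Var 0)) \<longleftrightarrow>
      app M (eval M e s) x = app M (eval M e t) x" if "x \<in> dom M \<sigma>" for x
    using Fun.IH(2)[of "\<sigma> # E" "lift s \<cdot> Var 0" "lift t \<cdot> Var 0" "case_nat x e"] Fun.prems that
    by (simp add: tyof_lift)
  then show ?case
    using extensional[OF eval_dom[OF Fun.prems(1,3)] eval_dom[OF Fun.prems(2,3)]] by auto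
qed simp

text \<open>The pattern for using an axiom scheme in a model: take its instance at variables and let
  the environment supply the elements.\<close>

lemma app_Pi:
  assumes "x \<in> dom M \<rho>" "y \<in> dom M \<tau>"
  shows "app M (app M (const M (Pi \<rho> \<tau>)) x) y = x"
proof -
  let ?E = "[\<rho>, \<tau>]" and ?e = "case_nat x (case_nat y (\<lambda>_. x))"
  have "(?E, eqt \<rho> (Cst (Pi \<rho> \<tau>) \<cdot> Var 0 \<cdot> Var 1) (Var 0)) \<in> efa" by (rule efa.pi) simp_all
  then have "sat M ?e (eqt \<rho> (Cst (Pi \<rho> \<tau>) \<cdot> Var 0 \<cdot> Var 1) (Var 0))"
    by (rule axiom_efa) (simp_all add: wff_eqt assms)
  then show ?thesis using assms by (simp add: sat_eqt[of ?E] One_nat_def)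
qed

lemma app_Sig:
  assumes "x \<in> dom M (\<delta> \<rightarrow> \<rho> \<rightarrow> \<tau>)" "y \<in> dom M (\<delta> \<rightarrow> \<rho>)" "z \<in> dom M \<delta>"
  shows "app M (app M (app M (const M (Sig \<delta> \<rho> \<tau>)) x) y) z = app M (app M x z) (app M y z)"
proof -
  let ?E = "[\<delta> \<rightarrow> \<rho> \<rightarrow> \<tau>, \<delta> \<rightarrow> \<rho>, \<delta>]" and ?e = "case_nat x (case_nat y (case_nat z (\<lambda>_. x)))"
  let ?\<phi> = "eqt \<tau> (Cst (Sig \<delta> \<rho> \<tau>) \<cdot> Var 0 \<cdot> Var 1 \<cdot> Var 2) (Var 0 \<cdot> Var 2 \<cdot> (Var 1 \<cdot> Var 2))"
  have "(?E, ?\<phi>) \<in> efa" by (rule efa.sig) simp_all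
  then have "sat M ?e ?\<phi>"
    by (rule axiom_efa) (simp_all add: wff_eqt assms)
  then show ?thesis using assms by (simp add: sat_eqt[of ?E] One_nat_def)
qed

text \<open>Bracket abstraction has three cases: \<open>Pi\<close> discards the argument,
  \<open>Sig\<close> distributes it over an application, and \<open>Sig\<close> with two
  \<open>Pi\<close> is the identity.\<close>

lemma eval_lam:
  "\<sigma> # E \<turnstile> t \<Colon> \<tau> \<Longrightarrow> wfenv M E e \<Longrightarrow> x \<in> dom M \<sigma> \<Longrightarrow>
    app M (eval M e (lam E \<sigma> t)) x = eval M (case_nat x e) t"
proof (induction t arbitrary: \<tau>)
  case (Var n)
  show ?case
  proof (cases n)
    case 0
    have dom: "const M (Pi \<sigma> (\<sigma> \<rightarrow> \<sigma>)) \<in> dom M (\<sigma> \<rightarrow> (\<sigma> \<rightarrow> \<sigma>) \<rightarrow> \<sigma>)" "const M (Pi \<sigma> \<sigma>) \<in> dom M (\<sigma> \<rightarrow> \<sigma> \<rightarrow> \<sigma>)"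
      using const_dom[of "Pi \<sigma> (\<sigma> \<rightarrow> \<sigma>)"] const_dom[of "Pi \<sigma> \<sigma>"] by simp_all
    show ?thesis
      using 0 Var.prems app_Sig[OF dom Var.prems(3)] app_Pi[OF Var.prems(3) app_dom[OF dom(2) Var.prems(3)]]
      by (simp add: lam.simps)
  next
    case (Suc m)
    then show ?thesis
      using Var.prems by (auto simp: lam.simps wfenv_def app_Pi split: if_splits)
  qed
next
  case (Cst c)
  then show ?case using const_dom[of c] by (auto simp: lam.simps app_Pi)
next
  case (App s t)
  from App.prems(1) obtain \<rho> where st: "\<sigma> # E \<turnstile> s \<Colon> \<rho> \<rightarrow> \<tau>" "\<sigma> # E \<turnstile> t \<Colon> \<rho>"
    by (auto split: option.splits ty.splits if_splits)
  show ?case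
  proof (cases "occurs0 (s \<cdot> t)")
    case True
    then have "lam E \<sigma> (s \<cdot> t) = Cst (Sig \<sigma> \<rho> \<tau>) \<cdot> lam E \<sigma> s \<cdot> lam E \<sigma> t"
      using st by (subst lam.simps) simp
    then show ?thesis
      using App.IH st App.prems eval_dom[OF tyof_lam[OF st(1)]] eval_dom[OF tyof_lam[OF st(2)]]
      by (simp add: app_Sig)
  next
    case False
    \<comment> \<open>For a body without the abstracted variable, lowering the indices is undone by
      \<open>lift\<close>, and evaluating a lifted term drops the new value.\<close>
    let ?t = "substt (\<lambda>n. Var (n - 1)) (s \<cdot> t)"
    have "lam E \<sigma> (s \<cdot> t) = Cst (Pi \<tau> \<sigma>) \<cdot> ?t"
      using False App.prems(1) by (subst lam.simps) simp
    moreover have "eval M e ?t \<in> dom M \<tau>"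
      using eval_dom[OF tyof_pred_subst[OF App.prems(1) False] App.prems(2)] .
    ultimately have "app M (eval M e (lam E \<sigma> (s \<cdot> t))) x = eval M e ?t"
      using App.prems(3) by (simp add: app_Pi del: substt.simps)
    also have "\<dots> = eval M (case_nat x e) (lift ?t)" by (simp only: eval_lift)
    finally show ?thesis unfolding lift_pred_subst[OF False] .
  qed
qed

lemma std_const: "std M (cty c) (const M c)"
proof -
  have "([], St (cty c) (Cst c)) \<in> efa_st" by (rule efa_st.st_closed) simp
  then have "sat M (\<lambda>_. undefined) (St (cty c) (Cst c))" by (rule axiom_st) simp_all
  then show ?thesis by simp
qed

lemma std_app:
  assumes "x \<in> dom M (\<sigma> \<rightarrow> \<tau>)" "y \<in> dom M \<sigma>" "std M (\<sigma> \<rightarrow> \<tau>) x" "std M \<sigma> y"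
  shows "std M \<tau> (app M x y)"
proof -
  let ?E = "[\<sigma> \<rightarrow> \<tau>, \<sigma>]" and ?e = "case_nat x (case_nat y (\<lambda>_. x))"
  let ?\<phi> = "St (\<sigma> \<rightarrow> \<tau>) (Var 0) \<^bold>\<and> St \<sigma> (Var 1) \<^bold>\<longrightarrow> St \<tau> (Var 0 \<cdot> Var 1)"
  have "(?E, ?\<phi>) \<in> efa_st" by (rule efa_st.st_app) simp_all
  then have "sat M ?e ?\<phi>" by (rule axiom_st) (simp_all add: assms)
  then show ?thesis using assms by (simp add: One_nat_def)
qed

lemma std_eval: "E \<turnstile> t \<Colon> \<sigma> \<Longrightarrow> wfenv M E e \<Longrightarrow> stdenv M E e \<Longrightarrow> std M \<sigma> (eval M e t)"
proof (induction t arbitrary: \<sigma>)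
  case (App s t)
  from App.prems(1) obtain \<rho> where st: "E \<turnstile> s \<Colon> \<rho> \<rightarrow> \<sigma>" "E \<turnstile> t \<Colon> \<rho>"
    by (auto split: option.splits ty.splits if_splits)
  then show ?case using App.IH App.prems std_app[OF eval_dom eval_dom] by auto
qed (auto simp: stdenv_def std_const split: if_splits)

text \<open>The source of explicitly defined functionals. Standardness comes along because constants
  are standard and application preserves it.\<close>

lemma comprehension:
  assumes "\<sigma> # E \<turnstile> t \<Colon> \<tau>" "wfenv M E e"
  shows "\<exists>f\<in>dom M (\<sigma> \<rightarrow> \<tau>). (\<forall>x\<in>dom M \<sigma>. app M f x = eval M (case_nat x e) t)
    \<and> (stdenv M E e \<longrightarrow> std M (\<sigma> \<rightarrow> \<tau>) f)"
  using eval_lam[OF assms] eval_dom[OF tyof_lam[OF assms(1)] assms(2)]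
    std_eval[OF tyof_lam[OF assms(1)] assms(2)] by blast

definition denot :: "trm \<Rightarrow> 'a" where
  "denot t = eval M (\<lambda>_. undefined) t"

lemma eval_closed: "[] \<turnstile> t \<Colon> \<sigma> \<Longrightarrow> eval M e t = denot t"
  unfolding denot_def by (rule eval_cong) auto

lemma denot_dom: "[] \<turnstile> t \<Colon> \<sigma> \<Longrightarrow> denot t \<in> dom M \<sigma>"
  unfolding denot_def by (rule eval_dom) auto

end

lemma case_nat_1 [simp]: "case_nat x f 1 = f 0"
  by (simp add: One_nat_def)

section \<open>Blocks of quantifiers\<close>

text \<open>Lists of values follow the convention of contexts, innermost variable first. A
  functional takes the outermost variable first, so its list of arguments appears as
  \<open>rev xs\<close>.\<close>

definition shift :: "'m list \<Rightarrow> (nat \<Rightarrow> 'm) \<Rightarrow> nat \<Rightarrow> 'm" where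
  "shift xs e = foldr case_nat xs e"

lemma shift_Nil [simp]: "shift [] e = e"
  and shift_Cons [simp]: "shift (x # xs) e = case_nat x (shift xs e)"
  by (simp_all add: shift_def)

lemma shift_append: "shift (xs @ ys) e = shift xs (shift ys e)"
  by (simp add: shift_def)

lemma shift_apply: "shift xs e i = (if i < length xs then xs ! i else e (i - length xs))"
  by (induction xs arbitrary: i) (auto simp: nth_Cons split: nat.split)

definition members :: "'m interp \<Rightarrow> ty list \<Rightarrow> 'm list \<Rightarrow> bool" where
  "members M \<Delta> xs \<longleftrightarrow> list_all2 (\<lambda>\<sigma> x. x \<in> dom M \<sigma>) \<Delta> xs"

lemma members_Nil [simp]: "members M [] xs \<longleftrightarrow> xs = []"
  and members_Cons: "members M (\<sigma> # \<Delta>) xs \<longleftrightarrow> (\<exists>y ys. xs = y # ys \<and> y \<in> dom M \<sigma> \<and> members M \<Delta> ys)"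
  by (auto simp: members_def list_all2_Cons1)

lemma members_Cons2 [simp]: "members M (\<sigma> # \<Delta>) (x # xs) \<longleftrightarrow> x \<in> dom M \<sigma> \<and> members M \<Delta> xs"
  by (simp add: members_def)

lemma members_length: "members M \<Delta> xs \<Longrightarrow> length xs = length \<Delta>"
  by (simp add: members_def list_all2_lengthD)

lemma all_members_Cons:
  "(\<forall>ys. members M (\<sigma> # \<Delta>) ys \<longrightarrow> P ys) \<longleftrightarrow> (\<forall>xs. members M \<Delta> xs \<longrightarrow> (\<forall>x\<in>dom M \<sigma>. P (x # xs)))"
  unfolding members_Cons by blast

lemma ex_members_Cons:
  "(\<exists>ys. members M (\<sigma> # \<Delta>) ys \<and> P ys) \<longleftrightarrow> (\<exists>xs. members M \<Delta> xs \<and> (\<exists>x\<in>dom M \<sigma>. P (x # xs)))"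
  unfolding members_Cons by blast

lemma sat_binds_All:
  "sat M e (binds All \<Delta> \<phi>) \<longleftrightarrow> (\<forall>xs. members M \<Delta> xs \<longrightarrow> sat M (shift xs e) \<phi>)"
  by (induction \<Delta> arbitrary: \<phi>) (auto simp: all_members_Cons)

lemma sat_binds_Ex:
  "sat M e (binds Ex \<Delta> \<phi>) \<longleftrightarrow> (\<exists>xs. members M \<Delta> xs \<and> sat M (shift xs e) \<phi>)"
  by (induction \<Delta> arbitrary: \<phi>) (simp_all add: ex_members_Cons)

lemma sat_binds_AllSt:
  "sat M e (binds AllSt \<Delta> \<phi>) \<longleftrightarrow>
    (\<forall>xs. members M \<Delta> xs \<longrightarrow> list_all2 (std M) \<Delta> xs \<longrightarrow> sat M (shift xs e) \<phi>)"
  by (induction \<Delta> arbitrary: \<phi>) (auto simp: all_members_Cons)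

lemma internal_binds: "internal (binds All \<Delta> \<phi>) \<longleftrightarrow> internal \<phi>"
  by (induction \<Delta> arbitrary: \<phi>) auto

lemma qf_internal: "qf \<phi> \<Longrightarrow> internal \<phi>"
  by (induction \<phi>) auto

lemma internal_subst: "internal (subst f \<phi>) \<longleftrightarrow> internal \<phi>"
  by (induction \<phi> arbitrary: f) auto

lemma qf_subst: "qf (subst f \<phi>) \<longleftrightarrow> qf \<phi>"
  by (induction \<phi> arbitrary: f) auto

lemma eval_foldl_App: "eval M e (foldl App t ts) = foldl (app M) (eval M e t) (map (eval M e) ts)"
  by (induction ts arbitrary: t) auto

lemma tyof_foldl_App:
  "E \<turnstile> t \<Colon> foldr Fun \<sigma>s \<tau> \<Longrightarrow> list_all2 (\<lambda>u \<sigma>. E \<turnstile> u \<Colon> \<sigma>) us \<sigma>s \<Longrightarrow> E \<turnstile> foldl App t us \<Colon> \<tau>"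
  by (induction us arbitrary: t \<sigma>s) (auto simp: list_all2_Cons1)

lemma eval_app_vars:
  "eval M (shift xs e) (app_vars t (length xs)) = foldl (app M) (eval M (shift xs e) t) (rev xs)"
proof -
  have "map (\<lambda>i. shift xs e i) [0..<length xs] = xs"
    by (rule nth_equalityI) (auto simp: shift_apply)
  then show ?thesis
    by (simp add: app_vars_def eval_foldl_App comp_def flip: rev_map)
qed

lemma tyof_app_vars:
  assumes "\<Delta> @ E \<turnstile> t \<Colon> foldr Fun (rev \<Delta>) \<tau>"
  shows "\<Delta> @ E \<turnstile> app_vars t (length \<Delta>) \<Colon> \<tau>"
  unfolding app_vars_def
  by (rule tyof_foldl_App[OF assms]) (auto simp: list_all2_conv_all_nth rev_nth nth_append)

text \<open>The substitution by which \<open>qf_ac\<close> replaces the existential variables by the functionals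
  \<open>Y\<close>, applied to the universal variables.\<close>

definition skolem_sub :: "ty list \<Rightarrow> ty list \<Rightarrow> nat \<Rightarrow> trm" where
  "skolem_sub \<Delta> \<Theta> =
    (\<lambda>i. if i < length \<Theta> then app_vars (Var (length \<Delta> + i)) (length \<Delta>)
         else if i < length \<Theta> + length \<Delta> then Var (i - length \<Theta>)
         else Var i)"

lemma sat_skolem_sub:
  assumes "length xs = length \<Delta>" "length Ys = length \<Theta>"
  shows "sat M (shift xs (shift Ys e)) (subst (skolem_sub \<Delta> \<Theta>) A)
    \<longleftrightarrow> sat M (shift (map (\<lambda>Y. foldl (app M) Y (rev xs)) Ys @ xs) e) A"
proof -
  have "eval M (shift xs (shift Ys e)) (skolem_sub \<Delta> \<Theta> i) =
      shift (map (\<lambda>Y. foldl (app M) Y (rev xs)) Ys @ xs) e i" for i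
    using assms eval_app_vars[of M xs "shift Ys e"]
    by (auto simp: skolem_sub_def shift_apply nth_append add.commute)
  then show ?thesis by (simp add: sat_subst)
qed

lemma typed_skolem_sub:
  "typed_sub (\<Theta> @ \<Delta> @ E) (\<Delta> @ map (\<lambda>\<tau>. foldr Fun (rev \<Delta>) \<tau>) \<Theta> @ E) (skolem_sub \<Delta> \<Theta>)"
  unfolding typed_sub_def
proof (intro allI impI)
  fix i assume i: "i < length (\<Theta> @ \<Delta> @ E)"
  let ?E = "map (\<lambda>\<tau>. foldr Fun (rev \<Delta>) \<tau>) \<Theta> @ E"
  show "\<Delta> @ ?E \<turnstile> skolem_sub \<Delta> \<Theta> i \<Colon> (\<Theta> @ \<Delta> @ E) ! i"
  proof (cases "i < length \<Theta>")
    case True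
    then have "\<Delta> @ ?E \<turnstile> Var (length \<Delta> + i) \<Colon> foldr Fun (rev \<Delta>) (\<Theta> ! i)"
      by (simp add: nth_append)
    from tyof_app_vars[OF this] show ?thesis using True by (simp add: skolem_sub_def nth_append)
  next
    case False
    then show ?thesis using i by (auto simp: skolem_sub_def nth_append add.commute)
  qed
qed

section \<open>Choice in models of the theory\<close>

locale b0_model = model "B0 \<union> qf_ac 2 1" M for M :: "'m interp"

sublocale b0_model \<subseteq> nonstandard_model "B0 \<union> qf_ac 2 1" M
  by unfold_locales (auto simp: B0_def)

context b0_model
begin

lemma qf_choice:
  assumes mn: "(m, n) \<in> {(1, 0), (2, 1)}"
    and A: "wff (\<Theta> @ \<Delta> @ E) A" "qf A"
    and levels: "\<forall>\<sigma>\<in>set \<Delta>. level \<sigma> = m" "\<forall>\<tau>\<in>set \<Theta>. level \<tau> = n"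
    and e: "wfenv M E e"
    and ex: "\<And>xs. members M \<Delta> xs \<Longrightarrow> \<exists>ys. members M \<Theta> ys \<and> sat M (shift (ys @ xs) e) A"
  shows "\<exists>Ys. members M (map (\<lambda>\<tau>. foldr Fun (rev \<Delta>) \<tau>) \<Theta>) Ys \<and>
    sat M (shift Ys e) (binds All \<Delta> (subst (skolem_sub \<Delta> \<Theta>) A))"
proof -
  let ?\<phi> = "binds All \<Delta> (binds Ex \<Theta> A) \<^bold>\<longrightarrow>
    binds Ex (map (\<lambda>\<tau>. foldr Fun (rev \<Delta>) \<tau>) \<Theta>) (binds All \<Delta> (subst (skolem_sub \<Delta> \<Theta>) A))"
  have "(E, ?\<phi>) \<in> qf_ac m n"
    unfolding qf_ac_def skolem_sub_def using A levels by blast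
  then have "(E, ?\<phi>) \<in> B0 \<union> qf_ac 2 1"
    using mn by (auto simp: B0_def)
  moreover have "wff E ?\<phi>"
    using A wff_subst[OF A(1) typed_skolem_sub] by (simp add: wff_binds)
  ultimately have "sat M e ?\<phi>" using e by (rule axiom)
  moreover have "sat M e (binds All \<Delta> (binds Ex \<Theta> A))"
    using ex by (simp add: sat_binds_All sat_binds_Ex shift_append)
  ultimately show ?thesis by (simp add: sat_binds_Ex)
qed

text \<open>Transfer for the negated formula, read contrapositively. That \<open>\<phi>\<close> is
  well-formed in \<open>\<Delta>\<close> alone expresses the absence of parameters.\<close>

lemma transfer_ex:
  assumes "internal \<phi>" "wff \<Delta> \<phi>" "members M \<Delta> xs" "sat M (shift xs e) \<phi>"
  shows "\<exists>xs. members M \<Delta> xs \<and> list_all2 (std M) \<Delta> xs \<and> sat M (shift xs e) \<phi>"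
proof (rule ccontr)
  assume no: "\<not> ?thesis"
  let ?\<phi> = "binds AllSt \<Delta> (\<^bold>\<not> \<phi>) \<^bold>\<longrightarrow> binds All \<Delta> (\<^bold>\<not> \<phi>)"
  have "([], ?\<phi>) \<in> B0 \<union> qf_ac 2 1"
  proof -
    have "([], ?\<phi>) \<in> pf_tp"
      unfolding pf_tp_def using assms(1,2) by (intro CollectI exI[of _ "[]"] exI[of _ \<Delta>] exI[of _ "\<^bold>\<not> \<phi>"]) simp
    then show ?thesis by (simp add: B0_def)
  qed
  moreover have "wff [] ?\<phi>" using assms(2) by (simp add: wff_binds)
  ultimately have "sat M e ?\<phi>" by (rule axiom) simp
  moreover have "sat M e (binds AllSt \<Delta> (\<^bold>\<not> \<phi>))" using no by (auto simp: sat_binds_AllSt)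
  ultimately have "sat M e (binds All \<Delta> (\<^bold>\<not> \<phi>))" by simp
  then show False using assms(3,4) by (auto simp: sat_binds_All)
qed

text \<open>That given functionals solve the problem for all arguments is an internal statement
  about them without parameters. Transfer therefore makes them standard, and the result still covers
  nonstandard arguments.\<close>

lemma standard_choice:
  assumes mn: "(m, n) \<in> {(1, 0), (2, 1)}"
    and A: "wff (\<Theta> @ \<Delta>) A" "qf A"
    and levels: "\<forall>\<sigma>\<in>set \<Delta>. level \<sigma> = m" "\<forall>\<tau>\<in>set \<Theta>. level \<tau> = n"
    and ex: "\<And>xs. members M \<Delta> xs \<Longrightarrow> \<exists>ys. members M \<Theta> ys \<and> sat M (shift (ys @ xs) e) A"
  shows "\<exists>Ys. members M (map (\<lambda>\<tau>. foldr Fun (rev \<Delta>) \<tau>) \<Theta>) Ys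
    \<and> list_all2 (std M) (map (\<lambda>\<tau>. foldr Fun (rev \<Delta>) \<tau>) \<Theta>) Ys
    \<and> (\<forall>xs. members M \<Delta> xs \<longrightarrow> sat M (shift (map (\<lambda>Y. foldl (app M) Y (rev xs)) Ys @ xs) e) A)"
proof -
  let ?\<phi> = "binds All \<Delta> (subst (skolem_sub \<Delta> \<Theta>) A)" and ?\<Theta> = "map (\<lambda>\<tau>. foldr Fun (rev \<Delta>) \<tau>) \<Theta>"
  obtain Ys where "members M ?\<Theta> Ys" "sat M (shift Ys e) ?\<phi>"
    using qf_choice[OF mn, of \<Theta> \<Delta> "[]" A e] A levels ex by auto
  moreover have "internal ?\<phi>" using A(2) by (simp add: internal_binds internal_subst qf_internal)
  moreover have "wff ?\<Theta> ?\<phi>"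
    using wff_subst[OF _ typed_skolem_sub, of \<Theta> \<Delta> "[]" A] A(1) by (simp add: wff_binds)
  ultimately obtain Ys where Ys: "members M ?\<Theta> Ys" "list_all2 (std M) ?\<Theta> Ys" "sat M (shift Ys e) ?\<phi>"
    using transfer_ex by blast
  moreover have "sat M (shift (map (\<lambda>Y. foldl (app M) Y (rev xs)) Ys @ xs) e) A"
    if "members M \<Delta> xs" for xs
    using Ys(3) that sat_skolem_sub[of xs \<Delta> Ys \<Theta> M e A] members_length[OF that] members_length[OF Ys(1)]
    by (simp add: sat_binds_All)
  ultimately show ?thesis by blast
qed

section \<open>Decision functionals and bounded search\<close>

abbreviation zero :: 'm where "zero \<equiv> const M Zero"
abbreviation succ :: "'m \<Rightarrow> 'm" where "succ \<equiv> app M (const M Succ)"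

lemma zero_dom: "zero \<in> dom M \<zero>"
  using const_dom[of Zero] by simp

lemma zero_std: "std M \<zero> zero"
  using std_const[of Zero] by simp

lemma succ_dom: "x \<in> dom M \<zero> \<Longrightarrow> succ x \<in> dom M \<zero>"
  using const_dom[of Succ] app_dom by simp

lemma succ_not_zero: "x \<in> dom M \<zero> \<Longrightarrow> succ x \<noteq> zero"
proof -
  assume x: "x \<in> dom M \<zero>"
  have "([\<zero>], \<^bold>\<not> (suc (Var 0) \<^bold>= zer)) \<in> efa" by (rule efa.suc_not_zero) simp
  then have "sat M (case_nat x (\<lambda>_. x)) (\<^bold>\<not> (suc (Var 0) \<^bold>= zer))"
    by (rule axiom_efa) (simp_all add: x)
  then show ?thesis by simp
qed

text \<open>Membership in a sequence gives an index strictly below the length, while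
  \<open>Mub\<close> expects a root up to and including its bound.\<close>

lemma leq_if_succ_leq:
  assumes "x \<in> dom M \<zero>" "y \<in> dom M \<zero>" "leq M (succ x) y"
  shows "leq M x y"
proof -
  let ?E = "[\<zero>, \<zero>]" and ?e = "case_nat x (case_nat y (\<lambda>_. x))"
  have "sat M ?e (Var 0 \<^bold>\<le> Var 0)"
    by (rule axiom_efa[of ?E]) (simp_all add: assms efa.le_refl)
  moreover have "sat M ?e (Var 0 \<^bold>\<le> suc (Var 0) \<^bold>\<longleftrightarrow> (Var 0 \<^bold>\<le> Var 0 \<^bold>\<or> Var 0 \<^bold>= suc (Var 0)))"
    by (rule axiom_efa[of ?E]) (auto simp: assms intro: efa.le_suc)
  moreover have "sat M ?e (Var 0 \<^bold>\<le> suc (Var 0) \<^bold>\<longrightarrow> suc (Var 0) \<^bold>\<le> Var 1 \<^bold>\<longrightarrow> Var 0 \<^bold>\<le> Var 1)"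
    by (rule axiom_efa[of ?E]) (auto simp: assms intro: efa.le_trans)
  ultimately show ?thesis using assms by (simp add: One_nat_def)
qed

lemma mub_root:
  assumes "f \<in> dom M (\<zero> \<rightarrow> \<zero> \<rightarrow> \<zero>)" "s \<in> dom M \<zero>" "t \<in> dom M \<zero>"
    and "leq M t s" "app M (app M f s) t = zero"
  shows "app M (app M f s) (app M (app M (const M Mub) f) s) = zero"
proof -
  let ?E = "[\<zero> \<rightarrow> \<zero> \<rightarrow> \<zero>, \<zero>, \<zero>]" and ?e = "case_nat f (case_nat s (case_nat t (\<lambda>_. f)))"
  let ?\<phi> = "Var 2 \<^bold>\<le> Var 1 \<^bold>\<and> Var 0 \<cdot> Var 1 \<cdot> Var 2 \<^bold>= zer \<^bold>\<longrightarrow> Var 0 \<cdot> Var 1 \<cdot> (Cst Mub \<cdot> Var 0 \<cdot> Var 1) \<^bold>= zer"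
  have "(?E, ?\<phi>) \<in> efa" by (rule efa.mub_root) simp_all
  then have "sat M ?e ?\<phi>" by (rule axiom_efa) (simp_all add: assms)
  then show ?thesis using assms by (simp add: One_nat_def)
qed

text \<open>By excluded middle one of the values 0 and 1 is correct for each tuple, so choice and
  transfer apply. The arguments have level 1 as demanded by the choice axiom for number values;
  numbers enter as constant functions.\<close>

lemma standard_characteristic:
  assumes "wff \<Delta> A" "qf A" "\<forall>\<sigma>\<in>set \<Delta>. level \<sigma> = 1"
  shows "\<exists>c\<in>dom M (foldr Fun (rev \<Delta>) \<zero>). std M (foldr Fun (rev \<Delta>) \<zero>) c \<and>
    (\<forall>xs. members M \<Delta> xs \<longrightarrow> (foldl (app M) c (rev xs) = zero \<longleftrightarrow> sat M (shift xs e) A))"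
proof -
  let ?A = "Var 0 \<^bold>= zer \<^bold>\<longleftrightarrow> liftf A"
  have sat: "sat M (case_nat y e) (liftf A) \<longleftrightarrow> sat M e A" for y e
    by (simp add: sat_subst)
  have "wff ([\<zero>] @ \<Delta>) ?A" "qf ?A"
    using assms wff_subst[OF assms(1) typed_sub_tail] by (simp_all add: qf_subst)
  moreover have "\<exists>ys. members M [\<zero>] ys \<and> sat M (shift (ys @ xs) e) ?A" if "members M \<Delta> xs" for xs
  proof (cases "sat M (shift xs e) A")
    case True
    then show ?thesis by (intro exI[of _ "[zero]"]) (simp add: zero_dom sat)
  next
    case False
    then show ?thesis
      by (intro exI[of _ "[succ zero]"]) (simp add: zero_dom succ_dom succ_not_zero sat)
  qed
  ultimately obtain Ys where Ys: "members M [foldr Fun (rev \<Delta>) \<zero>] Ys" "list_all2 (std M) [foldr Fun (rev \<Delta>) \<zero>] Ys"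
    "\<forall>xs. members M \<Delta> xs \<longrightarrow> sat M (shift (map (\<lambda>Y. foldl (app M) Y (rev xs)) Ys @ xs) e) ?A"
    using standard_choice[of 1 0 "[\<zero>]" \<Delta> ?A e] assms(3) by auto
  then obtain c where "Ys = [c]" by (auto simp: members_Cons)
  then show ?thesis using Ys by (intro bexI[of _ c]) (auto simp: sat)
qed

text \<open>The finite sequence given by \<open>hac_int\<close> can be searched because the matrix is decided by a
  standard functional.\<close>

lemma standard_selection:
  assumes c: "c \<in> dom M (\<sigma> \<rightarrow> \<zero> \<rightarrow> \<zero>)" "std M (\<sigma> \<rightarrow> \<zero> \<rightarrow> \<zero>) c"
    and ex: "\<And>x. x \<in> dom M \<sigma> \<Longrightarrow> std M \<sigma> x \<Longrightarrow> \<exists>y\<in>dom M \<zero>. std M \<zero> y \<and> app M (app M c x) y = zero"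
  shows "\<exists>f\<in>dom M (\<sigma> \<rightarrow> \<zero>). std M (\<sigma> \<rightarrow> \<zero>) f \<and>
    (\<forall>x\<in>dom M \<sigma>. std M \<sigma> x \<longrightarrow> app M (app M c x) (app M f x) = zero)"
proof -
  let ?C = "\<sigma> \<rightarrow> \<zero> \<rightarrow> \<zero>"
  let ?e = "case_nat c (\<lambda>_. c)"
  let ?\<phi> = "Var 2 \<cdot> Var 1 \<cdot> Var 0 \<^bold>= zer"
  let ?\<psi> = "AllSt \<sigma> (ExSt \<zero> ?\<phi>)
         \<^bold>\<longrightarrow> ExSt (\<sigma> \<rightarrow> \<zero>) (AllSt \<sigma> (Ex \<zero> (elem \<zero> (Var 0) (collect \<sigma> \<zero> \<cdot> Var 2 \<cdot> Var 1)
            \<^bold>\<and> rename (\<lambda>n. if n < 2 then n else Suc n) ?\<phi>)))"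
  let ?collect = "\<lambda>Y x. app M (app M (denot (collect \<sigma> \<zero>)) Y) x"
  let ?len = "app M (denot len0)" and ?cmp = "\<lambda>s i. app M (app M (denot cmp0) s) i"
  have closed: "eval M e (collect \<sigma> \<zero>) = denot (collect \<sigma> \<zero>)" "eval M e len0 = denot len0"
    "eval M e cmp0 = denot cmp0" for e
    by (rule eval_closed, simp)+
  have dom: "denot (collect \<sigma> \<zero>) \<in> dom M ((\<sigma> \<rightarrow> \<zero>) \<rightarrow> \<sigma> \<rightarrow> \<zero>)" "denot len0 \<in> dom M (\<zero> \<rightarrow> \<zero>)"
    "denot cmp0 \<in> dom M (\<zero> \<rightarrow> \<zero> \<rightarrow> \<zero>)"
    by (rule denot_dom, simp)+
  have "([?C], ?\<psi>) \<in> B0 \<union> qf_ac 2 1"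
    by (auto simp: B0_def hac_int_def)
  moreover have "wff [?C] ?\<psi>"
    by (simp add: elem_def)
  ultimately have "sat M ?e ?\<psi>" by (rule axiom) (simp add: c)
  moreover have "sat M ?e (AllSt \<sigma> (ExSt \<zero> ?\<phi>))" using ex by auto
  ultimately obtain Y where Y: "Y \<in> dom M (\<sigma> \<rightarrow> \<zero>)" "std M (\<sigma> \<rightarrow> \<zero>) Y" and
    Y_sat: "\<And>x. x \<in> dom M \<sigma> \<Longrightarrow> std M \<sigma> x \<Longrightarrow>
      \<exists>y\<in>dom M \<zero>. (\<exists>i\<in>dom M \<zero>. leq M (succ i) (?len (?collect Y x)) \<and> y = ?cmp (?collect Y x) i) \<and>
        app M (app M c x) y = zero"
    by (auto simp: elem_def closed)
  let ?s = "\<lambda>Y x. collect \<sigma> \<zero> \<cdot> Y \<cdot> x"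
  \<comment> \<open>\<open>Mub\<close> hands its bound to the function as a first argument, hence
    two abstractions. Inside them, the variables 0, 2, 3, 4 are the index, \<open>x\<close>,
    \<open>Y\<close> and \<open>c\<close>.\<close>
  define search where "search = lam [\<sigma>, \<sigma> \<rightarrow> \<zero>, ?C] \<zero> (lam [\<zero>, \<sigma>, \<sigma> \<rightarrow> \<zero>, ?C] \<zero>
    (Var 4 \<cdot> Var 2 \<cdot> (cmp0 \<cdot> ?s (Var 3) (Var 2) \<cdot> Var 0)))"
  \<comment> \<open>The component of \<open>Y[x]\<close> at the index found by the search. Its
    parameters \<open>Y\<close> and \<open>c\<close> are standard, and so is the functional it
    defines.\<close>
  define t where "t = cmp0 \<cdot> ?s (Var 1) (Var 0) \<cdot> (Cst Mub \<cdot> search \<cdot> (len0 \<cdot> ?s (Var 1) (Var 0)))"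
  have search: "[\<sigma>, \<sigma> \<rightarrow> \<zero>, ?C] \<turnstile> search \<Colon> \<zero> \<rightarrow> \<zero> \<rightarrow> \<zero>"
    unfolding search_def by (intro tyof_lam) simp
  then have "\<sigma> # [\<sigma> \<rightarrow> \<zero>, ?C] \<turnstile> t \<Colon> \<zero>" by (simp add: t_def)
  from comprehension[OF this, of "case_nat Y ?e"] obtain f where
    f: "f \<in> dom M (\<sigma> \<rightarrow> \<zero>)" "std M (\<sigma> \<rightarrow> \<zero>) f"
    "\<And>x. x \<in> dom M \<sigma> \<Longrightarrow> app M f x = eval M (case_nat x (case_nat Y ?e)) t"
    using Y c by auto
  have "app M (app M c x) (app M f x) = zero" if x: "x \<in> dom M \<sigma>" "std M \<sigma> x" for x
  proof -
    let ?e' = "case_nat x (case_nat Y ?e)"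
    have wf: "wfenv M [\<sigma>, \<sigma> \<rightarrow> \<zero>, ?C] ?e'" using x Y c by simp
    have s: "?collect Y x \<in> dom M \<zero>" "?len (?collect Y x) \<in> dom M \<zero>"
      using dom x Y by (auto intro!: app_dom)
    have g: "app M (app M (eval M ?e' search) k) i = app M (app M c x) (?cmp (?collect Y x) i)"
      if "k \<in> dom M \<zero>" "i \<in> dom M \<zero>" for k i
    proof -
      have 1: "\<zero> # [\<zero>, \<sigma>, \<sigma> \<rightarrow> \<zero>, ?C] \<turnstile> Var 4 \<cdot> Var 2 \<cdot> (cmp0 \<cdot> ?s (Var 3) (Var 2) \<cdot> Var 0) \<Colon> \<zero>" by simp
      have "app M (eval M ?e' search) k = eval M (case_nat k ?e') (lam [\<zero>, \<sigma>, \<sigma> \<rightarrow> \<zero>, ?C] \<zero>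
          (Var 4 \<cdot> Var 2 \<cdot> (cmp0 \<cdot> ?s (Var 3) (Var 2) \<cdot> Var 0)))"
        unfolding search_def by (rule eval_lam[OF tyof_lam[OF 1] wf that(1)])
      moreover have "app M \<dots> i = eval M (case_nat i (case_nat k ?e')) (Var 4 \<cdot> Var 2 \<cdot> (cmp0 \<cdot> ?s (Var 3) (Var 2) \<cdot> Var 0))"
        by (rule eval_lam[OF 1 _ that(2)]) (use wf that in simp)
      ultimately show ?thesis by (simp add: closed)
    qed
    obtain i where i: "i \<in> dom M \<zero>" "leq M (succ i) (?len (?collect Y x))"
      "app M (app M c x) (?cmp (?collect Y x) i) = zero"
      using Y_sat[OF x] by blast
    let ?m = "app M (app M (const M Mub) (eval M ?e' search)) (?len (?collect Y x))"
    have sd: "eval M ?e' search \<in> dom M (\<zero> \<rightarrow> \<zero> \<rightarrow> \<zero>)" by (rule eval_dom[OF search wf])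
    have "app M (app M (eval M ?e' search) (?len (?collect Y x))) ?m = zero"
      by (rule mub_root[OF sd s(2) i(1) leq_if_succ_leq[OF i(1) s(2) i(2)]]) (simp add: g i s)
    moreover have "?m \<in> dom M \<zero>"
      using app_dom[OF app_dom[OF _ sd] s(2)] const_dom[of Mub] by simp
    \<comment> \<open>The search guarantees that the component found passes the test
      \<open>c\<close>; this is all that is required of it.\<close>
    ultimately have "app M (app M c x) (?cmp (?collect Y x) ?m) = zero" using g s(2) by simp
    then show ?thesis using f(3)[OF x(1)] by (simp add: t_def closed)
  qed
  then show ?thesis using f by blast
qed

end

section \<open>Weak Koenig's lemma in models of the theory\<close>

lemma occurs0_closed: "[] \<turnstile> t \<Colon> \<sigma> \<Longrightarrow> \<not> occurs0 t"
  by (induction t arbitrary: \<sigma>) (auto split: option.splits ty.splits if_splits)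

lemma occurs0_len0 [simp]: "\<not> occurs0 len0"
  by (rule occurs0_closed) (rule tyof_len0)

lemma liftn_2_Var [simp]: "liftn 2 (Var n) = Var (n + 2)"
  by (simp add: liftn_def)

text \<open>Because \<open>rel_st\<close> inspects the syntactic shape of a quantified body, these
  facts let the simplifier compute \<open>rel_st WKL\<close>.\<close>

lemma bounded_all_simps [simp]:
  "\<not> bounded_all \<sigma> (s \<^bold>= t)" "\<not> bounded_all \<sigma> (s \<^bold>\<le> t)" "\<not> bounded_all \<sigma> (Ex \<rho> \<phi>)"
  "\<not> bounded_all \<sigma> (s \<^bold>= t \<^bold>\<longrightarrow> \<phi>)" "\<not> bounded_all (\<sigma> \<rightarrow> \<tau>) \<phi>"
  "\<not> occurs0 t \<Longrightarrow> bounded_all \<zero> (Var 0 \<^bold>\<le> t \<^bold>\<longrightarrow> \<phi>)"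
  "\<not> occurs0 t \<Longrightarrow> bounded_all \<zero> (Var 0 \<^bold>< t \<^bold>\<longrightarrow> \<phi>)"
  by (simp_all add: bounded_all_def)

lemma bounded_ex_simps [simp]:
  "\<not> bounded_ex \<sigma> (s \<^bold>= t \<^bold>\<and> \<phi>)" "\<not> bounded_ex (\<sigma> \<rightarrow> \<tau>) \<phi>"
  by (simp_all add: bounded_ex_def)

context b0_model
begin

abbreviation ap (infixl "\<bullet>" 90) where "ap \<equiv> app M"
abbreviation one :: 'm where "one \<equiv> succ zero"
abbreviation lh :: "'m \<Rightarrow> 'm" where "lh \<beta> \<equiv> denot len0 \<bullet> \<beta>"
abbreviation cp :: "'m \<Rightarrow> 'm \<Rightarrow> 'm" where "cp \<beta> k \<equiv> denot cmp0 \<bullet> \<beta> \<bullet> k"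
abbreviation sg :: "'m \<Rightarrow> 'm \<Rightarrow> 'm" where "sg \<alpha> n \<equiv> denot seg \<bullet> \<alpha> \<bullet> n"

abbreviation (input) "N \<equiv> dom M \<zero>"
abbreviation (input) "N1 \<equiv> dom M \<one>"

lemma eval_coding [simp]:
  "eval M e len0 = denot len0" "eval M e cmp0 = denot cmp0" "eval M e seg = denot seg"
  by (rule eval_closed, simp)+

text \<open>Needed to move the clause of \<open>node\<close> that does not mention \<open>n\<close>
  under the quantifier over \<open>n\<close>.\<close>

lemma N_nonempty [simp]: "\<exists>n. n \<in> N"
  using zero_dom by blast

text \<open>The tree axioms stripped of their quantifiers, so that a violation is a pair of numbers.
  A function argument instead of an element allows the tree and its copy of level 2 to be treated
  alike.\<close>

definition node :: "('m \<Rightarrow> 'm) \<Rightarrow> 'm \<Rightarrow> 'm \<Rightarrow> bool" where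
  "node T \<beta> n \<longleftrightarrow> leq M (T \<beta>) one
    \<and> (T \<beta> = one \<longrightarrow> leq M (succ n) (lh \<beta>) \<longrightarrow> leq M (cp \<beta> n) one)
    \<and> (T \<beta> = one \<longrightarrow> leq M n (lh \<beta>) \<longrightarrow> T (sg (denot cmp0 \<bullet> \<beta>) n) = one)"

text \<open>Both requirements on a path are tested at the same number, so a failure is witnessed by
  one number.\<close>

definition on_path :: "('m \<Rightarrow> 'm) \<Rightarrow> 'm \<Rightarrow> 'm \<Rightarrow> bool" where
  "on_path T \<alpha> n \<longleftrightarrow> leq M (\<alpha> \<bullet> n) one \<and> T (sg \<alpha> n) = one"

lemma sat_WKL:
  "sat M e WKL \<longleftrightarrow> (\<forall>T\<in>N1. (\<forall>\<beta>\<in>N. \<forall>n\<in>N. node (app M T) \<beta> n) \<longrightarrow>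
    (\<forall>n\<in>N. \<exists>\<beta>\<in>N. lh \<beta> = n \<and> T \<bullet> \<beta> = one) \<longrightarrow>
    (\<exists>\<alpha>\<in>N1. \<forall>n\<in>N. on_path (app M T) \<alpha> n))"
  by (simp add: imp_conjL imp_conjR WKL_def binary_tree_def binary_fun_def in_tree_def node_def on_path_def ball_conj_distrib)

text \<open>In \<open>node\<close> the number \<open>n\<close> comes from quantifiers bounded by the
  length of \<open>\<beta>\<close>, which stay unrelativized; hence it ranges over all of
  \<open>N\<close>.\<close>

lemma rel_st_WKL:
  "sat M e (rel_st WKL) \<longleftrightarrow> (\<forall>T\<in>N1. std M \<one> T \<longrightarrow>
    (\<forall>\<beta>\<in>N. std M \<zero> \<beta> \<longrightarrow> (\<forall>n\<in>N. node (app M T) \<beta> n)) \<longrightarrow>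
    (\<forall>n\<in>N. std M \<zero> n \<longrightarrow> (\<exists>\<beta>\<in>N. std M \<zero> \<beta> \<and> lh \<beta> = n \<and> T \<bullet> \<beta> = one)) \<longrightarrow>
    (\<exists>\<alpha>\<in>N1. std M \<one> \<alpha> \<and> (\<forall>n\<in>N. std M \<zero> n \<longrightarrow> on_path (app M T) \<alpha> n)))"
  by (simp add: imp_conjL imp_conjR WKL_def binary_tree_def binary_fun_def in_tree_def      node_def on_path_def ball_conj_distrib)

section \<open>Constant functions and changes of level\<close>

abbreviation two_ty :: ty where "two_ty \<equiv> \<one> \<rightarrow> \<zero>"
text \<open>The constant function with value \<open>x\<close>, which raises a number to level 1;
  application to \<open>zero\<close> recovers the number.\<close>

abbreviation K :: "'m \<Rightarrow> 'm" where "K x \<equiv> const M (Pi \<zero> \<zero>) \<bullet> x"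

lemma K_dom: "x \<in> N \<Longrightarrow> K x \<in> N1"
  using app_dom[of _ \<zero> \<one>] const_dom[of "Pi \<zero> \<zero>"] by simp

lemma K_std: "x \<in> N \<Longrightarrow> std M \<zero> x \<Longrightarrow> std M \<one> (K x)"
  using std_app[of _ \<zero> \<one>] const_dom[of "Pi \<zero> \<zero>"] std_const[of "Pi \<zero> \<zero>"] by simp

lemma K_apply: "x \<in> N \<Longrightarrow> y \<in> N \<Longrightarrow> K x \<bullet> y = x"
  by (rule app_Pi)

lemma comprehension2:
  assumes "\<tau> # \<sigma> # E \<turnstile> t \<Colon> \<rho>" "wfenv M E e"
  shows "\<exists>f\<in>dom M (\<sigma> \<rightarrow> \<tau> \<rightarrow> \<rho>).
    (\<forall>x\<in>dom M \<sigma>. \<forall>y\<in>dom M \<tau>. f \<bullet> x \<bullet> y = eval M (case_nat y (case_nat x e)) t)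
    \<and> (stdenv M E e \<longrightarrow> std M (\<sigma> \<rightarrow> \<tau> \<rightarrow> \<rho>) f)"
proof -
  obtain f where "f \<in> dom M (\<sigma> \<rightarrow> \<tau> \<rightarrow> \<rho>)" "stdenv M E e \<longrightarrow> std M (\<sigma> \<rightarrow> \<tau> \<rightarrow> \<rho>) f"
    "\<And>x. x \<in> dom M \<sigma> \<Longrightarrow> f \<bullet> x = eval M (case_nat x e) (lam (\<sigma> # E) \<tau> t)"
    using comprehension[OF tyof_lam[OF assms(1)] assms(2)] by blast
  moreover have "eval M (case_nat x e) (lam (\<sigma> # E) \<tau> t) \<bullet> y = eval M (case_nat y (case_nat x e)) t"
    if "x \<in> dom M \<sigma>" "y \<in> dom M \<tau>" for x y
    by (rule eval_lam[OF assms(1) _ that(2)]) (use assms(2) that in simp)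
  ultimately show ?thesis by (intro bexI[of _ f]) auto
qed

lemma sg_dom: "\<alpha> \<in> N1 \<Longrightarrow> n \<in> N \<Longrightarrow> sg \<alpha> n \<in> N"
  using app_dom[OF app_dom[OF denot_dom[OF tyof_seg]]] .

lemma cmp_dom: "\<beta> \<in> N \<Longrightarrow> denot cmp0 \<bullet> \<beta> \<in> N1"
  using app_dom[OF denot_dom[OF tyof_cmp0]] .

text \<open>Serves to exchange a tree of type 1 with a copy of level 2 that agrees with it through
  \<open>u \<mapsto> K u\<close>.\<close>

lemma node_cong:
  assumes "\<And>u. u \<in> N \<Longrightarrow> S u = T u" "\<beta> \<in> N" "n \<in> N"
  shows "node S \<beta> n \<longleftrightarrow> node T \<beta> n"
  using assms by (simp add: node_def sg_dom cmp_dom)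

lemma on_path_cong:
  assumes "\<And>u. u \<in> N \<Longrightarrow> S u = T u" "\<alpha> \<in> N1" "n \<in> N"
  shows "on_path S \<alpha> n \<longleftrightarrow> on_path T \<alpha> n"
  using assms by (simp add: on_path_def sg_dom)

text \<open>Skolemizing the counterexamples to the hypotheses (by \<open>q\<^sub>1, q\<^sub>2\<close>) and Herbrandizing the
  conclusion (by \<open>g\<close>) makes the lemma a quantifier-free statement about \<open>T\<close>, \<open>b\<close>, \<open>g\<close> and
  \<open>\<alpha>, q\<^sub>1, q\<^sub>2\<close>. Here \<open>T\<close> and \<open>b\<close> are raised to level \<open>2\<close>, the numbers \<open>q\<^sub>1, q\<^sub>2\<close> to level \<open>1\<close>.\<close>

lemma standard_WKL_functional:
  assumes WKL: "sat M e WKL"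
  shows "\<exists>F Q R. F \<in> dom M (two_ty \<rightarrow> two_ty \<rightarrow> two_ty \<rightarrow> \<one>) \<and> std M (two_ty \<rightarrow> two_ty \<rightarrow> two_ty \<rightarrow> \<one>) F
    \<and> Q \<in> dom M (two_ty \<rightarrow> two_ty \<rightarrow> two_ty \<rightarrow> \<one>) \<and> std M (two_ty \<rightarrow> two_ty \<rightarrow> two_ty \<rightarrow> \<one>) Q
    \<and> R \<in> dom M (two_ty \<rightarrow> two_ty \<rightarrow> two_ty \<rightarrow> \<one>) \<and> std M (two_ty \<rightarrow> two_ty \<rightarrow> two_ty \<rightarrow> \<one>) R
    \<and> (\<forall>T\<in>dom M two_ty. \<forall>b\<in>dom M two_ty. \<forall>g\<in>dom M two_ty.
        let T' = (\<lambda>u. T \<bullet> K u); \<alpha> = F \<bullet> g \<bullet> b \<bullet> T; \<beta> = Q \<bullet> g \<bullet> b \<bullet> T \<bullet> zero; n = R \<bullet> g \<bullet> b \<bullet> T \<bullet> zero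
        in node T' \<beta> n \<longrightarrow> lh (b \<bullet> K n) = n \<longrightarrow> T' (b \<bullet> K n) = one \<longrightarrow> on_path T' \<alpha> (g \<bullet> \<alpha>))"
proof -
  define k where "k u = Cst (Pi \<zero> \<zero>) \<cdot> u" for u
  \<comment> \<open>The variables 0 to 5 are \<open>\<alpha>\<close>, the two counterexamples,
    \<open>T\<close>, \<open>b\<close> and \<open>g\<close>. The counterexamples are functions read
    at zero.\<close>
  let ?T = "\<lambda>u. Var 3 \<cdot> k u" and ?b = "\<lambda>u. Var 4 \<cdot> k u" and ?\<beta> = "Var 1 \<cdot> zer" and ?n = "Var 2 \<cdot> zer"
  let ?m = "Var 5 \<cdot> Var 0"
  let ?A = "?T ?\<beta> \<^bold>\<le> num1
    \<^bold>\<and> (?T ?\<beta> \<^bold>= num1 \<^bold>\<longrightarrow> suc ?n \<^bold>\<le> len0 \<cdot> ?\<beta> \<^bold>\<longrightarrow> cmp0 \<cdot> ?\<beta> \<cdot> ?n \<^bold>\<le> num1)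
    \<^bold>\<and> (?T ?\<beta> \<^bold>= num1 \<^bold>\<longrightarrow> ?n \<^bold>\<le> len0 \<cdot> ?\<beta> \<^bold>\<longrightarrow> ?T (seg \<cdot> (cmp0 \<cdot> ?\<beta>) \<cdot> ?n) \<^bold>= num1)
    \<^bold>\<longrightarrow> len0 \<cdot> ?b ?n \<^bold>= ?n \<^bold>\<longrightarrow> ?T (?b ?n) \<^bold>= num1
    \<^bold>\<longrightarrow> Var 0 \<cdot> ?m \<^bold>\<le> num1 \<^bold>\<and> ?T (seg \<cdot> Var 0 \<cdot> ?m) \<^bold>= num1"
  let ?P = "\<lambda>T b g \<alpha> \<beta> n. node (\<lambda>u. T \<bullet> K u) \<beta> n \<longrightarrow> lh (b \<bullet> K n) = n \<longrightarrow> T \<bullet> K (b \<bullet> K n) = one \<longrightarrow>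
      on_path (\<lambda>u. T \<bullet> K u) \<alpha> (g \<bullet> \<alpha>)"
  let ?\<Delta> = "[two_ty, two_ty, two_ty]" and ?\<Theta> = "[\<one>, \<one>, \<one>]"
  have A: "sat M (shift ([\<alpha>, q, r] @ [T, b, g]) e) ?A \<longleftrightarrow> ?P T b g \<alpha> (q \<bullet> zero) (r \<bullet> zero)" for T b g \<alpha> q r
    by (simp add: node_def on_path_def k_def imp_conjL)
  have wff: "wff (?\<Theta> @ ?\<Delta>) ?A" and qf: "qf ?A"
    by (simp_all add: k_def)
  have ex: "\<exists>ys. members M ?\<Theta> ys \<and> sat M (shift (ys @ xs) e) ?A" if xs: "members M ?\<Delta> xs" for xs
  proof -
    obtain T b g where xs: "xs = [T, b, g]" and dom: "T \<in> dom M two_ty" "b \<in> dom M two_ty" "g \<in> dom M two_ty"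
      using xs by (auto simp: members_Cons)
    have "\<exists>\<alpha>\<in>N1. \<exists>\<beta>\<in>N. \<exists>n\<in>N. ?P T b g \<alpha> \<beta> n"
    \<comment> \<open>A violated hypothesis makes the implication vacuous, so any
      \<open>\<alpha>\<close> will do. Otherwise all hypotheses hold and WKL provides a path, which
      in particular works at \<open>g \<bullet> \<alpha>\<close>.\<close>
    proof (cases "\<exists>\<beta>\<in>N. \<exists>n\<in>N. \<not> (node (\<lambda>u. T \<bullet> K u) \<beta> n \<and> lh (b \<bullet> K n) = n \<and> T \<bullet> K (b \<bullet> K n) = one)")
      case True
      then show ?thesis using K_dom[OF zero_dom] by blast
    next
      case False
      \<comment> \<open>WKL concerns trees of type 1, so \<open>T\<close> is first brought down to
        the tree \<open>S\<close> on numbers.\<close>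
      have "[\<zero>, two_ty] \<turnstile> Var 1 \<cdot> k (Var 0) \<Colon> \<zero>" by (simp add: k_def)
      from comprehension[OF this, of "case_nat T e"] obtain S where
        S: "S \<in> N1" "\<And>u. u \<in> N \<Longrightarrow> S \<bullet> u = T \<bullet> K u"
        using dom by (auto simp: k_def)
      have "\<forall>\<beta>\<in>N. \<forall>n\<in>N. node (app M S) \<beta> n"
        using False S by (simp add: node_cong[of "app M S" "\<lambda>u. T \<bullet> K u"])
      moreover have "\<exists>\<beta>\<in>N. lh \<beta> = n \<and> S \<bullet> \<beta> = one" if "n \<in> N" for n
      proof (intro bexI conjI)
        show "b \<bullet> K n \<in> N" using app_dom[OF dom(2) K_dom[OF that]] .
        then show "S \<bullet> (b \<bullet> K n) = one" using False that S by auto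
      qed (use False that in blast)
      ultimately obtain \<alpha> where \<alpha>: "\<alpha> \<in> N1" "\<forall>n\<in>N. on_path (app M S) \<alpha> n"
        using WKL S(1) unfolding sat_WKL by blast
      then have "on_path (\<lambda>u. T \<bullet> K u) \<alpha> (g \<bullet> \<alpha>)"
        using on_path_cong[of "app M S" "\<lambda>u. T \<bullet> K u"] S(2) app_dom[OF dom(3)] by blast
      then show ?thesis using \<alpha>(1) zero_dom by blast
    qed
    then obtain \<alpha> \<beta> n where *: "\<alpha> \<in> N1" "\<beta> \<in> N" "n \<in> N" "?P T b g \<alpha> \<beta> n" by blast
    then have "sat M (shift ([\<alpha>, K \<beta>, K n] @ xs) e) ?A"
      unfolding xs A by (simp add: K_apply zero_dom)
    then show ?thesis using * K_dom by (intro exI[of _ "[\<alpha>, K \<beta>, K n]"]) simp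
  qed
  have "\<exists>Ys. members M (map (\<lambda>\<tau>. foldr Fun (rev ?\<Delta>) \<tau>) ?\<Theta>) Ys
    \<and> list_all2 (std M) (map (\<lambda>\<tau>. foldr Fun (rev ?\<Delta>) \<tau>) ?\<Theta>) Ys
    \<and> (\<forall>xs. members M ?\<Delta> xs \<longrightarrow> sat M (shift (map (\<lambda>Y. foldl (app M) Y (rev xs)) Ys @ xs) e) ?A)"
    by (rule standard_choice[of 2 1]) (use wff qf ex in auto)
  then obtain F Q R where *: "members M (map (\<lambda>\<tau>. foldr Fun (rev ?\<Delta>) \<tau>) ?\<Theta>) [F, Q, R]"
    "list_all2 (std M) (map (\<lambda>\<tau>. foldr Fun (rev ?\<Delta>) \<tau>) ?\<Theta>) [F, Q, R]"
    and sat: "\<And>xs. members M ?\<Delta> xs \<Longrightarrow> sat M (shift (map (\<lambda>Y. foldl (app M) Y (rev xs)) [F, Q, R] @ xs) e) ?A"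
    by (force simp: members_Cons)
  \<comment> \<open>The tuple lists \<open>T\<close> first as the innermost variable, so the
    functionals receive \<open>g\<close>, \<open>b\<close>, \<open>T\<close> in this order.\<close>
  have "?P T b g (F \<bullet> g \<bullet> b \<bullet> T) (Q \<bullet> g \<bullet> b \<bullet> T \<bullet> zero) (R \<bullet> g \<bullet> b \<bullet> T \<bullet> zero)"
    if "T \<in> dom M two_ty" "b \<in> dom M two_ty" "g \<in> dom M two_ty" for T b g
    using sat[of "[T, b, g]"] that A[of "F \<bullet> g \<bullet> b \<bullet> T" "Q \<bullet> g \<bullet> b \<bullet> T" "R \<bullet> g \<bullet> b \<bullet> T" T b g] by simp
  then show ?thesis using * unfolding Let_def by (intro exI[of _ F] exI[of _ Q] exI[of _ R]) auto
qed

text \<open>The hypotheses on \<open>T\<close> hold at standard arguments only. They suffice because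
  the functionals are applied to standard data and so ask for these hypotheses at standard
  places.\<close>

lemma WKL_imp_WKL_st:
  assumes WKL: "sat M e WKL"
  shows "sat M e (rel_st WKL)"
  unfolding rel_st_WKL
proof (intro ballI impI)
  fix T assume T: "T \<in> N1" "std M \<one> T"
    and nodes: "\<forall>\<beta>\<in>N. std M \<zero> \<beta> \<longrightarrow> (\<forall>n\<in>N. node (app M T) \<beta> n)"
    and infinite: "\<forall>n\<in>N. std M \<zero> n \<longrightarrow> (\<exists>\<beta>\<in>N. std M \<zero> \<beta> \<and> lh \<beta> = n \<and> T \<bullet> \<beta> = one)"
  let ?\<Delta> = "[\<one>, \<one>, \<one>]" and ?\<chi> = "\<one> \<rightarrow> \<one> \<rightarrow> \<one> \<rightarrow> \<zero>"
  show "\<exists>\<alpha>\<in>N1. std M \<one> \<alpha> \<and> (\<forall>n\<in>N. std M \<zero> n \<longrightarrow> on_path (app M T) \<alpha> n)"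
  proof (rule ccontr)
    assume no_path: "\<not> ?thesis"
    obtain b where b: "b \<in> N1" "std M \<one> b"
      "\<And>n. n \<in> N \<Longrightarrow> std M \<zero> n \<Longrightarrow> lh (b \<bullet> n) = n \<and> T \<bullet> (b \<bullet> n) = one"
    proof -
      \<comment> \<open>Here \<open>T\<close> is a variable, since parameters are forbidden, and
        both numbers are given as level 1 objects read at zero.\<close>
      let ?A = "len0 \<cdot> (Var 0 \<cdot> zer) \<^bold>= Var 1 \<cdot> zer \<^bold>\<and> Var 2 \<cdot> (Var 0 \<cdot> zer) \<^bold>= num1"
      obtain c where c: "c \<in> dom M ?\<chi>" "std M ?\<chi> c"
        "\<And>xs. members M ?\<Delta> xs \<Longrightarrow> foldl (app M) c (rev xs) = zero \<longleftrightarrow> sat M (shift xs e) ?A"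
        using standard_characteristic[of ?\<Delta> ?A e] by auto
      \<comment> \<open>Only now is \<open>T\<close> inserted. The result \<open>d\<close> is
        standard because \<open>c\<close> and \<open>T\<close> are.\<close>
      have "[\<zero>, \<zero>, ?\<chi>, \<one>] \<turnstile> Var 2 \<cdot> Var 3 \<cdot> (Cst (Pi \<zero> \<zero>) \<cdot> Var 1) \<cdot> (Cst (Pi \<zero> \<zero>) \<cdot> Var 0) \<Colon> \<zero>" by simp
      from comprehension2[OF this, of "case_nat c (case_nat T e)"] obtain d where
        d: "d \<in> dom M (\<zero> \<rightarrow> \<zero> \<rightarrow> \<zero>)" "std M (\<zero> \<rightarrow> \<zero> \<rightarrow> \<zero>) d"
        "\<And>n \<beta>. n \<in> N \<Longrightarrow> \<beta> \<in> N \<Longrightarrow> d \<bullet> n \<bullet> \<beta> = c \<bullet> T \<bullet> K n \<bullet> K \<beta>"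
        using c T by auto
      have char: "d \<bullet> n \<bullet> \<beta> = zero \<longleftrightarrow> lh \<beta> = n \<and> T \<bullet> \<beta> = one" if "n \<in> N" "\<beta> \<in> N" for n \<beta>
        using that T c(3)[of "[K \<beta>, K n, T]"] by (simp add: d K_dom K_apply zero_dom)
      obtain f where "f \<in> N1" "std M \<one> f" "\<And>n. n \<in> N \<Longrightarrow> std M \<zero> n \<Longrightarrow> d \<bullet> n \<bullet> (f \<bullet> n) = zero"
        using standard_selection[OF d(1,2)] infinite char by (metis (no_types, lifting))
      then show ?thesis using that char app_dom by metis
    qed
    obtain g where g: "g \<in> dom M two_ty" "std M two_ty g"
      "\<And>\<alpha>. \<alpha> \<in> N1 \<Longrightarrow> std M \<one> \<alpha> \<Longrightarrow> \<not> on_path (app M T) \<alpha> (g \<bullet> \<alpha>)"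
    proof -
      \<comment> \<open>Here \<open>\<alpha>\<close> already has level 1 and only the number is
        coded. Selection then turns the absence of a standard path into a functional
        \<open>g\<close> locating the failure of each standard \<open>\<alpha>\<close>.\<close>
      let ?A = "\<^bold>\<not> (Var 1 \<cdot> (Var 0 \<cdot> zer) \<^bold>\<le> num1 \<^bold>\<and> Var 2 \<cdot> (seg \<cdot> Var 1 \<cdot> (Var 0 \<cdot> zer)) \<^bold>= num1)"
      obtain c where c: "c \<in> dom M ?\<chi>" "std M ?\<chi> c"
        "\<And>xs. members M ?\<Delta> xs \<Longrightarrow> foldl (app M) c (rev xs) = zero \<longleftrightarrow> sat M (shift xs e) ?A"
        using standard_characteristic[of ?\<Delta> ?A e] by auto
      have "[\<zero>, \<one>, ?\<chi>, \<one>] \<turnstile> Var 2 \<cdot> Var 3 \<cdot> Var 1 \<cdot> (Cst (Pi \<zero> \<zero>) \<cdot> Var 0) \<Colon> \<zero>" by simp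
      from comprehension2[OF this, of "case_nat c (case_nat T e)"] obtain d where
        d: "d \<in> dom M (\<one> \<rightarrow> \<zero> \<rightarrow> \<zero>)" "std M (\<one> \<rightarrow> \<zero> \<rightarrow> \<zero>) d"
        "\<And>\<alpha> n. \<alpha> \<in> N1 \<Longrightarrow> n \<in> N \<Longrightarrow> d \<bullet> \<alpha> \<bullet> n = c \<bullet> T \<bullet> \<alpha> \<bullet> K n"
        using c T by auto
      have char: "d \<bullet> \<alpha> \<bullet> n = zero \<longleftrightarrow> \<not> on_path (app M T) \<alpha> n" if "\<alpha> \<in> N1" "n \<in> N" for \<alpha> n
        using that T c(3)[of "[K n, \<alpha>, T]"] by (simp add: d K_dom K_apply zero_dom on_path_def)
      obtain f where "f \<in> dom M two_ty" "std M two_ty f"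
        "\<And>\<alpha>. \<alpha> \<in> N1 \<Longrightarrow> std M \<one> \<alpha> \<Longrightarrow> d \<bullet> \<alpha> \<bullet> (f \<bullet> \<alpha>) = zero"
        using standard_selection[OF d(1,2)] no_path char by (metis (no_types, lifting))
      then show ?thesis using that char app_dom by metis
    qed
    obtain F Q R where dom: "F \<in> dom M (two_ty \<rightarrow> two_ty \<rightarrow> two_ty \<rightarrow> \<one>)" "Q \<in> dom M (two_ty \<rightarrow> two_ty \<rightarrow> two_ty \<rightarrow> \<one>)" "R \<in> dom M (two_ty \<rightarrow> two_ty \<rightarrow> two_ty \<rightarrow> \<one>)"
      and std: "std M (two_ty \<rightarrow> two_ty \<rightarrow> two_ty \<rightarrow> \<one>) F" "std M (two_ty \<rightarrow> two_ty \<rightarrow> two_ty \<rightarrow> \<one>) Q" "std M (two_ty \<rightarrow> two_ty \<rightarrow> two_ty \<rightarrow> \<one>) R"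
      and FQR: "\<And>T b g T' \<alpha> \<beta> n. T \<in> dom M two_ty \<Longrightarrow> b \<in> dom M two_ty \<Longrightarrow> g \<in> dom M two_ty \<Longrightarrow>
        T' = (\<lambda>u. T \<bullet> K u) \<Longrightarrow> \<alpha> = F \<bullet> g \<bullet> b \<bullet> T \<Longrightarrow> \<beta> = Q \<bullet> g \<bullet> b \<bullet> T \<bullet> zero \<Longrightarrow> n = R \<bullet> g \<bullet> b \<bullet> T \<bullet> zero \<Longrightarrow>
        node T' \<beta> n \<Longrightarrow> lh (b \<bullet> K n) = n \<Longrightarrow> T' (b \<bullet> K n) = one \<Longrightarrow> on_path T' \<alpha> (g \<bullet> \<alpha>)"
      using standard_WKL_functional[OF WKL] unfolding Let_def by blast
    \<comment> \<open>The copy \<open>x \<mapsto> f (x 0)\<close> has level 2, as the functionals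
      demand, and returns the values of \<open>f\<close> at constant functions.\<close>
    have raise: "\<exists>f2\<in>dom M two_ty. std M two_ty f2 \<and> (\<forall>u\<in>N. f2 \<bullet> K u = f \<bullet> u)"
      if "f \<in> N1" "std M \<one> f" for f
    proof -
      have "[\<one>, \<one>] \<turnstile> Var 1 \<cdot> (Var 0 \<cdot> zer) \<Colon> \<zero>" by simp
      from comprehension[OF this, of "case_nat f e"] show ?thesis
        using that by (auto simp: K_dom K_apply zero_dom)
    qed
    obtain T2 where T2: "T2 \<in> dom M two_ty" "std M two_ty T2" "\<And>u. u \<in> N \<Longrightarrow> T2 \<bullet> K u = T \<bullet> u"
      using raise[OF T] by blast
    obtain b2 where b2: "b2 \<in> dom M two_ty" "std M two_ty b2" "\<And>u. u \<in> N \<Longrightarrow> b2 \<bullet> K u = b \<bullet> u"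
      using raise[OF b(1,2)] by blast
    have app: "Y \<bullet> g \<bullet> b2 \<bullet> T2 \<in> N1 \<and> std M \<one> (Y \<bullet> g \<bullet> b2 \<bullet> T2)"
      if "Y \<in> dom M (two_ty \<rightarrow> two_ty \<rightarrow> two_ty \<rightarrow> \<one>)" "std M (two_ty \<rightarrow> two_ty \<rightarrow> two_ty \<rightarrow> \<one>) Y" for Y
    proof -
      have "[two_ty \<rightarrow> two_ty \<rightarrow> two_ty \<rightarrow> \<one>, two_ty, two_ty, two_ty] \<turnstile> Var 0 \<cdot> Var 1 \<cdot> Var 2 \<cdot> Var 3 \<Colon> \<one>" by simp
      from eval_dom[OF this, of "shift [Y, g, b2, T2] e"] std_eval[OF this, of "shift [Y, g, b2, T2] e"]
      show ?thesis using that g b2 T2 by simp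
    qed
    define \<alpha> where "\<alpha> = F \<bullet> g \<bullet> b2 \<bullet> T2"
    define \<beta> where "\<beta> = Q \<bullet> g \<bullet> b2 \<bullet> T2 \<bullet> zero"
    define n where "n = R \<bullet> g \<bullet> b2 \<bullet> T2 \<bullet> zero"
    have \<alpha>: "\<alpha> \<in> N1" "std M \<one> \<alpha>" using app dom std by (auto simp: \<alpha>_def)
    have \<beta>: "\<beta> \<in> N" "std M \<zero> \<beta>"
      using app[OF dom(2) std(2)] app_dom std_app zero_dom zero_std unfolding \<beta>_def by blast+
    have n: "n \<in> N" "std M \<zero> n"
      using app[OF dom(3) std(3)] app_dom std_app zero_dom zero_std unfolding n_def by blast+
    have bn: "b \<bullet> n \<in> N" using app_dom[OF b(1) n(1)] .
    have "on_path (\<lambda>u. T2 \<bullet> K u) \<alpha> (g \<bullet> \<alpha>)"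
    proof (rule FQR[OF T2(1) b2(1) g(1) refl \<alpha>_def \<beta>_def n_def])
      \<comment> \<open>The relativized tree axioms apply because \<open>\<beta>\<close> is
        standard, being a value of the standard functional \<open>Q\<close>.\<close>
      show "node (\<lambda>u. T2 \<bullet> K u) \<beta> n"
        using nodes \<beta> n node_cong[of "\<lambda>u. T2 \<bullet> K u" "app M T"] T2(3) by blast
      show "lh (b2 \<bullet> K n) = n" "T2 \<bullet> K (b2 \<bullet> K n) = one"
        using b(3)[OF n] by (simp_all add: b2 T2 n bn)
    qed
    then have "on_path (app M T) \<alpha> (g \<bullet> \<alpha>)"
      using on_path_cong[of "\<lambda>u. T2 \<bullet> K u" "app M T"] T2(3) \<alpha>(1) app_dom[OF g(1) \<alpha>(1)] by blast
    then show False using g(3) \<alpha> by blast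
  qed
qed

text \<open>Choice tolerates the counterexample \<open>T\<close> as a parameter but transfer does
  not. So \<open>T\<close> and its Skolem functionals are made standard together, by transferring
  the existence of such a triple.\<close>

lemma WKL_st_imp_WKL:
  assumes WKL_st: "sat M e (rel_st WKL)"
  shows "sat M e WKL"
proof (rule ccontr)
  assume "\<not> ?thesis"
  then obtain T where T: "T \<in> N1" "\<forall>\<beta>\<in>N. \<forall>n\<in>N. node (app M T) \<beta> n"
    "\<forall>n\<in>N. \<exists>\<beta>\<in>N. lh \<beta> = n \<and> T \<bullet> \<beta> = one" "\<forall>\<alpha>\<in>N1. \<exists>n\<in>N. \<not> on_path (app M T) \<alpha> n"
    unfolding sat_WKL by blast
  let ?e = "case_nat T e"
  obtain b where b: "b \<in> dom M two_ty" "\<And>x. x \<in> N1 \<Longrightarrow> lh (b \<bullet> x) = x \<bullet> zero \<and> T \<bullet> (b \<bullet> x) = one"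
  proof -
    \<comment> \<open>A node of each length is chosen by a functional of type 1 arguments, the only
      domain available in \<open>B0\<close>; the length is the value
      \<open>x \<bullet> zero\<close>.\<close>
    let ?A = "len0 \<cdot> Var 0 \<^bold>= Var 1 \<cdot> zer \<^bold>\<and> Var 2 \<cdot> Var 0 \<^bold>= num1"
    have ex: "\<exists>ys. members M [\<zero>] ys \<and> sat M (shift (ys @ xs) ?e) ?A" if xs: "members M [\<one>] xs" for xs
    proof -
      obtain x where x: "xs = [x]" "x \<in> N1" using xs by (auto simp: members_Cons)
      obtain \<beta> where "\<beta> \<in> N" "lh \<beta> = x \<bullet> zero" "T \<bullet> \<beta> = one"
        using T(3) app_dom[OF x(2) zero_dom] by blast
      then show ?thesis using x by (intro exI[of _ "[\<beta>]"]) simp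
    qed
    have "\<exists>Ys. members M (map (\<lambda>\<tau>. foldr Fun (rev [\<one>]) \<tau>) [\<zero>]) Ys \<and>
        sat M (shift Ys ?e) (binds All [\<one>] (subst (skolem_sub [\<one>] [\<zero>]) ?A))"
      by (rule qf_choice[where m = 1 and n = 0 and E = "[\<one>]"]) (use T(1) ex in auto)
    then obtain b where "b \<in> dom M two_ty"
      "sat M (shift [b] ?e) (binds All [\<one>] (subst (skolem_sub [\<one>] [\<zero>]) ?A))"
      by (force simp: members_Cons)
    moreover from this have "sat M (shift [b \<bullet> x, x] ?e) ?A" if "x \<in> N1" for x
      using sat_skolem_sub[of "[x]" "[\<one>]" "[b]" "[\<zero>]" M ?e ?A] that
      by (auto simp: sat_binds_All members_Cons simp del: binds.simps)
    ultimately show ?thesis using that by auto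
  qed
  obtain g where g: "g \<in> dom M two_ty" "\<And>\<alpha>. \<alpha> \<in> N1 \<Longrightarrow> \<not> on_path (app M T) \<alpha> (g \<bullet> \<alpha>)"
  proof -
    let ?A = "\<^bold>\<not> (Var 1 \<cdot> Var 0 \<^bold>\<le> num1 \<^bold>\<and> Var 2 \<cdot> (seg \<cdot> Var 1 \<cdot> Var 0) \<^bold>= num1)"
    have ex: "\<exists>ys. members M [\<zero>] ys \<and> sat M (shift (ys @ xs) ?e) ?A" if xs: "members M [\<one>] xs" for xs
    proof -
      obtain \<alpha> where \<alpha>: "xs = [\<alpha>]" "\<alpha> \<in> N1" using xs by (auto simp: members_Cons)
      obtain n where "n \<in> N" "\<not> on_path (app M T) \<alpha> n" using T(4) \<alpha>(2) by blast
      then show ?thesis using \<alpha> by (intro exI[of _ "[n]"]) (simp add: on_path_def)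
    qed
    have "\<exists>Ys. members M (map (\<lambda>\<tau>. foldr Fun (rev [\<one>]) \<tau>) [\<zero>]) Ys \<and>
        sat M (shift Ys ?e) (binds All [\<one>] (subst (skolem_sub [\<one>] [\<zero>]) ?A))"
      by (rule qf_choice[where m = 1 and n = 0 and E = "[\<one>]"]) (use T(1) ex in auto)
    then obtain g where "g \<in> dom M two_ty"
      "sat M (shift [g] ?e) (binds All [\<one>] (subst (skolem_sub [\<one>] [\<zero>]) ?A))"
      by (force simp: members_Cons)
    moreover from this have "sat M (shift [g \<bullet> x, x] ?e) ?A" if "x \<in> N1" for x
      using sat_skolem_sub[of "[x]" "[\<one>]" "[g]" "[\<zero>]" M ?e ?A] that
      by (auto simp: sat_binds_All members_Cons simp del: binds.simps)
    ultimately show ?thesis using that by (auto simp: on_path_def)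
  qed
  \<comment> \<open>With \<open>b\<close> and \<open>g\<close> named, infinity of the tree and
    absence of a path become universal statements, which a standard triple satisfies at all
    arguments.\<close>
  let ?\<Delta> = "[\<one>, two_ty, two_ty]"
  let ?\<phi> = "binary_tree (Var 0)
    \<^bold>\<and> All \<one> (len0 \<cdot> (Var 2 \<cdot> Var 0) \<^bold>= Var 0 \<cdot> zer \<^bold>\<and> Var 1 \<cdot> (Var 2 \<cdot> Var 0) \<^bold>= num1)
    \<^bold>\<and> All \<one> (\<^bold>\<not> (Var 0 \<cdot> (Var 3 \<cdot> Var 0) \<^bold>\<le> num1 \<^bold>\<and> Var 1 \<cdot> (seg \<cdot> Var 0 \<cdot> (Var 3 \<cdot> Var 0)) \<^bold>= num1))"
  have tree: "sat M (case_nat T e) (binary_tree (Var 0)) \<longleftrightarrow> (\<forall>\<beta>\<in>N. \<forall>n\<in>N. node (app M T) \<beta> n)" for T e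
    by (simp add: binary_tree_def binary_fun_def in_tree_def node_def ball_conj_distrib)
  have \<phi>: "sat M (shift [T, b, g] e) ?\<phi> \<longleftrightarrow> (\<forall>\<beta>\<in>N. \<forall>n\<in>N. node (app M T) \<beta> n)
      \<and> (\<forall>x\<in>N1. lh (b \<bullet> x) = x \<bullet> zero \<and> T \<bullet> (b \<bullet> x) = one)
      \<and> (\<forall>\<alpha>\<in>N1. \<not> on_path (app M T) \<alpha> (g \<bullet> \<alpha>))" for T b g
    by (simp add: tree on_path_def)
  have "internal ?\<phi>" "wff ?\<Delta> ?\<phi>"
    by (simp_all add: binary_tree_def binary_fun_def in_tree_def)
  moreover have "members M ?\<Delta> [T, b, g]" using T(1) b(1) g(1) by simp
  moreover have "sat M (shift [T, b, g] e) ?\<phi>" unfolding \<phi> using T(2) b(2) g(2) by blast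
  ultimately have "\<exists>xs. members M ?\<Delta> xs \<and> list_all2 (std M) ?\<Delta> xs \<and> sat M (shift xs e) ?\<phi>"
    by (rule transfer_ex)
  then obtain T b g where mem: "members M ?\<Delta> [T, b, g]" "list_all2 (std M) ?\<Delta> [T, b, g]"
    and sat: "sat M (shift [T, b, g] e) ?\<phi>"
    unfolding members_Cons members_Nil by blast
  have std: "T \<in> N1" "std M \<one> T" "b \<in> dom M two_ty" "std M two_ty b" "g \<in> dom M two_ty" "std M two_ty g"
    using mem by simp_all
  have *: "\<forall>\<beta>\<in>N. \<forall>n\<in>N. node (app M T) \<beta> n" "\<And>x. x \<in> N1 \<Longrightarrow> lh (b \<bullet> x) = x \<bullet> zero \<and> T \<bullet> (b \<bullet> x) = one"
    "\<And>\<alpha>. \<alpha> \<in> N1 \<Longrightarrow> \<not> on_path (app M T) \<alpha> (g \<bullet> \<alpha>)"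
    using sat unfolding \<phi> by blast+
  \<comment> \<open>Standardness of \<open>b\<close> and \<open>n\<close> makes the node
    \<open>b \<bullet> K n\<close> standard, as the relativized hypothesis demands.\<close>
  have "\<exists>\<beta>\<in>N. std M \<zero> \<beta> \<and> lh \<beta> = n \<and> T \<bullet> \<beta> = one" if n: "n \<in> N" "std M \<zero> n" for n
  proof (intro bexI conjI)
    show "b \<bullet> K n \<in> N" using app_dom[OF std(3) K_dom[OF n(1)]] .
    show "std M \<zero> (b \<bullet> K n)" using std_app[OF std(3) K_dom[OF n(1)] std(4) K_std[OF n]] .
  qed (use *(2)[OF K_dom[OF n(1)]] in \<open>simp_all add: K_apply n zero_dom\<close>)
  then obtain \<alpha> where \<alpha>: "\<alpha> \<in> N1" "std M \<one> \<alpha>" "\<forall>n\<in>N. std M \<zero> n \<longrightarrow> on_path (app M T) \<alpha> n"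
    using WKL_st std(1,2) *(1) unfolding rel_st_WKL by blast
  \<comment> \<open>The standard path is only known to be good at standard numbers, and
    \<open>g \<bullet> \<alpha>\<close> is one of them.\<close>
  then show False
    using *(3) app_dom[OF std(5) \<alpha>(1)] std_app[OF std(5) \<alpha>(1) std(6) \<alpha>(2)] by blast
qed

end

theorem theorem4p7:
  shows "B0 \<union> qf_ac 2 1 \<tturnstile> WKL \<^bold>\<longleftrightarrow> rel_st WKL"
proof (rule completeness)
  show "efa_st \<subseteq> B0 \<union> qf_ac 2 1" by (auto simp: B0_def)
  show "wff [] (WKL \<^bold>\<longleftrightarrow> rel_st WKL)"
    by (simp add: WKL_def binary_tree_def binary_fun_def in_tree_def)
  fix M :: "trm set interp" and e
  assume "model (B0 \<union> qf_ac 2 1) M"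
  then interpret b0_model M by (rule b0_model.intro)
  show "sat M e (WKL \<^bold>\<longleftrightarrow> rel_st WKL)"
    using WKL_imp_WKL_st[of e] WKL_st_imp_WKL[of e] by auto
qed

end
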